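(* Let $\{\mathbf X_t\}_{t\in\mathbb N}=\{(X_{1,t},X_{2,t})^T\}_{t\in\mathbb N}$ be a strictly stationary BRCMNBINAR(1) process, i.e. $X_{i,t}=\alpha_{i,t}\diamond X_{i,t-1}+Z_{i,t}$, $i=1,2$. Then for $t\ge 1$, $k\ge 0$, $i,j\in\{1,2\}$ with $i\neq j$: (i) $E(X_{i,t+1}\mid X_{1,t},X_{2,t})=\alpha_i(X_{i,t}+1)+\mu_i$; $\mathrm{Var}(X_{i,t+1}\mid X_{1,t},X_{2,t})=\sigma_{\alpha_i}^2(X_{i,t}+1)^2+(\sigma_{\alpha_i}^2+\alpha_i^2+\alpha_i)(X_{i,t}+1)+\sigma_{Z_i}^2$; $\mathrm{Cov}(X_{1,t+1},X_{2,t+1}\mid X_{1,t},X_{2,t})=\phi$. (ii) $E(X_{i,t})=\dfrac{m_i+l\mu_i}{l-m_i}$; $\mathrm{Var}(X_{i,t})=\Big[(\sigma_{\alpha_i}^2+\alpha_i^2+\alpha_i)\dfrac{l(\mu_i+1)}{l-m_i}+\dfrac{m_i(m_i+l)(\mu_i+1)^2}{(l-1)(l-m_i)^2}+\sigma_{Z_i}^2\Big]\Big/(1-\alpha_i^2-\sigma_{\alpha_i}^2)$; $\mathrm{Cov}(X_{i,t+k},X_{i,t})=\alpha_i^k\,\mathrm{Var}(X_{i,t})$; $\mathrm{Corr}(X_{i,t+k},X_{i,t})=\alpha_i^k$. (iii) $\mathrm{Cov}(X_{1,t},X_{2,t})=\dfrac{l^2\phi}{l^2-m_1m_2}$; $\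mathrm{Cov}(X_{i,t+k},X_{j,t})=\dfrac{m_i^k\phi}{l^k-l^{k-2}m_1m_2}$.
   Context: $\mathbb N_0=\{0,1,2,\dots\}$. Modified negative binomial operator: for $\alpha>0$ and an $\mathbb N_0$-valued random variable $X$, $\alpha\diamond X=\sum_{j=1}^{X+1}G_j$, where $\{G_j\}$ are i.i.d. geometric with parameter $\frac{\alpha}{1+\alpha}$, i.e. $P(G_j=k)=\frac{\alpha^k}{(1+\alpha)^{k+1}}$, $k\in\mathbb N_0$ (mean $\alpha$), independent of $X$. When $\alpha$ is random, this is understood conditionally on $\alpha$. BRCMNBINAR(1) process: an $\mathbb N_0^2$-valued process $\mathbf X_t=(X_{1,t},X_{2,t})^T$ with $X_{i,t}=\alpha_{i,t}\diamond X_{i,t-1}+Z_{i,t}$, $i=1,2$, $t\in\mathbb N$, where: (i) for $i=1,2$, $\{\alpha_{i,t}\}_t$ is i.i.d. Beta prime with density $f(x)=x^{m_i-1}(1+x)^{-m_i-l-1}/B(m_i,l+1)$, $x>0$ ($B$ is the Beta function), where $l>1$ is a known constant and $0<m_i<l$; so $E(\alpha_{i,t})=\alpha_i=m_i/l$ and $\mathrm{Var}(\alpha_{i,t})=\sigma_{\alpha_i}^2=\frac{m_i(m_i+l)}{(l-1)l^2}$; $\{\alpha_{1,t}\}$ and $\{\alpha_{2,t}\}$ are mutually independent; (ii) $\mathbf Z_t=(Z_{1,t},Z_{2,t})^T$ are i.i.d. $\mathbb N_0^2$-valued random vectors with joint pmf $f_{\mathbf Z}(x,y)$, $E(Z_{i,t})=\mu_i$,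 $\mathrm{Var}(Z_{i,t})=\sigma_{Z_i}^2<\infty$, $\mathrm{Cov}(Z_{1,t},Z_{2,t})=\phi$; $\mathbf Z_t$ is independent of $(\alpha_{1,t}\diamond X_{1,t-1},\alpha_{2,t}\diamond X_{2,t-1})$ and of $\mathbf X_s$ for $s<t$; (iii) given the coefficients $\alpha_{i,t}$, the counting variables $G_j$ used in different components $i$ and at different times $t$ are independent; the triples (coefficients $(\alpha_{1,t},\alpha_{2,t})$, counting variables at time $t$, $\mathbf Z_t$) are independent over $t$ and independent of $\mathbf X_s$, $s<t$; (iv) $(m_1,\mu_1)\neq(m_2,\mu_2)$.
   Formalization: The Var, Cov(X_{i,t+k},X_{i,t}) and Corr formulas in (ii) are stated when X_{i,t} has finite second moment, which is proved if 1-α_i²-σ_{α_i}²>0 (i.e. m_i<l-1); for l-1≤m_i<l the stationary variance is infinite and the stated formula fails. *)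

theory Defs
  imports "HOL-Probability.Probability"
begin

section \<open>Moments and conditional moments\<close>

definition covariance :: "'w measure \<Rightarrow> ('w \<Rightarrow> real) \<Rightarrow> ('w \<Rightarrow> real) \<Rightarrow> real" where
  "covariance M X Y =
    (\<integral>\<omega>. (X \<omega> - prob_space.expectation M X) * (Y \<omega> - prob_space.expectation M Y) \<partial>M)"

definition correlation :: "'w measure \<Rightarrow> ('w \<Rightarrow> real) \<Rightarrow> ('w \<Rightarrow> real) \<Rightarrow> real" where
  "correlation M X Y =
    covariance M X Y / (sqrt (prob_space.variance M X) * sqrt (prob_space.variance M Y))"

text \<open>
  The constant \<^const>\<open>real_cond_exp\<close> is defined through the extended nonnegative conditional
  expectations of the positive and the negative part, so the following conditional moments are
  meaningful whenever those are almost surely finite, even if the unconditional second moments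
  are infinite.
\<close>

definition cond_covariance ::
    "'w measure \<Rightarrow> 'w measure \<Rightarrow> ('w \<Rightarrow> real) \<Rightarrow> ('w \<Rightarrow> real) \<Rightarrow> 'w \<Rightarrow> real" where
  "cond_covariance M F X Y =
    real_cond_exp M F (\<lambda>\<omega>. (X \<omega> - real_cond_exp M F X \<omega>) * (Y \<omega> - real_cond_exp M F Y \<omega>))"

definition cond_variance :: "'w measure \<Rightarrow> 'w measure \<Rightarrow> ('w \<Rightarrow> real) \<Rightarrow> 'w \<Rightarrow> real" where
  "cond_variance M F X = real_cond_exp M F (\<lambda>\<omega>. (X \<omega> - real_cond_exp M F X \<omega>)\<^sup>2)"


section \<open>Independence and stationarity\<close>

text \<open>
  The library's \<open>indep_var\<close> forces both variables to have the same value type; this is the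
  same notion for two different value types.
\<close>

definition (in prob_space) indep_rv ::
    "'b measure \<Rightarrow> ('a \<Rightarrow> 'b) \<Rightarrow> 'c measure \<Rightarrow> ('a \<Rightarrow> 'c) \<Rightarrow> bool" where
  "indep_rv S U T V \<longleftrightarrow>
    random_variable S U \<and> random_variable T V \<and>
    indep_set {U -` A \<inter> space M |A. A \<in> sets S} {V -` B \<inter> space M |B. B \<in> sets T}"

text \<open>Strict stationarity of a process with time index \<open>1, 2, \<dots>\<close> (time \<open>0\<close> is not constrained).\<close>

definition strictly_stationary :: "'w measure \<Rightarrow> 'b measure \<Rightarrow> (nat \<Rightarrow> 'w \<Rightarrow> 'b) \<Rightarrow> bool" where
  "strictly_stationary M S Y \<longleftrightarrow>
    (\<forall>h T. finite T \<and> T \<subseteq> {1..} \<longrightarrow>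
      distr M (\<Pi>\<^sub>M t\<in>T. S) (\<lambda>\<omega>. \<lambda>t\<in>T. Y (t + h) \<omega>) =
      distr M (\<Pi>\<^sub>M t\<in>T. S) (\<lambda>\<omega>. \<lambda>t\<in>T. Y t \<omega>))"


section \<open>The BRCMNBINAR(1) process\<close>

definition beta_prime_density :: "real \<Rightarrow> real \<Rightarrow> real \<Rightarrow> real" where
  "beta_prime_density m l x =
    (if 0 < x then x powr (m - 1) * (1 + x) powr (- m - l - 1) / Beta m (l + 1) else 0)"

text \<open>Mean and variance of the distribution with density \<open>beta_prime_density m l\<close>.\<close>

definition coef_mean :: "real \<Rightarrow> real \<Rightarrow> real" where
  "coef_mean m l = m / l"

definition coef_var :: "real \<Rightarrow> real \<Rightarrow> real" where
  "coef_var m l = m * (m + l) / ((l - 1) * l\<^sup>2)"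

definition nb_thinning :: "(nat \<Rightarrow> 'w \<Rightarrow> nat) \<Rightarrow> ('w \<Rightarrow> nat) \<Rightarrow> 'w \<Rightarrow> nat" where
  "nb_thinning G X \<omega> = (\<Sum>j\<in>{1..X \<omega> + 1}. G j \<omega>)"

definition geom_prob :: "real \<Rightarrow> nat \<Rightarrow> real" where
  "geom_prob a k = a ^ k / (1 + a) ^ (k + 1)"

text \<open>
  Components are indexed by \<open>i \<in> {1, 2}\<close>, times by \<open>t \<ge> 1\<close> (with initial state \<open>X i 0\<close>), and
  \<open>G i t j\<close>, \<open>j \<ge> 1\<close>, are the counting variables of component \<open>i\<close> at time \<open>t\<close>, so that
  \<open>\<alpha>\<^sub>i\<^sub>,\<^sub>t \<diamondop> X\<^sub>i\<^sub>,\<^sub>t\<^sub>-\<^sub>1\<close> is \<open>nb_thinning (G i t) (X i (t - 1))\<close>. That the counting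
  variables are conditionally i.i.d. geometric given the random coefficients is expressed by
  the conditional probabilities of the finite-dimensional events, given the \<open>\<sigma>\<close>-algebra
  generated by all coefficients; independence of the states is part of \<open>indep_innov_past\<close>.
\<close>

locale brcmnbinar = prob_space M for M :: "'w measure" +
  fixes m \<mu> \<sigma>Z :: "nat \<Rightarrow> real" and l \<phi> :: real and fZ :: "(nat \<times> nat) pmf"
    and \<alpha> :: "nat \<Rightarrow> nat \<Rightarrow> 'w \<Rightarrow> real"
    and G :: "nat \<Rightarrow> nat \<Rightarrow> nat \<Rightarrow> 'w \<Rightarrow> nat"
    and Z X :: "nat \<Rightarrow> nat \<Rightarrow> 'w \<Rightarrow> nat"
  assumes l_gt_1: "1 < l"
    and m_bounds: "\<And>i. i \<in> {1, 2} \<Longrightarrow> 0 < m i \<and> m i < l"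
    and params_neq: "(m 1, \<mu> 1) \<noteq> (m 2, \<mu> 2)"
    and X_rv: "\<And>i t. i \<in> {1, 2} \<Longrightarrow> random_variable (count_space UNIV) (X i t)"
    and Z_rv: "\<And>i t. i \<in> {1, 2} \<Longrightarrow> 1 \<le> t \<Longrightarrow> random_variable (count_space UNIV) (Z i t)"
    and G_rv: "\<And>i t j. i \<in> {1, 2} \<Longrightarrow> 1 \<le> t \<Longrightarrow> 1 \<le> j \<Longrightarrow>
                 random_variable (count_space UNIV) (G i t j)"
    and recursion: "\<And>i t \<omega>. i \<in> {1, 2} \<Longrightarrow> 1 \<le> t \<Longrightarrow> \<omega> \<in> space M \<Longrightarrow>
                 X i t \<omega> = nb_thinning (G i t) (X i (t - 1)) \<omega> + Z i t \<omega>"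
    and coef_density: "\<And>i t. i \<in> {1, 2} \<Longrightarrow> 1 \<le> t \<Longrightarrow>
                 distributed M lborel (\<alpha> i t) (\<lambda>x. ennreal (beta_prime_density (m i) l x))"
    and coef_indep_time: "\<And>i. i \<in> {1, 2} \<Longrightarrow> indep_vars (\<lambda>_. borel) (\<alpha> i) {1..}"
    and coef_indep_comp:
      "indep_var (\<Pi>\<^sub>M t\<in>{1..}. borel) (\<lambda>\<omega>. \<lambda>t\<in>{1..}. \<alpha> 1 t \<omega>)
                 (\<Pi>\<^sub>M t\<in>{1..}. borel) (\<lambda>\<omega>. \<lambda>t\<in>{1..}. \<alpha> 2 t \<omega>)"
    and counting_cond:
      "\<And>J g. finite J \<Longrightarrow> J \<subseteq> {1, 2} \<times> {1..} \<times> {1..} \<Longrightarrow>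
        AE \<omega> in M.
          real_cond_exp M
            (vimage_algebra (space M) (\<lambda>\<omega>. \<lambda>(i, t)\<in>{1, 2} \<times> {1..}. \<alpha> i t \<omega>)
              (\<Pi>\<^sub>M p\<in>{1, 2} \<times> {1..}. borel))
            (indicator {\<omega> \<in> space M. \<forall>(i, t, j)\<in>J. G i t j \<omega> = g (i, t, j)}) \<omega>
          = (\<Prod>(i, t, j)\<in>J. geom_prob (\<alpha> i t \<omega>) (g (i, t, j)))"
    and Z_pmf: "\<And>t. 1 \<le> t \<Longrightarrow>
                 distr M (count_space UNIV) (\<lambda>\<omega>. (Z 1 t \<omega>, Z 2 t \<omega>)) = measure_pmf fZ"
    and Z_indep: "indep_vars (\<lambda>_. count_space UNIV) (\<lambda>t \<omega>. (Z 1 t \<omega>, Z 2 t \<omega>)) {1..}"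
    and Z_square_integrable: "\<And>i t. i \<in> {1, 2} \<Longrightarrow> 1 \<le> t \<Longrightarrow> integrable M (\<lambda>\<omega>. (real (Z i t \<omega>))\<^sup>2)"
    and Z_mean: "\<And>i t. i \<in> {1, 2} \<Longrightarrow> 1 \<le> t \<Longrightarrow> expectation (\<lambda>\<omega>. real (Z i t \<omega>)) = \<mu> i"
    and Z_var: "\<And>i t. i \<in> {1, 2} \<Longrightarrow> 1 \<le> t \<Longrightarrow> variance (\<lambda>\<omega>. real (Z i t \<omega>)) = (\<sigma>Z i)\<^sup>2"
    and Z_cov: "\<And>t. 1 \<le> t \<Longrightarrow>
                 covariance M (\<lambda>\<omega>. real (Z 1 t \<omega>)) (\<lambda>\<omega>. real (Z 2 t \<omega>)) = \<phi>"
    and Z_indep_thinning_past: "\<And>t. 1 \<le> t \<Longrightarrow>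
      indep_rv (count_space UNIV) (\<lambda>\<omega>. (Z 1 t \<omega>, Z 2 t \<omega>))
        (count_space UNIV \<Otimes>\<^sub>M (\<Pi>\<^sub>M s\<in>{..<t}. count_space UNIV))
        (\<lambda>\<omega>. ((nb_thinning (G 1 t) (X 1 (t - 1)) \<omega>, nb_thinning (G 2 t) (X 2 (t - 1)) \<omega>),
              \<lambda>s\<in>{..<t}. (X 1 s \<omega>, X 2 s \<omega>)))"
    and innov_indep:
      "indep_vars
        (\<lambda>_. (borel \<Otimes>\<^sub>M borel) \<Otimes>\<^sub>M (\<Pi>\<^sub>M p\<in>{1, 2} \<times> {1..}. count_space UNIV) \<Otimes>\<^sub>M count_space UNIV)
        (\<lambda>t \<omega>. ((\<alpha> 1 t \<omega>, \<alpha> 2 t \<omega>), (\<lambda>(i, j)\<in>{1, 2} \<times> {1..}. G i t j \<omega>), (Z 1 t \<omega>, Z 2 t \<omega>)))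
        {1..}"
    and indep_innov_past: "\<And>t. 1 \<le> t \<Longrightarrow>
      indep_rv
        ((borel \<Otimes>\<^sub>M borel) \<Otimes>\<^sub>M (\<Pi>\<^sub>M p\<in>{1, 2} \<times> {1..}. count_space UNIV) \<Otimes>\<^sub>M count_space UNIV)
        (\<lambda>\<omega>. ((\<alpha> 1 t \<omega>, \<alpha> 2 t \<omega>), (\<lambda>(i, j)\<in>{1, 2} \<times> {1..}. G i t j \<omega>), (Z 1 t \<omega>, Z 2 t \<omega>)))
        (\<Pi>\<^sub>M s\<in>{..<t}. count_space UNIV)
        (\<lambda>\<omega>. \<lambda>s\<in>{..<t}. (X 1 s \<omega>, X 2 s \<omega>))"

text \<open>The \<open>\<sigma>\<close>-algebra generated by \<open>(X\<^sub>1\<^sub>,\<^sub>t, X\<^sub>2\<^sub>,\<^sub>t)\<close>.\<close>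

definition state_algebra :: "'w measure \<Rightarrow> (nat \<Rightarrow> nat \<Rightarrow> 'w \<Rightarrow> nat) \<Rightarrow> nat \<Rightarrow> 'w measure" where
  "state_algebra M X t =
    vimage_algebra (space M) (\<lambda>\<omega>. (X 1 t \<omega>, X 2 t \<omega>)) (count_space UNIV)"

end

theory Submission
  imports Defs
begin

text \<open>
  The innovations at time \<open>t\<close> are independent of the past, so given the state \<open>x\<close> the moments
  of the next state are those of sums of \<open>x + 1\<close> counting variables plus those of \<open>Z\<close>; the moments of
  the counting variables are mixtures of geometric moments, hence polynomials in the first two
  moments of the beta prime law. All one-step identities are proved for nonnegative integrals weighted by an
  arbitrary nonnegative function of an earlier state; therefore they need no integrability.
  Integrability of \<open>X\<^sub>i\<close>, \<open>X\<^sub>i\<^sup>2\<close> and \<open>X\<^sub>1 X\<^sub>2\<close> under the stationary law follows from a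
  Foster--Lyapunov argument: each conditional expectation equals a factor below \<open>1\<close> times the
  current value plus terms already known to be integrable. Stationarity then turns the one-step identities into linear
  equations for the moments, and iterating them gives the lagged covariances.
\<close>

subsection \<open>Geometric and beta prime moments\<close>

text \<open>Strict stationarity brings no moment assumption. The coefficients are unbounded, so
  their second moment can reach or exceed 1 although their mean \<open>m i / l\<close> stays below
  1, and the states may then have infinite variance. Hence square integrability is derived under
  \<open>coef_sq_mean i < 1\<close>, a condition that a finite second moment forces in turn. The
  product of the two components behaves better: by independence of the two coefficients its
  contraction factor is the product of their means, so covariances across components exist in all
  cases. The weight makes a single one-step identity serve several purposes: an atom indicator
  yields conditional moments, the indicator of a sublevel set of the drift function yields the
  truncated inequality behind integrability, and a component of an earlier state yields lagged
  products. Extended nonnegative values do not allow free subtraction, so raw second and product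
  moments are propagated rather than variances and covariances, and the possibly negative \<phi> is
  always kept together with a product of means that makes the sum nonnegative.\<close>

lemma square_times_power_limit_0:
  fixes r :: real
  assumes "0 \<le> r" "r < 1"
  shows "(\<lambda>k. real k ^ 2 * r ^ k) \<longlonglongrightarrow> 0"
proof -
  \<comment> \<open>The sequence in question is the square of this one, and
    \<open>sqrt r < 1\<close> still holds.\<close>
  have "(\<lambda>k. real k * sqrt r ^ k) \<longlonglongrightarrow> 0"
    using assms by (intro powser_times_n_limit_0) auto
  from tendsto_mult[OF this this] show ?thesis
    using assms by (simp add: power2_eq_square mult.assoc mult.left_commute power_mult_distrib[symmetric])
qed

lemma geom_prob_moments:
  assumes "0 < a"
  shows geom_prob_sums: "(\<lambda>k. geom_prob a k) sums 1"
    and geom_prob_mean: "(\<lambda>k. real k * geom_prob a k) sums a"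
    and geom_prob_second_moment: "(\<lambda>k. real k ^ 2 * geom_prob a k) sums (a + 2 * a\<^sup>2)"
proof -
  define r where "r = a / (1 + a)"
  have r: "0 \<le> r" "r < 1" using assms by (auto simp: r_def)
  have gp: "geom_prob a k = (1 - r) * r ^ k" for k
    using assms by (simp add: geom_prob_def r_def power_divide field_simps)
  \<comment> \<open>This relation between the ratio and the mean is what makes the polynomial
    coefficients below match.\<close>
  have ra: "r * a = a - r" using assms by (simp add: r_def field_simps)
  have lims: "(\<lambda>k. r ^ k) \<longlonglongrightarrow> 0" "(\<lambda>k. real k * r ^ k) \<longlonglongrightarrow> 0"
    "(\<lambda>k. real k ^ 2 * r ^ k) \<longlonglongrightarrow> 0"
    using r by (auto intro!: LIMSEQ_power_zero powser_times_n_limit_0 square_times_power_limit_0)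
  \<comment> \<open>The summands \<open>k\<^sup>n P(G = k)\<close> telescope with a polynomial multiple of \<open>r\<^sup>k\<close> as antidifference.\<close>
  have gen: "(\<lambda>k. (A * real k ^ 2 + B * real k + C) * r ^ k
      - (A * real (Suc k) ^ 2 + B * real (Suc k) + C) * r ^ Suc k) sums C" for A B C
  proof -
    have "(\<lambda>k. A * (real k ^ 2 * r ^ k) + B * (real k * r ^ k) + C * r ^ k) \<longlonglongrightarrow> A * 0 + B * 0 + C * 0"
      by (intro tendsto_intros lims)
    hence "(\<lambda>k. (A * real k ^ 2 + B * real k + C) * r ^ k) \<longlonglongrightarrow> 0"
      by (simp add: algebra_simps)
    from telescope_sums'[OF this] show ?thesis by simp
  qed
  show "(\<lambda>k. geom_prob a k) sums 1"
    using gen[of 0 0 1] by (simp add: gp algebra_simps)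
  \<comment> \<open>The telescoping sum equals the value of the polynomial at 0, so the constant
    term has to be the moment itself.\<close>
  have "(real k + a) * r ^ k - (real (Suc k) + a) * r ^ Suc k = real k * geom_prob a k" for k
  proof -
    have "(real k + a) - (real (Suc k) + a) * r = real k * (1 - r)"
      using ra by (simp add: algebra_simps)
    hence "((real k + a) - (real (Suc k) + a) * r) * r ^ k = real k * geom_prob a k"
      by (simp add: gp)
    thus ?thesis by (simp only: left_diff_distrib power_Suc mult.assoc)
  qed
  thus "(\<lambda>k. real k * geom_prob a k) sums a"
    using gen[of 0 1 a] by simp
  \<comment> \<open>The coefficients solve \<open>p(k) - r * p(k + 1) = (1 - r) * k^2\<close> for a
    monic quadratic \<open>p\<close>: the linear one is \<open>2 * r / (1 - r) = 2 * a\<close>, and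
    the constant one is \<open>a * (1 + 2 * a)\<close>.\<close>
  have "(real k ^ 2 + 2 * a * real k + (a + 2 * a\<^sup>2)) * r ^ k
      - (real (Suc k) ^ 2 + 2 * a * real (Suc k) + (a + 2 * a\<^sup>2)) * r ^ Suc k
      = real k ^ 2 * geom_prob a k" for k
  proof -
    have ra2: "r * a\<^sup>2 = a\<^sup>2 - (a - r)" using ra by algebra
    have "(real k ^ 2 + 2 * a * real k + (a + 2 * a\<^sup>2)) 
      - (real (Suc k) ^ 2 + 2 * a * real (Suc k) + (a + 2 * a\<^sup>2)) * r
      = real k ^ 2 * (1 - r) + 2 * real k * (a - r - r * a) + (a - r - r * a) + 2 * (a\<^sup>2 - r * a - r * a\<^sup>2)"
      by (simp add: algebra_simps power2_eq_square)
    also have "\<dots> = real k ^ 2 * (1 - r)" using ra ra2 by simp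
    finally have "((real k ^ 2 + 2 * a * real k + (a + 2 * a\<^sup>2)) 
      - (real (Suc k) ^ 2 + 2 * a * real (Suc k) + (a + 2 * a\<^sup>2)) * r) * r ^ k = real k ^ 2 * geom_prob a k"
      by (simp add: gp)
    thus ?thesis by (simp only: left_diff_distrib power_Suc mult.assoc)
  qed
  thus "(\<lambda>k. real k ^ 2 * geom_prob a k) sums (a + 2 * a\<^sup>2)"
    using gen[of 1 "2 * a" "a + 2 * a\<^sup>2"] by simp
qed

lemma geom_prob_nonneg: "0 < a \<Longrightarrow> 0 \<le> geom_prob a k"
  by (simp add: geom_prob_def)

lemma geom_prob_suminf:
  assumes "0 < a"
  shows "(\<Sum>k. ennreal (geom_prob a k)) = 1"
    and "(\<Sum>k. ennreal (real k) * ennreal (geom_prob a k)) = ennreal a"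
    and "(\<Sum>k. ennreal (real k ^ 2) * ennreal (geom_prob a k)) = ennreal (a + 2 * a\<^sup>2)"
proof -
  note nn = geom_prob_nonneg[OF assms]
  show "(\<Sum>k. ennreal (geom_prob a k)) = 1"
    using suminf_ennreal_eq[OF nn geom_prob_sums[OF assms]] by simp
  have "(\<Sum>k. ennreal (real k * geom_prob a k)) = ennreal a"
    by (rule suminf_ennreal_eq[OF _ geom_prob_mean[OF assms]]) (simp add: nn)
  thus "(\<Sum>k. ennreal (real k) * ennreal (geom_prob a k)) = ennreal a"
    by (subst (asm) ennreal_mult) (simp_all add: nn)
  have "(\<Sum>k. ennreal (real k ^ 2 * geom_prob a k)) = ennreal (a + 2 * a\<^sup>2)"
    by (rule suminf_ennreal_eq[OF _ geom_prob_second_moment[OF assms]]) (simp add: nn)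
  thus "(\<Sum>k. ennreal (real k ^ 2) * ennreal (geom_prob a k)) = ennreal (a + 2 * a\<^sup>2)"
    by (subst (asm) ennreal_mult) (simp_all add: nn)
qed

text \<open>A nonnegative derivative whose antiderivative has finite limits at both ends is
  automatically integrable. Extended endpoints admit 0 and infinity, where only limits of the
  antiderivative are available.\<close>

lemma nn_integral_FTC_einterval:
  fixes f F :: "real \<Rightarrow> real" and a b :: ereal
  assumes "a < b"
    and F: "\<And>x. a < ereal x \<Longrightarrow> ereal x < b \<Longrightarrow> DERIV F x :> f x"
    and f: "\<And>x. a < ereal x \<Longrightarrow> ereal x < b \<Longrightarrow> isCont f x"
    and nonneg: "\<And>x. a < ereal x \<Longrightarrow> ereal x < b \<Longrightarrow> 0 \<le> f x"
    and A: "((F \<circ> real_of_ereal) \<longlongrightarrow> A) (at_right a)"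
    and B: "((F \<circ> real_of_ereal) \<longlongrightarrow> B) (at_left b)"
  shows "(\<integral>\<^sup>+x\<in>einterval a b. ennreal (f x) \<partial>lborel) = ennreal (B - A)"
proof -
  have int: "set_integrable lborel (einterval a b) f" "(LBINT x=a..b. f x) = B - A"
    by (rule interval_integral_FTC_nonneg[where F = F]; use assms in auto)+
  have "(\<integral>\<^sup>+x. ennreal (indicator (einterval a b) x *\<^sub>R f x) \<partial>lborel) = ennreal (B - A)"
    using int nonneg less_imp_le[OF \<open>a < b\<close>]
    unfolding set_integrable_def interval_lebesgue_integral_def set_lebesgue_integral_def
    by (subst nn_integral_eq_integral) (auto simp: einterval_def split: split_indicator)
  moreover have "ennreal (f x) * indicator (einterval a b) x = ennreal (indicator (einterval a b) x *\<^sub>R f x)" for x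
    by (simp split: split_indicator)
  ultimately show ?thesis by simp
qed

text \<open>
  Integrate the derivative of \<open>x\<^sup>p (1 + x)\<^sup>-\<^sup>p\<^sup>-\<^sup>q\<close> over the half line. The derivative changes sign only at
  \<open>x = p / q\<close>, and splitting there keeps every integral nonnegative, so that no integrability
  has to be known beforehand.
\<close>

lemma beta_prime_integral_rec:
  fixes p q :: real
  assumes p: "0 < p" and q: "0 < q"
  shows "ennreal p * (\<integral>\<^sup>+x\<in>{0<..}. ennreal (x powr (p - 1) * (1 + x) powr (- p - q - 1)) \<partial>lborel)
       = ennreal q * (\<integral>\<^sup>+x\<in>{0<..}. ennreal (x * (x powr (p - 1) * (1 + x) powr (- p - q - 1))) \<partial>lborel)"
proof -
  define w where "w x = x powr (p - 1) * (1 + x) powr (- p - q - 1)" for x :: real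
  define F where "F x = x powr p * (1 + x) powr (- p - q)" for x :: real
  define f where "f x = (p - q * x) * w x" for x :: real
  define x0 where "x0 = p / q"
  have x0: "0 < x0" using p q by (simp add: x0_def)
  have [measurable]: "w \<in> borel_measurable borel" unfolding w_def by measurable
  have [measurable]: "f \<in> borel_measurable borel" unfolding f_def by measurable
  have wnn: "0 \<le> w x" for x by (simp add: w_def)
  have F': "DERIV F x :> f x" if "0 < x" for x
  proof -
    have 1: "x powr p = x powr (p - 1) * x"
      using that powr_mult_base[of x "p - 1"] by (simp add: mult.commute)
    have 2: "(1 + x) powr (- p - q) = (1 + x) powr (- p - q - 1) * (1 + x)"
      using that powr_mult_base[of "1 + x" "- p - q - 1"] by (simp add: mult.commute)
    have d1: "DERIV (\<lambda>x. x powr p) x :> p * x powr (p - 1)"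
      by (rule has_real_derivative_powr[OF that])
    have d2: "DERIV (\<lambda>x. (1 + x) powr (- p - q)) x :> (- p - q) * (1 + x) powr (- p - q - 1) * (0 + 1)"
      using that by (intro DERIV_chain2[where f = "\<lambda>x. x powr (- p - q)"] has_real_derivative_powr DERIV_add DERIV_const DERIV_ident) simp
    have "p * x powr (p - 1) * (1 + x) powr (- p - q)
        + (- p - q) * (1 + x) powr (- p - q - 1) * (0 + 1) * x powr p = f x"
      unfolding f_def w_def 1 2 by algebra
    with DERIV_mult[OF d1 d2] show ?thesis unfolding F_def by simp
  qed
  have cont: "isCont f x" if "0 < x" for x
    using that unfolding f_def w_def by (intro continuous_intros) auto
  have lim0: "(F \<longlongrightarrow> 0) (at_right 0)"
  proof -
    have "((\<lambda>x. x powr p) \<longlongrightarrow> 0) (at_right (0::real))"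
      using p by (intro tendsto_eq_intros) (auto simp: eventually_at_filter)
    moreover have "((\<lambda>x. (1 + x) powr (- p - q)) \<longlongrightarrow> 1) (at_right (0::real))"
      by (rule tendsto_eq_intros refl | simp)+
    ultimately show ?thesis unfolding F_def using tendsto_mult by fastforce
  qed
  have liminf: "(F \<longlongrightarrow> 0) at_top"
  proof (rule tendsto_sandwich[of "\<lambda>_. 0" _ _ "\<lambda>x. x powr (- q)"])
    show "\<forall>\<^sub>F x in at_top. F x \<le> x powr (- q)"
    proof (rule eventually_mono[OF eventually_gt_at_top[of 0]])
      fix x :: real assume x: "0 < x"
      have "(1 + x) powr (- p - q) \<le> x powr (- p - q)"
        using x p q by (intro powr_mono2') auto
      hence "F x \<le> x powr p * x powr (- p - q)" unfolding F_def by (intro mult_left_mono) auto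
      also have "\<dots> = x powr (- q)" using x by (simp flip: powr_add)
      finally show "F x \<le> x powr (- q)" .
    qed
    show "((\<lambda>x. x powr (- q)) \<longlongrightarrow> 0) at_top" using q by (intro tendsto_neg_powr filterlim_ident) auto
  qed (auto simp: F_def)
  have fpos: "0 \<le> f x" if "x < x0" for x
  proof -
    have "q * x \<le> p" using that q by (simp add: x0_def field_simps)
    thus ?thesis using wnn[of x] by (simp add: f_def)
  qed
  have fneg: "0 \<le> - f x" if "x0 < x" for x
  proof -
    have "p \<le> q * x" using that q by (simp add: x0_def field_simps)
    thus ?thesis using wnn[of x] by (simp add: f_def mult_nonpos_nonneg)
  qed
  have eqs: "einterval 0 (ereal x0) = {0<..<x0}" "einterval (ereal x0) \<infinity> = {x0<..}"
    by (auto simp: einterval_def zero_ereal_def)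
  have A': "(\<integral>\<^sup>+x\<in>{0<..<x0}. ennreal (f x) \<partial>lborel) = ennreal (F x0 - 0)"
  proof (subst eqs(1)[symmetric], rule nn_integral_FTC_einterval[where F = F])
    show "((F \<circ> real_of_ereal) \<longlongrightarrow> 0) (at_right 0)"
      unfolding zero_ereal_def ereal_tendsto_simps by (rule lim0)
    show "((F \<circ> real_of_ereal) \<longlongrightarrow> F x0) (at_left (ereal x0))"
      unfolding ereal_tendsto_simps using DERIV_isCont[OF F'[OF x0]]
      unfolding isCont_def filterlim_at_split by blast
    fix x assume x: "0 < ereal x" "ereal x < ereal x0"
    show "DERIV F x :> f x" "isCont f x" using F' cont x by auto
    show "0 \<le> f x" using x fpos by auto
  qed (use x0 in auto)
  have B': "(\<integral>\<^sup>+x\<in>{x0<..}. ennreal (- f x) \<partial>lborel) = ennreal (- 0 - (- F x0))"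
  proof (subst eqs(2)[symmetric], rule nn_integral_FTC_einterval[where F = "\<lambda>x. - F x"])
    show "(((\<lambda>x. - F x) \<circ> real_of_ereal) \<longlongrightarrow> - F x0) (at_right (ereal x0))"
      unfolding ereal_tendsto_simps using DERIV_isCont[OF F'[OF x0]]
      unfolding isCont_def filterlim_at_split by (blast intro: tendsto_minus)
    show "(((\<lambda>x. - F x) \<circ> real_of_ereal) \<longlongrightarrow> - 0) (at_left \<infinity>)"
      unfolding ereal_tendsto_simps by (intro tendsto_minus liminf)
    fix x assume "ereal x0 < ereal x" 
    hence x: "x0 < x" "0 < x" using x0 by auto
    show "DERIV (\<lambda>x. - F x) x :> - f x" "isCont (\<lambda>x. - f x) x"
      using F'[OF x(2)] cont[OF x(2)] by (auto intro: DERIV_minus)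
    show "0 \<le> - f x" by (rule fneg[OF x(1)])
  qed simp
  \<comment> \<open>This is \<open>p * w = q * x * w + f\<close> with the negative part of
    \<open>f\<close> moved to the left, so that no subtraction occurs. The integrals of the two
    parts of \<open>f\<close> both equal \<open>F x0\<close>, which is finite and therefore
    cancels.\<close>
  have eq: "ennreal (p * w x) * indicator {0<..} x + ennreal (- f x) * indicator {x0<..} x
      = ennreal (q * (x * w x)) * indicator {0<..} x + ennreal (f x) * indicator {0<..<x0} x" for x
  proof -
    consider "x \<le> 0" | "0 < x" "x < x0" | "x = x0" | "x0 < x" by linarith
    thus ?thesis
    proof cases
      case 2
      hence "0 \<le> f x" using fpos by simp
      thus ?thesis using 2 wnn[of x] p q by (simp add: ennreal_plus[symmetric] f_def algebra_simps del: ennreal_plus)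
    next
      case 3 thus ?thesis using x0 q by (simp add: x0_def)
    next
      case 4
      hence "0 \<le> - f x" using fneg by simp
      thus ?thesis using 4 wnn[of x] p q x0 by (simp add: ennreal_plus[symmetric] f_def algebra_simps del: ennreal_plus)
    qed (use x0 in auto)
  qed
  have "(\<integral>\<^sup>+x\<in>{0<..}. ennreal (p * w x) \<partial>lborel) + (\<integral>\<^sup>+x\<in>{x0<..}. ennreal (- f x) \<partial>lborel)
      = (\<integral>\<^sup>+x\<in>{0<..}. ennreal (q * (x * w x)) \<partial>lborel) + (\<integral>\<^sup>+x\<in>{0<..<x0}. ennreal (f x) \<partial>lborel)"
    by (simp add: nn_integral_add[symmetric] eq)
  hence "(\<integral>\<^sup>+x\<in>{0<..}. ennreal (p * w x) \<partial>lborel) = (\<integral>\<^sup>+x\<in>{0<..}. ennreal (q * (x * w x)) \<partial>lborel)"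
    unfolding A' B' by (simp add: add.commute[of _ "ennreal (F x0)"] ennreal_add_left_cancel)
  thus ?thesis using p q
    by (simp add: w_def[symmetric] ennreal_mult' mult.assoc nn_integral_cmult)
qed

subsection \<open>Independence, conditioning on a discrete variable, drift conditions\<close>

lemma covariance_commute: "covariance M A B = covariance M B A"
  by (simp add: covariance_def mult.commute)

text \<open>The integrand is split over the values of \<open>N\<close>. The extra factor
  \<open>g\<close> allows a second application to another counting variable inside the
  first.\<close>

lemma nn_integral_nat_eq_suminf:
  fixes f :: "nat \<Rightarrow> ennreal"
  assumes [measurable]: "N \<in> measurable M (count_space UNIV)" "g \<in> borel_measurable M"
  shows "(\<integral>\<^sup>+\<omega>. f (N \<omega>) * g \<omega> \<partial>M) = (\<Sum>k. f k * (\<integral>\<^sup>+\<omega>. indicator {k} (N \<omega>) * g \<omega> \<partial>M))"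
proof -
  have [measurable]: "(\<lambda>\<omega>. indicator {k} (N \<omega>) :: ennreal) \<in> borel_measurable M" for k
    by (rule measurable_compose[OF assms(1)]) simp
  have "(\<integral>\<^sup>+\<omega>. f (N \<omega>) * g \<omega> \<partial>M) = (\<integral>\<^sup>+\<omega>. (\<Sum>k. f k * (indicator {k} (N \<omega>) * g \<omega>)) \<partial>M)"
  proof (rule nn_integral_cong)
    fix \<omega>
    have "(\<Sum>k. f k * (indicator {k} (N \<omega>) * g \<omega>)) = (\<Sum>k\<in>{N \<omega>}. f k * (indicator {k} (N \<omega>) * g \<omega>))"
      by (rule suminf_finite) auto
    thus "f (N \<omega>) * g \<omega> = (\<Sum>k. f k * (indicator {k} (N \<omega>) * g \<omega>))" by simp
  qed
  also have "\<dots> = (\<Sum>k. f k * (\<integral>\<^sup>+\<omega>. indicator {k} (N \<omega>) * g \<omega> \<partial>M))"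
    by (subst nn_integral_suminf) (auto intro!: suminf_cong nn_integral_cmult)
  finally show ?thesis .
qed

lemma measurable_add_count_space [measurable]:
  fixes f g :: "'a \<Rightarrow> nat"
  assumes "f \<in> measurable N (count_space UNIV)" "g \<in> measurable N (count_space UNIV)"
  shows "(\<lambda>x. f x + g x) \<in> measurable N (count_space UNIV)"
  by (rule measurable_compose_countable[OF measurable_compose[OF assms(2)] assms(1)]) simp

lemma measurable_sum_count_space:
  fixes f :: "'i \<Rightarrow> 'a \<Rightarrow> nat"
  assumes "\<And>i. i \<in> A \<Longrightarrow> f i \<in> measurable N (count_space UNIV)"
  shows "(\<lambda>x. \<Sum>i\<in>A. f i x) \<in> measurable N (count_space UNIV)"
  using assms by (induction A rule: infinite_finite_induct) (auto intro: measurable_add_count_space)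

section \<open>Integrals of independent variables with different value types, discrete conditioning,
  drift\<close>

context prob_space
begin

lemma expectation_eqI:
  assumes "f \<in> borel_measurable M" "\<And>\<omega>. 0 \<le> f \<omega>" "0 \<le> e" "(\<integral>\<^sup>+\<omega>. ennreal (f \<omega>) \<partial>M) = ennreal e"
  shows "expectation f = e"
  using has_bochner_integral_nn_integral[of f M e] assms by (simp add: has_bochner_integral_iff)

lemma covariance_eq:
  assumes "integrable M A" "integrable M B" "integrable M (\<lambda>\<omega>. A \<omega> * B \<omega>)"
  shows "covariance M A B = expectation (\<lambda>\<omega>. A \<omega> * B \<omega>) - expectation A * expectation B"
proof -
  have "covariance M A B = expectation (\<lambda>\<omega>. A \<omega> * B \<omega> - expectation B * A \<omega> - expectation A * B \<omega> + expectation A * expectation B)"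
    unfolding covariance_def by (intro Bochner_Integration.integral_cong) (auto simp: algebra_simps)
  also have "\<dots> = expectation (\<lambda>\<omega>. A \<omega> * B \<omega>) - expectation A * expectation B"
    using assms by (simp add: prob_space)
  finally show ?thesis .
qed

text \<open>Product measures are determined by rectangles, and on rectangles the claim is the
  definition of \<open>indep_rv\<close>. This opens the way to Tonelli's theorem.\<close>

lemma indep_rv_distr_pair:
  assumes "indep_rv S U T V"
  shows "distr M S U \<Otimes>\<^sub>M distr M T V = distr M (S \<Otimes>\<^sub>M T) (\<lambda>\<omega>. (U \<omega>, V \<omega>))"
proof -
  have [measurable]: "U \<in> measurable M S" "V \<in> measurable M T"
    and ind: "indep_set {U -` A \<inter> space M |A. A \<in> sets S} {V -` B \<inter> space M |B. B \<in> sets T}"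
    using assms by (auto simp: indep_rv_def)
  interpret U: prob_space "distr M S U" by (rule prob_space_distr) simp
  interpret V: prob_space "distr M T V" by (rule prob_space_distr) simp
  show ?thesis
  proof (rule pair_measure_eqI)
    fix A B assume "A \<in> sets (distr M S U)" "B \<in> sets (distr M T V)"
    hence [measurable]: "A \<in> sets S" "B \<in> sets T" by auto
    have "(\<lambda>\<omega>. (U \<omega>, V \<omega>)) -` (A \<times> B) \<inter> space M = (U -` A \<inter> space M) \<inter> (V -` B \<inter> space M)" by auto
    moreover have "prob ((U -` A \<inter> space M) \<inter> (V -` B \<inter> space M)) = prob (U -` A \<inter> space M) * prob (V -` B \<inter> space M)"
      by (rule indep_setD[OF ind]) auto
    ultimately show "emeasure (distr M S U) A * emeasure (distr M T V) B = emeasure (distr M (S \<Otimes>\<^sub>M T) (\<lambda>\<omega>. (U \<omega>, V \<omega>))) (A \<times> B)"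
      by (simp add: emeasure_distr emeasure_eq_measure ennreal_mult)
  qed (auto intro: U.sigma_finite_measure_axioms V.sigma_finite_measure_axioms)
qed

text \<open>Tonelli for the joint law: \<open>V\<close> is frozen while \<open>U\<close> is
  averaged. Below, \<open>V\<close> is the past trajectory and \<open>U\<close> collects the
  innovations at the current time.\<close>

lemma indep_rv_nn_integral:
  assumes ind: "indep_rv S U T V"
    and h: "case_prod h \<in> borel_measurable (S \<Otimes>\<^sub>M T)"
  shows "(\<integral>\<^sup>+\<omega>. h (U \<omega>) (V \<omega>) \<partial>M) = (\<integral>\<^sup>+\<omega>. (\<integral>\<^sup>+\<omega>'. h (U \<omega>') (V \<omega>) \<partial>M) \<partial>M)"
proof -
  have [measurable]: "U \<in> measurable M S" "V \<in> measurable M T"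
    using ind by (auto simp: indep_rv_def)
  note h[measurable]
  interpret U: prob_space "distr M S U" by (rule prob_space_distr) simp
  interpret V: prob_space "distr M T V" by (rule prob_space_distr) simp
  interpret UV: pair_sigma_finite "distr M S U" "distr M T V" ..
  have [measurable]: "(\<lambda>v. \<integral>\<^sup>+u. h u v \<partial>distr M S U) \<in> borel_measurable T"
    by measurable
  have "(\<integral>\<^sup>+\<omega>. h (U \<omega>) (V \<omega>) \<partial>M) = (\<integral>\<^sup>+p. case_prod h p \<partial>distr M (S \<Otimes>\<^sub>M T) (\<lambda>\<omega>. (U \<omega>, V \<omega>)))"
    by (subst nn_integral_distr) auto
  also have "\<dots> = (\<integral>\<^sup>+p. case_prod h p \<partial>(distr M S U \<Otimes>\<^sub>M distr M T V))"
    by (simp add: indep_rv_distr_pair[OF ind])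
  also have "\<dots> = (\<integral>\<^sup>+v. \<integral>\<^sup>+u. h u v \<partial>distr M S U \<partial>distr M T V)"
    by (subst UV.nn_integral_snd[symmetric]) auto
  also have "\<dots> = (\<integral>\<^sup>+\<omega>. (\<integral>\<^sup>+u. h u (V \<omega>) \<partial>distr M S U) \<partial>M)"
    by (subst nn_integral_distr) auto
  also have "\<dots> = (\<integral>\<^sup>+\<omega>. (\<integral>\<^sup>+\<omega>'. h (U \<omega>') (V \<omega>) \<partial>M) \<partial>M)"
    by (intro nn_integral_cong nn_integral_distr) (auto intro: measurable_compose_Pair1 simp: measurable_space)
  finally show ?thesis .
qed

lemma indep_rv_nn_integral_mult:
  assumes ind: "indep_rv S U T V"
    and [measurable]: "f \<in> borel_measurable S" "g \<in> borel_measurable T"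
  shows "(\<integral>\<^sup>+\<omega>. f (U \<omega>) * g (V \<omega>) \<partial>M) = (\<integral>\<^sup>+\<omega>. f (U \<omega>) \<partial>M) * (\<integral>\<^sup>+\<omega>. g (V \<omega>) \<partial>M)"
proof -
  have [measurable]: "U \<in> measurable M S" "V \<in> measurable M T"
    using ind by (auto simp: indep_rv_def)
  show ?thesis
    by (subst indep_rv_nn_integral[OF ind, of "\<lambda>u v. f u * g v"])
      (simp_all add: nn_integral_multc nn_integral_cmult)
qed

text \<open>
  Only integrability on each atom is required, so the lemma also covers conditional variances of
  variables whose unconditional variance is infinite.
\<close>

lemma real_cond_exp_discrete:
  fixes Y :: "'a \<Rightarrow> 'b :: countable" and f :: "'a \<Rightarrow> real"
  defines "F \<equiv> vimage_algebra (space M) Y (count_space UNIV)"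
  assumes Y: "Y \<in> measurable M (count_space UNIV)"
    and f: "f \<in> borel_measurable M"
    and int: "\<And>y. integrable M (\<lambda>\<omega>. indicator {y} (Y \<omega>) * f \<omega>)"
    and g: "\<And>y. (\<integral>\<omega>. indicator {y} (Y \<omega>) * f \<omega> \<partial>M) = g y * prob {\<omega> \<in> space M. Y \<omega> = y}"
  shows "AE \<omega> in M. real_cond_exp M F f \<omega> = g (Y \<omega>)"
proof -
  note Y[measurable] f[measurable]
  have YF: "Y \<in> measurable F (count_space UNIV)"
    unfolding F_def by (rule measurable_vimage_algebra1) simp
  have "subalgebra M F"
    using Y unfolding subalgebra_def F_def
    by (auto simp: sets_vimage_algebra2 measurable_sets)
  then interpret F: finite_measure_subalgebra M F
    by unfold_locales
  define P where "P y = prob {\<omega> \<in> space M. Y \<omega> = y}" for y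
  \<comment> \<open>Elementary conditional expectation on the atom \<open>Y = y\<close>. Since
    \<open>ennreal\<close> truncates at 0, taking \<open>f\<close> and \<open>- f\<close> for
    \<open>h\<close> produces the positive and the negative part.\<close>
  define R where "R h y = (\<integral>\<^sup>+\<omega>. indicator {y} (Y \<omega>) * ennreal (h \<omega>) \<partial>M) / ennreal (P y)" for h :: "'a \<Rightarrow> real" and y
  have Pe: "(\<integral>\<^sup>+\<omega>. indicator {y} (Y \<omega>) \<partial>M) = ennreal (P y)" for y
  proof -
    have "(\<integral>\<^sup>+\<omega>. indicator {y} (Y \<omega>) \<partial>M) = (\<integral>\<^sup>+\<omega>. indicator {\<omega> \<in> space M. Y \<omega> = y} \<omega> \<partial>M)"
      by (intro nn_integral_cong) (auto split: split_indicator)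
    thus ?thesis by (simp add: P_def emeasure_eq_measure)
  qed
  \<comment> \<open>There are only countably many values \<open>y\<close>, so the null atoms
    together form a null set.\<close>
  have nullP: "AE \<omega> in M. P (Y \<omega>) \<noteq> 0"
  proof -
    have "AE \<omega> in M. \<forall>y. P y = 0 \<longrightarrow> Y \<omega> \<noteq> y"
    proof (subst AE_all_countable, intro allI)
      fix y
      show "AE \<omega> in M. P y = 0 \<longrightarrow> Y \<omega> \<noteq> y"
        by (cases "P y = 0") (auto simp: P_def emeasure_eq_measure intro!: AE_I[where N = "{\<omega> \<in> space M. Y \<omega> = y}"])
    qed
    thus ?thesis by eventually_elim auto
  qed
  have ce: "AE \<omega> in M. nn_cond_exp M F (\<lambda>\<omega>. ennreal (h \<omega>)) \<omega> = R h (Y \<omega>)"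
    if [measurable]: "h \<in> borel_measurable M" and fin: "\<And>y. (\<integral>\<^sup>+\<omega>. indicator {y} (Y \<omega>) * ennreal (h \<omega>) \<partial>M) < \<infinity>" for h
  proof -
    have "AE \<omega> in M. R h (Y \<omega>) = nn_cond_exp M F (\<lambda>\<omega>. ennreal (h \<omega>)) \<omega>"
    proof (rule F.nn_cond_exp_charact)
      fix A assume "A \<in> sets F"
      then obtain B where A: "A = Y -` B \<inter> space M" by (auto simp: F_def sets_vimage_algebra2)
      \<comment> \<open>Every set of \<open>F\<close> is a preimage under \<open>Y\<close>. Pushing
        both densities forward to the countable value space therefore reduces the test sets to
        singletons.\<close>
      have eq: "distr (density M (\<lambda>\<omega>. ennreal (h \<omega>))) (count_space UNIV) Y = distr (density M (\<lambda>\<omega>. R h (Y \<omega>))) (count_space UNIV) Y"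
      proof (rule measure_eqI_countable)
        fix y :: 'b
        have *: "indicator (Y -` {y} \<inter> space M) \<omega> = indicator {y} (Y \<omega>)" if "\<omega> \<in> space M" for \<omega>
          using that by (auto split: split_indicator)
        have "emeasure (distr (density M (\<lambda>\<omega>. R h (Y \<omega>))) (count_space UNIV) Y) {y} = (\<integral>\<^sup>+\<omega>. R h (Y \<omega>) * indicator {y} (Y \<omega>) \<partial>M)"
          by (simp add: emeasure_distr emeasure_density * cong: nn_integral_cong)
        also have "\<dots> = (\<integral>\<^sup>+\<omega>. R h y * indicator {y} (Y \<omega>) \<partial>M)"
          by (intro nn_integral_cong) (auto split: split_indicator)
        also have "\<dots> = R h y * ennreal (P y)" by (simp add: nn_integral_cmult Pe)
        also have "\<dots> = (\<integral>\<^sup>+\<omega>. indicator {y} (Y \<omega>) * ennreal (h \<omega>) \<partial>M)"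
        proof (cases "P y = 0")
          case True
          with Pe[of y] have "AE \<omega> in M. indicator {y} (Y \<omega>) = (0::ennreal)"
            by (simp add: nn_integral_0_iff_AE)
          hence "AE \<omega> in M. indicator {y} (Y \<omega>) * ennreal (h \<omega>) = 0" by eventually_elim simp
          thus ?thesis using True by (simp add: nn_integral_0_iff_AE)
        next
          case False
          hence "0 < P y" by (simp add: P_def zero_less_measure_iff)
          thus ?thesis by (simp add: R_def ennreal_divide_times divide_ennreal)
        qed
        also have "\<dots> = emeasure (distr (density M (\<lambda>\<omega>. ennreal (h \<omega>))) (count_space UNIV) Y) {y}"
          by (simp add: emeasure_distr emeasure_density * mult.commute cong: nn_integral_cong)
        finally show "emeasure (distr (density M (\<lambda>\<omega>. ennreal (h \<omega>))) (count_space UNIV) Y) {y} = emeasure (distr (density M (\<lambda>\<omega>. R h (Y \<omega>))) (count_space UNIV) Y) {y}" ..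
      qed auto
      from arg_cong[OF eq, of "\<lambda>m. emeasure m B"]
      show "(\<integral>\<^sup>+\<omega>\<in>A. ennreal (h \<omega>) \<partial>M) = (\<integral>\<^sup>+\<omega>\<in>A. R h (Y \<omega>) \<partial>M)"
        by (simp add: emeasure_distr emeasure_density A)
    qed (use YF in \<open>auto intro: measurable_compose\<close>)
    thus ?thesis by eventually_elim simp
  qed
  have fin: "(\<integral>\<^sup>+\<omega>. indicator {y} (Y \<omega>) * ennreal (f \<omega>) \<partial>M) < \<infinity>"
            "(\<integral>\<^sup>+\<omega>. indicator {y} (Y \<omega>) * ennreal (- f \<omega>) \<partial>M) < \<infinity>"
    and diff: "enn2real (\<integral>\<^sup>+\<omega>. indicator {y} (Y \<omega>) * ennreal (f \<omega>) \<partial>M)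
        - enn2real (\<integral>\<^sup>+\<omega>. indicator {y} (Y \<omega>) * ennreal (- f \<omega>) \<partial>M) = g y * P y" for y
  proof -
    have eq: "ennreal (indicator {y} (Y \<omega>) * f \<omega>) = indicator {y} (Y \<omega>) * ennreal (f \<omega>)"
      "ennreal (- (indicator {y} (Y \<omega>) * f \<omega>)) = indicator {y} (Y \<omega>) * ennreal (- f \<omega>)" for \<omega>
      by (auto split: split_indicator)
    show "(\<integral>\<^sup>+\<omega>. indicator {y} (Y \<omega>) * ennreal (f \<omega>) \<partial>M) < \<infinity>"
         "(\<integral>\<^sup>+\<omega>. indicator {y} (Y \<omega>) * ennreal (- f \<omega>) \<partial>M) < \<infinity>"
      using int[of y] unfolding real_integrable_def eq by (auto simp: less_top)
    show "enn2real (\<integral>\<^sup>+\<omega>. indicator {y} (Y \<omega>) * ennreal (f \<omega>) \<partial>M)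
        - enn2real (\<integral>\<^sup>+\<omega>. indicator {y} (Y \<omega>) * ennreal (- f \<omega>) \<partial>M) = g y * P y"
      using g[of y] unfolding real_lebesgue_integral_def[OF int[of y]] eq P_def by simp
  qed
  have "AE \<omega> in M. nn_cond_exp M F (\<lambda>\<omega>. ennreal (- f \<omega>)) \<omega> = R (\<lambda>\<omega>. - f \<omega>) (Y \<omega>)"
    using fin by (intro ce) auto
  moreover have "AE \<omega> in M. nn_cond_exp M F (\<lambda>\<omega>. ennreal (f \<omega>)) \<omega> = R f (Y \<omega>)"
    using fin by (intro ce) auto
  ultimately show ?thesis using nullP
  proof eventually_elim
    case (elim \<omega>)
    hence P: "0 < P (Y \<omega>)" by (simp add: P_def zero_less_measure_iff)
    \<comment> \<open>\<open>enn2real\<close> is compatible with division only for finite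
      numerators; this is where integrability on each atom enters.\<close>
    have e2r: "enn2real (I / ennreal (P (Y \<omega>))) = enn2real I / P (Y \<omega>)" if "I < \<infinity>" for I
      using that P by (cases I) (auto simp: divide_ennreal)
    show ?case
      unfolding real_cond_exp_def elim R_def e2r[OF fin(1)] e2r[OF fin(2)]
      using diff[of "Y \<omega>"] P by (simp add: diff_divide_distrib[symmetric])
  qed
qed

text \<open>
  Truncation at \<open>N\<close> and Jensen's inequality give \<open>E (min V N) \<le> E (min Q N)\<close> although
  both untruncated expectations may be infinite; the bound \<open>W\<close> then allows Fatou's lemma.
\<close>

lemma foster_lyapunov:
  fixes V V' Q W :: "'a \<Rightarrow> real"
  assumes [measurable]: "V \<in> borel_measurable M" "V' \<in> borel_measurable M" "Q \<in> borel_measurable M"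
    and W: "integrable M W"
    and nonneg: "\<And>\<omega>. 0 \<le> V \<omega>" "\<And>\<omega>. 0 \<le> V' \<omega>" "\<And>\<omega>. 0 \<le> Q \<omega>" "\<And>\<omega>. 0 \<le> W \<omega>"
    and drift: "\<And>c. (\<integral>\<^sup>+\<omega>. indicator {..c} (Q \<omega>) * ennreal (V' \<omega>) \<partial>M)
                  = (\<integral>\<^sup>+\<omega>. indicator {..c} (Q \<omega>) * ennreal (Q \<omega>) \<partial>M)"
    and same: "distr M borel V' = distr M borel V"
    and lower: "\<And>\<omega>. V \<omega> - Q \<omega> \<ge> - W \<omega>"
  shows "integrable M (\<lambda>\<omega>. V \<omega> - Q \<omega>)"
proof -
  note [measurable] = borel_measurable_integrable[OF W]
  have bd: "integrable M (\<lambda>\<omega>. min (U \<omega>) (real N))"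
    if [measurable]: "U \<in> borel_measurable M" and "\<And>\<omega>. 0 \<le> U \<omega>" for U N
    by (rule integrable_const_bound[where B = "real N"]) (use that in auto)
  have min_le: "expectation (\<lambda>\<omega>. min (V \<omega>) (real N)) \<le> expectation (\<lambda>\<omega>. min (Q \<omega>) (real N))" for N
  proof -
    have "ennreal (expectation (\<lambda>\<omega>. min (V \<omega>) (real N))) = (\<integral>\<^sup>+x. ennreal (min x (real N)) \<partial>distr M borel V)"
      using nonneg by (subst nn_integral_distr) (auto simp: nn_integral_eq_integral bd)
    also have "\<dots> = (\<integral>\<^sup>+\<omega>. ennreal (min (V' \<omega>) (real N)) \<partial>M)"
      by (subst same[symmetric], subst nn_integral_distr) auto
    \<comment> \<open>This is Jensen's inequality done by hand: where \<open>Q\<close> is at most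
      \<open>N\<close> the truncation of \<open>V'\<close> is dropped and the drift identity
      applies; where \<open>Q\<close> exceeds \<open>N\<close> the bound \<open>N\<close> is kept.
      The sum of the two is the truncation of \<open>Q\<close>.\<close>
    also have "\<dots> \<le> (\<integral>\<^sup>+\<omega>. indicator {..real N} (Q \<omega>) * ennreal (V' \<omega>) + indicator {real N<..} (Q \<omega>) * ennreal (real N) \<partial>M)"
      by (intro nn_integral_mono) (auto split: split_indicator intro!: ennreal_leI)
    also have "\<dots> = (\<integral>\<^sup>+\<omega>. indicator {..real N} (Q \<omega>) * ennreal (Q \<omega>) \<partial>M) + (\<integral>\<^sup>+\<omega>. indicator {real N<..} (Q \<omega>) * ennreal (real N) \<partial>M)"
      by (subst nn_integral_add) (auto simp: drift)
    also have "\<dots> = (\<integral>\<^sup>+\<omega>. indicator {..real N} (Q \<omega>) * ennreal (Q \<omega>) + indicator {real N<..} (Q \<omega>) * ennreal (real N) \<partial>M)"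
      by (subst nn_integral_add) auto
    also have "\<dots> = (\<integral>\<^sup>+\<omega>. ennreal (min (Q \<omega>) (real N)) \<partial>M)"
      by (intro nn_integral_cong) (auto split: split_indicator simp: min_def)
    also have "\<dots> = ennreal (expectation (\<lambda>\<omega>. min (Q \<omega>) (real N)))"
      using nonneg by (simp add: nn_integral_eq_integral bd)
    finally show ?thesis using nonneg by (simp add: Bochner_Integration.integral_nonneg)
  qed
  \<comment> \<open>Truncation is monotone and does not enlarge differences, so the lower bound
    \<open>- W\<close> survives it. Adding \<open>W\<close> gives the nonnegativity that Fatou's
    lemma requires.\<close>
  define H where "H N \<omega> = min (V \<omega>) (real N) - min (Q \<omega>) (real N) + W \<omega>" for N \<omega>
  have Hnn: "0 \<le> H N \<omega>" for N \<omega> using lower[of \<omega>] nonneg(4)[of \<omega>] by (auto simp: H_def min_def)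
  have Hint: "integrable M (H N)" for N unfolding H_def using W nonneg by (intro Bochner_Integration.integrable_add Bochner_Integration.integrable_diff bd) auto
  have HI: "(\<integral>\<^sup>+\<omega>. ennreal (H N \<omega>) \<partial>M) \<le> ennreal (expectation W)" for N
  proof -
    have "(\<integral>\<^sup>+\<omega>. ennreal (H N \<omega>) \<partial>M) = ennreal (expectation (H N))"
      using Hnn Hint by (intro nn_integral_eq_integral) auto
    also have "expectation (H N) = expectation (\<lambda>\<omega>. min (V \<omega>) (real N)) - expectation (\<lambda>\<omega>. min (Q \<omega>) (real N)) + expectation W"
      unfolding H_def using W nonneg by (simp add: bd)
    also have "ennreal \<dots> \<le> ennreal (expectation W)" using min_le[of N] by (intro ennreal_leI) simp
    finally show ?thesis .
  qed
  have lim: "(\<lambda>N. ennreal (H N \<omega>)) \<longlonglongrightarrow> ennreal (V \<omega> - Q \<omega> + W \<omega>)" for \<omega>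
  proof (rule tendsto_eventually, rule eventually_sequentiallyI)
    fix N assume "nat \<lceil>max (V \<omega>) (Q \<omega>)\<rceil> \<le> N"
    hence "V \<omega> \<le> real N" "Q \<omega> \<le> real N" by linarith+
    thus "ennreal (H N \<omega>) = ennreal (V \<omega> - Q \<omega> + W \<omega>)" by (simp add: H_def)
  qed
  have [measurable]: "H N \<in> borel_measurable M" for N using Hint by auto
  have "(\<integral>\<^sup>+\<omega>. ennreal (V \<omega> - Q \<omega> + W \<omega>) \<partial>M) = (\<integral>\<^sup>+\<omega>. liminf (\<lambda>N. ennreal (H N \<omega>)) \<partial>M)"
    by (intro nn_integral_cong lim_imp_Liminf[symmetric] sequentially_bot lim)
  also have "\<dots> \<le> liminf (\<lambda>N. \<integral>\<^sup>+\<omega>. ennreal (H N \<omega>) \<partial>M)"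
    by (rule nn_integral_liminf) simp
  also have "\<dots> \<le> liminf (\<lambda>N. ennreal (expectation W))"
    by (intro Liminf_mono always_eventually allI HI)
  also have "\<dots> < \<infinity>" by (simp add: Liminf_const)
  finally have "integrable M (\<lambda>\<omega>. V \<omega> - Q \<omega> + W \<omega>)"
    using lower by (intro integrableI_nonneg) (auto simp: algebra_simps)
  from Bochner_Integration.integrable_diff[OF this W] show ?thesis by simp
qed

end

subsection \<open>Coefficients and counting variables\<close>

context brcmnbinar
begin

text \<open>Second moment of a coefficient, written as variance plus squared mean, so that
  \<open>1 - coef_sq_mean i\<close> is the denominator of the stationary variance.\<close>

definition coef_sq_mean :: "nat \<Rightarrow> real" where
  "coef_sq_mean i = coef_var (m i) l + (coef_mean (m i) l)\<^sup>2"

lemma coef_mean_bounds: "i \<in> {1, 2} \<Longrightarrow> 0 < coef_mean (m i) l" "i \<in> {1, 2} \<Longrightarrow> coef_mean (m i) l < 1"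
  using m_bounds[of i] l_gt_1 by (auto simp: coef_mean_def)

text \<open>The product \<open>(m i / l) * ((m i + 1) / (l - 1))\<close> is the form in which the
  recursion for beta prime integrals delivers the second moment.\<close>

lemma coef_sq_mean_eq:
  assumes "i \<in> {1, 2}"
  shows "coef_sq_mean i = m i * (m i + 1) / (l * (l - 1))"
  using m_bounds[OF assms] l_gt_1
  by (simp add: coef_sq_mean_def coef_mean_def coef_var_def divide_simps power2_eq_square) algebra

lemma coef_sq_mean_pos: "i \<in> {1, 2} \<Longrightarrow> 0 < coef_sq_mean i"
  using m_bounds[of i] l_gt_1 by (simp add: coef_sq_mean_eq)

lemma coef_rv [measurable]:
  assumes "i \<in> {1, 2}" "1 \<le> t" shows "\<alpha> i t \<in> borel_measurable M"
  using distributed_measurable[OF coef_density[OF assms]] by simp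

lemma coef_nn_integral:
  assumes it: "i \<in> {1, 2}" "1 \<le> t" and [measurable]: "g \<in> borel_measurable borel"
  shows "(\<integral>\<^sup>+\<omega>. g (\<alpha> i t \<omega>) \<partial>M) = (\<integral>\<^sup>+x. ennreal (beta_prime_density (m i) l x) * g x \<partial>lborel)"
  by (rule distributed_nn_integral[OF coef_density[OF it], symmetric]) simp

text \<open>The geometric moment formulas need a positive parameter, and \<open>ennreal\<close>
  would truncate negative values; positivity almost everywhere covers both.\<close>

lemma coef_AE_pos:
  assumes it: "i \<in> {1, 2}" "1 \<le> t"
  shows "AE \<omega> in M. 0 < \<alpha> i t \<omega>"
proof -
  note [measurable] = coef_rv[OF it]
  have "(\<integral>\<^sup>+\<omega>. indicator {..0} (\<alpha> i t \<omega>) \<partial>M) = (\<integral>\<^sup>+(x::real). 0 \<partial>lborel)"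
    by (subst coef_nn_integral[OF it], simp, rule nn_integral_cong)
       (auto simp: beta_prime_density_def split: split_indicator)
  hence "(\<integral>\<^sup>+\<omega>. indicator {..0} (\<alpha> i t \<omega>) \<partial>M) = 0" by simp
  hence "AE \<omega> in M. indicator {..0} (\<alpha> i t \<omega>) = (0::ennreal)"
    by (subst (asm) nn_integral_0_iff_AE) auto
  thus ?thesis by eventually_elim (auto simp: indicator_def split: if_splits)
qed

text \<open>The density has total mass one, so the unnormalised zeroth moment is the Beta constant
  itself and no Beta integral has to be evaluated. Two steps of the recursion then give the first
  and second moments, and the constant cancels.\<close>

lemma coef_nn_moments:
  assumes it: "i \<in> {1, 2}" "1 \<le> t"
  shows "(\<integral>\<^sup>+\<omega>. ennreal (\<alpha> i t \<omega>) \<partial>M) = ennreal (coef_mean (m i) l)"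
    and "(\<integral>\<^sup>+\<omega>. ennreal ((\<alpha> i t \<omega>)\<^sup>2) \<partial>M) = ennreal (coef_sq_mean i)"
proof -
  note [measurable] = coef_rv[OF it]
  let ?m = "m i"
  have ml: "0 < ?m" "?m < l" "1 < l" using m_bounds[OF it(1)] l_gt_1 by auto
  define w where "w x = x powr (?m - 1) * (1 + x) powr (- ?m - l - 1)" for x :: real
  have [measurable]: "w \<in> borel_measurable borel" unfolding w_def by measurable
  have wnn: "0 \<le> w x" for x by (simp add: w_def)
  define B where "B = Beta ?m (l + 1)"
  have B: "0 < B" using ml by (simp add: B_def Beta_def Gamma_real_pos)
  define J where "J k = (\<integral>\<^sup>+x\<in>{0<..}. ennreal (x ^ k * w x) \<partial>lborel)" for k :: nat
  have EJ: "ennreal B * (\<integral>\<^sup>+\<omega>. ennreal ((\<alpha> i t \<omega>) ^ k) \<partial>M) = J k" for k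
  proof -
    have "ennreal B * (\<integral>\<^sup>+\<omega>. ennreal ((\<alpha> i t \<omega>) ^ k) \<partial>M)
        = (\<integral>\<^sup>+x. ennreal B * (ennreal (beta_prime_density ?m l x) * ennreal (x ^ k)) \<partial>lborel)"
      by (subst coef_nn_integral[OF it]) (auto simp: nn_integral_cmult beta_prime_density_def)
    also have "\<dots> = J k" unfolding J_def
      using B wnn by (intro nn_integral_cong)
        (auto simp: beta_prime_density_def ennreal_mult'[symmetric] w_def B_def[symmetric] mult.commute split: split_indicator)
    finally show ?thesis .
  qed
  have J0: "J 0 = ennreal B" using EJ[of 0] by (simp add: emeasure_space_1)
  have r1: "ennreal ?m * J 0 = ennreal l * J 1"
    using beta_prime_integral_rec[of ?m l] ml by (simp add: J_def w_def)
  \<comment> \<open>The recursion is used with \<open>?m + 1\<close> and \<open>l - 1\<close>: the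
    extra factor \<open>x\<close> raises the first exponent, while the exponent of
    \<open>1 + x\<close> is unchanged. Positivity of \<open>l - 1\<close> is the hypothesis
    \<open>1 < l\<close>.\<close>
  have r2: "ennreal (?m + 1) * J 1 = ennreal (l - 1) * J 2"
  proof -
    have x: "x powr ?m = x * x powr (?m - 1)" if "0 < x" for x :: real
      using that powr_mult_base[of x "?m - 1"] by simp
    have "J 1 = (\<integral>\<^sup>+x\<in>{0<..}. ennreal (x powr (?m + 1 - 1) * (1 + x) powr (- (?m + 1) - (l - 1) - 1)) \<partial>lborel)"
      unfolding J_def w_def by (intro nn_integral_cong) (auto simp: x algebra_simps split: split_indicator)
    moreover have "J 2 = (\<integral>\<^sup>+x\<in>{0<..}. ennreal (x * (x powr (?m + 1 - 1) * (1 + x) powr (- (?m + 1) - (l - 1) - 1))) \<partial>lborel)"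
      unfolding J_def w_def by (intro nn_integral_cong) (auto simp: x algebra_simps power2_eq_square split: split_indicator)
    ultimately show ?thesis using beta_prime_integral_rec[of "?m + 1" "l - 1"] ml by simp
  qed
  \<comment> \<open>Division in the extended nonnegative reals: an infinite \<open>I\<close> is
    impossible, because the left side of the equation is finite and \<open>d\<close> is
    positive.\<close>
  have solve: "I = ennreal (c * y / d)" if "ennreal c * ennreal y = ennreal d * I" "0 < d" "0 \<le> c" "0 \<le> y" for I c y d
  proof (cases I)
    case (real x)
    have "c * y = d * x" using that real by (simp flip: ennreal_mult)
    thus ?thesis using real that by (simp add: field_simps)
  next
    case top
    thus ?thesis using that by (simp add: ennreal_mult_top flip: ennreal_mult)
  qed
  have J1: "J 1 = ennreal (?m * B / l)" using r1 ml B unfolding J0 by (intro solve) auto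
  show "(\<integral>\<^sup>+\<omega>. ennreal (\<alpha> i t \<omega>) \<partial>M) = ennreal (coef_mean (m i) l)"
    using solve[of 1 "?m * B / l" B] EJ[of 1] J1 B ml by (simp add: coef_mean_def)
  have "J 2 = ennreal ((?m + 1) * (?m * B / l) / (l - 1))"
    using r2 ml B unfolding J1 by (intro solve) auto
  thus "(\<integral>\<^sup>+\<omega>. ennreal ((\<alpha> i t \<omega>)\<^sup>2) \<partial>M) = ennreal (coef_sq_mean i)"
    using solve[of 1 "(?m + 1) * (?m * B / l) / (l - 1)" B] EJ[of 2] B ml
    by (simp add: coef_sq_mean_eq[OF it(1)] mult.commute)
qed

lemma coef_integrable:
  assumes it: "i \<in> {1, 2}" "1 \<le> t"
  shows "integrable M (\<alpha> i t)" "expectation (\<alpha> i t) = coef_mean (m i) l"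
    and "integrable M (\<lambda>\<omega>. (\<alpha> i t \<omega>)\<^sup>2)" "expectation (\<lambda>\<omega>. (\<alpha> i t \<omega>)\<^sup>2) = coef_sq_mean i"
proof -
  note [measurable] = coef_rv[OF it]
  have nn: "AE \<omega> in M. 0 \<le> \<alpha> i t \<omega>" using coef_AE_pos[OF it] by eventually_elim simp
  show "integrable M (\<alpha> i t)" "integrable M (\<lambda>\<omega>. (\<alpha> i t \<omega>)\<^sup>2)"
    using nn by (auto intro!: integrableI_nonneg simp: coef_nn_moments[OF it])
  show "expectation (\<alpha> i t) = coef_mean (m i) l" "expectation (\<lambda>\<omega>. (\<alpha> i t \<omega>)\<^sup>2) = coef_sq_mean i"
    using nn coef_mean_bounds[OF it(1)] coef_sq_mean_pos[OF it(1)]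
    by (auto simp: integral_eq_nn_integral coef_nn_moments[OF it])
qed

text \<open>Independence is given for the two whole coefficient sequences; projecting both to time
  \<open>t\<close> makes the mean of the product factorise.\<close>

lemma coef_cross:
  assumes t: "1 \<le> t"
  shows "(\<integral>\<^sup>+\<omega>. ennreal (\<alpha> 1 t \<omega> * \<alpha> 2 t \<omega>) \<partial>M) = ennreal (coef_mean (m 1) l * coef_mean (m 2) l)"
proof -
  have "indep_var borel ((\<lambda>f. f t) \<circ> (\<lambda>\<omega>. \<lambda>t\<in>{1..}. \<alpha> 1 t \<omega>)) borel ((\<lambda>f. f t) \<circ> (\<lambda>\<omega>. \<lambda>t\<in>{1..}. \<alpha> 2 t \<omega>))"
    using t by (intro indep_var_compose[OF coef_indep_comp] measurable_component_singleton) auto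
  hence ind: "indep_var borel (\<alpha> 1 t) borel (\<alpha> 2 t)" using t by (simp add: comp_def)
  have i: "integrable M (\<alpha> 1 t)" "integrable M (\<alpha> 2 t)" using t by (auto intro: coef_integrable)
  have nn: "AE \<omega> in M. 0 \<le> \<alpha> 1 t \<omega> * \<alpha> 2 t \<omega>"
    using coef_AE_pos[OF _ t, of 1, simplified] coef_AE_pos[OF _ t, of 2, simplified] by eventually_elim simp
  show ?thesis
    using indep_var_integrable[OF ind i] indep_var_lebesgue_integral[OF ind i] nn t
    by (subst nn_integral_eq_integral) (auto simp: coef_integrable)
qed

text \<open>Integrating the conditional probability removes the conditioning: from here on the
  conditional law of the counting variables enters only through this mixture formula.\<close>

lemma counting_prob:
  assumes J: "finite J" "J \<subseteq> {1, 2} \<times> {1..} \<times> {1..}"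
  shows "emeasure M {\<omega> \<in> space M. \<forall>(i, t, j)\<in>J. G i t j \<omega> = g (i, t, j)}
       = (\<integral>\<^sup>+\<omega>. ennreal (\<Prod>(i, t, j)\<in>J. geom_prob (\<alpha> i t \<omega>) (g (i, t, j))) \<partial>M)"
proof -
  define F where "F = vimage_algebra (space M) (\<lambda>\<omega>. \<lambda>(i, t)\<in>{1, 2} \<times> {1..}. \<alpha> i t \<omega>) (\<Pi>\<^sub>M p\<in>{1, 2::nat} \<times> {1::nat..}. borel :: real measure)"
  define E where "E = {\<omega> \<in> space M. \<forall>(i, t, j)\<in>J. G i t j \<omega> = g (i, t, j)}"
  define p where "p \<omega> = (\<Prod>(i, t, j)\<in>J. geom_prob (\<alpha> i t \<omega>) (g (i, t, j)))" for \<omega>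
  have "(\<lambda>\<omega>. \<lambda>(i, t)\<in>{1, 2} \<times> {1..}. \<alpha> i t \<omega>) \<in> measurable M (\<Pi>\<^sub>M p\<in>{1, 2} \<times> {1..}. borel)"
    by (intro measurable_restrict) (auto intro: coef_rv)
  hence "subalgebra M F"
    unfolding measurable_iff_sets subalgebra_def F_def by simp
  then interpret F: finite_measure_subalgebra M F
    by unfold_locales
  have E [measurable]: "E \<in> sets M"
  proof -
    have "E = {\<omega> \<in> space M. \<forall>q\<in>J. G (fst q) (fst (snd q)) (snd (snd q)) \<omega> = g q}"
      by (auto simp: E_def)
    also have "\<dots> \<in> sets M"
    proof (rule sets.sets_Collect_finite_All[OF _ J(1)])
      fix q assume "q \<in> J"
      hence [measurable]: "G (fst q) (fst (snd q)) (snd (snd q)) \<in> measurable M (count_space UNIV)"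
        using J(2) by (intro G_rv) auto
      show "{\<omega> \<in> space M. G (fst q) (fst (snd q)) (snd (snd q)) \<omega> = g q} \<in> sets M" by measurable
    qed
    finally show ?thesis .
  qed
  have int: "integrable M (indicator E :: 'w \<Rightarrow> real)" by (auto simp: emeasure_eq_measure)
  have [measurable]: "p \<in> borel_measurable M"
    unfolding p_def geom_prob_def using J(2) by (intro borel_measurable_prod) (auto intro!: borel_measurable_divide borel_measurable_power borel_measurable_add coef_rv)
  have ae: "AE \<omega> in M. real_cond_exp M F (indicator E) \<omega> = p \<omega>"
    using counting_cond[OF J, of g] unfolding F_def E_def p_def .
  have intp: "integrable M p" 
    using integrable_cong_AE[OF _ _ ae] F.real_cond_exp_int(1)[OF int] by simp
  have "expectation p = expectation (real_cond_exp M F (indicator E))"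
    using ae by (intro integral_cong_AE) auto
  also have "\<dots> = prob E" using F.real_cond_exp_int(2)[OF int] by simp
  finally have Ep: "expectation p = prob E" .
  have "AE \<omega> in M. \<forall>q\<in>J. 0 < \<alpha> (fst q) (fst (snd q)) \<omega>"
    using J by (intro AE_finite_allI) (auto intro!: coef_AE_pos)
  hence "AE \<omega> in M. 0 \<le> p \<omega>"
  proof eventually_elim
    case (elim \<omega>)
    thus ?case unfolding p_def by (intro prod_nonneg) (auto simp: geom_prob_nonneg)
  qed
  thus ?thesis
    using nn_integral_eq_integral[OF intp] Ep by (simp add: emeasure_eq_measure E_def[symmetric] p_def[symmetric])
qed

text \<open>Distinct counting variables are conditionally independent given the coefficients. Both
  factors are expanded over their values, the joint point probabilities are replaced by mixtures,
  and the sums return under the integral by monotone convergence. One and the same coefficient may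
  drive both factors.\<close>

lemma counting_pair_nn_integral:
  assumes p: "i \<in> {1, 2}" "1 \<le> t" "1 \<le> j" and q: "i' \<in> {1, 2}" "1 \<le> t'" "1 \<le> j'"
    and neq: "(i, t, j) \<noteq> (i', t', j')"
  shows "(\<integral>\<^sup>+\<omega>. f (G i t j \<omega>) * h (G i' t' j' \<omega>) \<partial>M)
       = (\<integral>\<^sup>+\<omega>. (\<Sum>k. f k * ennreal (geom_prob (\<alpha> i t \<omega>) k)) * (\<Sum>k. h k * ennreal (geom_prob (\<alpha> i' t' \<omega>) k)) \<partial>M)"
proof -
  note [measurable] = G_rv[OF p] G_rv[OF q] coef_rv[OF p(1,2)] coef_rv[OF q(1,2)]
  have [measurable]: "(\<lambda>\<omega>. geom_prob (\<alpha> i t \<omega>) k) \<in> borel_measurable M"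
    "(\<lambda>\<omega>. geom_prob (\<alpha> i' t' \<omega>) k) \<in> borel_measurable M" for k
    by (simp_all add: geom_prob_def)
  have [measurable]: "(\<lambda>\<omega>. indicator {k} (G i t j \<omega>) :: ennreal) \<in> borel_measurable M" for k
    by (rule measurable_compose[OF G_rv[OF p]]) simp
  have P: "(\<integral>\<^sup>+\<omega>. indicator {k'} (G i' t' j' \<omega>) * indicator {k} (G i t j \<omega>) \<partial>M)
      = (\<integral>\<^sup>+\<omega>. ennreal (geom_prob (\<alpha> i t \<omega>) k) * ennreal (geom_prob (\<alpha> i' t' \<omega>) k') \<partial>M)" for k k'
  proof -
    let ?J = "{(i, t, j), (i', t', j')}"
    let ?g = "\<lambda>r. if r = (i, t, j) then k else k'"
    have "(\<integral>\<^sup>+\<omega>. indicator {k'} (G i' t' j' \<omega>) * indicator {k} (G i t j \<omega>) \<partial>M)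
        = (\<integral>\<^sup>+\<omega>. indicator {\<omega> \<in> space M. \<forall>(i, t, j)\<in>?J. G i t j \<omega> = ?g (i, t, j)} \<omega> \<partial>M)"
      using neq by (intro nn_integral_cong) (auto split: split_indicator)
    also have "\<dots> = emeasure M {\<omega> \<in> space M. \<forall>(i, t, j)\<in>?J. G i t j \<omega> = ?g (i, t, j)}"
      using neq by (intro nn_integral_indicator) auto
    also have "\<dots> = (\<integral>\<^sup>+\<omega>. ennreal (\<Prod>(i, t, j)\<in>?J. geom_prob (\<alpha> i t \<omega>) (?g (i, t, j))) \<partial>M)"
      using p q by (intro counting_prob) auto
    also have "\<dots> = (\<integral>\<^sup>+\<omega>. ennreal (geom_prob (\<alpha> i t \<omega>) k) * ennreal (geom_prob (\<alpha> i' t' \<omega>) k') \<partial>M)"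
      using coef_AE_pos[OF p(1,2)] coef_AE_pos[OF q(1,2)]
    proof (intro nn_integral_cong_AE, eventually_elim)
      case (elim \<omega>)
      have "(\<Prod>(i, t, j)\<in>?J. geom_prob (\<alpha> i t \<omega>) (?g (i, t, j))) = geom_prob (\<alpha> i t \<omega>) k * geom_prob (\<alpha> i' t' \<omega>) k'"
        using neq by (subst prod.insert) auto
      thus ?case using elim by (simp add: ennreal_mult geom_prob_nonneg)
    qed
    finally show ?thesis .
  qed
  have "(\<integral>\<^sup>+\<omega>. f (G i t j \<omega>) * h (G i' t' j' \<omega>) \<partial>M)
      = (\<Sum>k. f k * (\<integral>\<^sup>+\<omega>. h (G i' t' j' \<omega>) * indicator {k} (G i t j \<omega>) \<partial>M))"
    by (subst nn_integral_nat_eq_suminf) (auto simp: mult.commute)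
  also have "\<dots> = (\<Sum>k. f k * (\<Sum>k'. h k' * (\<integral>\<^sup>+\<omega>. ennreal (geom_prob (\<alpha> i t \<omega>) k) * ennreal (geom_prob (\<alpha> i' t' \<omega>) k') \<partial>M)))"
    by (subst nn_integral_nat_eq_suminf) (auto simp: P)
  also have "\<dots> = (\<Sum>k. (\<Sum>k'. (\<integral>\<^sup>+\<omega>. (f k * ennreal (geom_prob (\<alpha> i t \<omega>) k)) * (h k' * ennreal (geom_prob (\<alpha> i' t' \<omega>) k')) \<partial>M)))"
    unfolding ennreal_suminf_cmult[symmetric]
    by (auto simp: nn_integral_cmult[symmetric] mult_ac intro!: suminf_cong nn_integral_cong)
  also have "\<dots> = (\<integral>\<^sup>+\<omega>. (\<Sum>k. (\<Sum>k'. (f k * ennreal (geom_prob (\<alpha> i t \<omega>) k)) * (h k' * ennreal (geom_prob (\<alpha> i' t' \<omega>) k')))) \<partial>M)"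
    by (simp add: nn_integral_suminf del: ennreal_suminf_cmult ennreal_suminf_multc)
  also have "\<dots> = (\<integral>\<^sup>+\<omega>. (\<Sum>k. f k * ennreal (geom_prob (\<alpha> i t \<omega>) k)) * (\<Sum>k. h k * ennreal (geom_prob (\<alpha> i' t' \<omega>) k)) \<partial>M)"
    by (simp add: ennreal_suminf_cmult ennreal_suminf_multc)
  finally show ?thesis .
qed

lemma counting_moments:
  assumes p: "i \<in> {1, 2}" "1 \<le> t" "1 \<le> j"
  shows "integrable M (\<lambda>\<omega>. real (G i t j \<omega>))" "expectation (\<lambda>\<omega>. real (G i t j \<omega>)) = coef_mean (m i) l"
    and "integrable M (\<lambda>\<omega>. (real (G i t j \<omega>))\<^sup>2)" 
    and "expectation (\<lambda>\<omega>. (real (G i t j \<omega>))\<^sup>2) = coef_mean (m i) l + 2 * coef_sq_mean i"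
proof -
  note [measurable] = G_rv[OF p] coef_rv[OF p(1,2)]
  note pos = coef_AE_pos[OF p(1,2)]
  \<comment> \<open>A single variable is paired with its successor \<open>j + 1\<close> carrying the
    weight 1, whose geometric probabilities sum to one.\<close>
  have *: "(\<integral>\<^sup>+\<omega>. f (G i t j \<omega>) \<partial>M) = (\<integral>\<^sup>+\<omega>. (\<Sum>k. f k * ennreal (geom_prob (\<alpha> i t \<omega>) k)) \<partial>M)" for f
  proof -
    have "(\<integral>\<^sup>+\<omega>. f (G i t j \<omega>) * 1 \<partial>M) = (\<integral>\<^sup>+\<omega>. (\<Sum>k. f k * ennreal (geom_prob (\<alpha> i t \<omega>) k)) * (\<Sum>k. 1 * ennreal (geom_prob (\<alpha> i t \<omega>) k)) \<partial>M)"
      using p by (intro counting_pair_nn_integral[where i' = i and t' = t and j' = "j + 1"]) auto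
    also have "\<dots> = (\<integral>\<^sup>+\<omega>. (\<Sum>k. f k * ennreal (geom_prob (\<alpha> i t \<omega>) k)) \<partial>M)"
      by (intro nn_integral_cong_AE, use pos in eventually_elim) (simp add: geom_prob_suminf)
    finally show ?thesis by simp
  qed
  have 1: "(\<integral>\<^sup>+\<omega>. ennreal (real (G i t j \<omega>)) \<partial>M) = ennreal (coef_mean (m i) l)"
    unfolding *[of "\<lambda>k. ennreal (real k)"] coef_nn_moments(1)[OF p(1,2), symmetric]
    by (intro nn_integral_cong_AE, use pos in eventually_elim) (simp add: geom_prob_suminf)
  have 2: "(\<integral>\<^sup>+\<omega>. ennreal ((real (G i t j \<omega>))\<^sup>2) \<partial>M) = ennreal (coef_mean (m i) l + 2 * coef_sq_mean i)"
  proof -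
    have "(\<integral>\<^sup>+\<omega>. ennreal ((real (G i t j \<omega>))\<^sup>2) \<partial>M) = (\<integral>\<^sup>+\<omega>. ennreal (\<alpha> i t \<omega> + 2 * (\<alpha> i t \<omega>)\<^sup>2) \<partial>M)"
      unfolding *[of "\<lambda>k. ennreal ((real k)\<^sup>2)"]
      by (intro nn_integral_cong_AE, use pos in eventually_elim) (simp add: geom_prob_suminf)
    also have "\<dots> = ennreal (expectation (\<lambda>\<omega>. \<alpha> i t \<omega> + 2 * (\<alpha> i t \<omega>)\<^sup>2))"
      by (intro nn_integral_eq_integral Bochner_Integration.integrable_add integrable_mult_right coef_integrable[OF p(1,2)])
        (use pos in \<open>eventually_elim, simp\<close>)
    also have "expectation (\<lambda>\<omega>. \<alpha> i t \<omega> + 2 * (\<alpha> i t \<omega>)\<^sup>2) = coef_mean (m i) l + 2 * coef_sq_mean i"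
      by (simp add: coef_integrable[OF p(1,2)])
    finally show ?thesis .
  qed
  show "integrable M (\<lambda>\<omega>. real (G i t j \<omega>))" "integrable M (\<lambda>\<omega>. (real (G i t j \<omega>))\<^sup>2)"
    by (auto intro!: integrableI_nonneg simp: 1 2)
  show "expectation (\<lambda>\<omega>. real (G i t j \<omega>)) = coef_mean (m i) l"
    "expectation (\<lambda>\<omega>. (real (G i t j \<omega>))\<^sup>2) = coef_mean (m i) l + 2 * coef_sq_mean i"
    using coef_mean_bounds[OF p(1)] coef_sq_mean_pos[OF p(1)] by (simp_all add: integral_eq_nn_integral 1 2)
qed

text \<open>Within a component both variables share one random coefficient, so the product averages
  its square and they are in general correlated. Across components the coefficients are independent
  and the means multiply.\<close>

lemma counting_product_moments:
  assumes t: "1 \<le> t" "1 \<le> j" "1 \<le> j'"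
  shows "i \<in> {1, 2} \<Longrightarrow> j \<noteq> j' \<Longrightarrow> integrable M (\<lambda>\<omega>. real (G i t j \<omega>) * real (G i t j' \<omega>))"
    and "i \<in> {1, 2} \<Longrightarrow> j \<noteq> j' \<Longrightarrow> expectation (\<lambda>\<omega>. real (G i t j \<omega>) * real (G i t j' \<omega>)) = coef_sq_mean i"
    and "integrable M (\<lambda>\<omega>. real (G 1 t j \<omega>) * real (G 2 t j' \<omega>))"
    and "expectation (\<lambda>\<omega>. real (G 1 t j \<omega>) * real (G 2 t j' \<omega>)) = coef_mean (m 1) l * coef_mean (m 2) l"
proof -
  have *: "(\<integral>\<^sup>+\<omega>. ennreal (real (G i t j \<omega>) * real (G i' t j' \<omega>)) \<partial>M) = (\<integral>\<^sup>+\<omega>. ennreal (\<alpha> i t \<omega> * \<alpha> i' t \<omega>) \<partial>M)"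
    if ii: "i \<in> {1, 2}" "i' \<in> {1, 2}" "(i, t, j) \<noteq> (i', t, j')" for i i'
  proof -
    have "(\<integral>\<^sup>+\<omega>. ennreal (real (G i t j \<omega>) * real (G i' t j' \<omega>)) \<partial>M)
        = (\<integral>\<^sup>+\<omega>. ennreal (real (G i t j \<omega>)) * ennreal (real (G i' t j' \<omega>)) \<partial>M)"
      by (simp add: ennreal_mult)
    also have "\<dots> = (\<integral>\<^sup>+\<omega>. (\<Sum>k. ennreal (real k) * ennreal (geom_prob (\<alpha> i t \<omega>) k)) * (\<Sum>k. ennreal (real k) * ennreal (geom_prob (\<alpha> i' t \<omega>) k)) \<partial>M)"
      using t ii by (intro counting_pair_nn_integral[where f = "\<lambda>k. ennreal (real k)" and h = "\<lambda>k. ennreal (real k)"]) auto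
    also have "\<dots> = (\<integral>\<^sup>+\<omega>. ennreal (\<alpha> i t \<omega> * \<alpha> i' t \<omega>) \<partial>M)"
      by (intro nn_integral_cong_AE, use coef_AE_pos[OF ii(1) t(1)] coef_AE_pos[OF ii(2) t(1)] in eventually_elim)
        (simp add: geom_prob_suminf ennreal_mult)
    finally show ?thesis .
  qed
  have c: "(\<integral>\<^sup>+\<omega>. ennreal (real (G 1 t j \<omega>) * real (G 2 t j' \<omega>)) \<partial>M) = ennreal (coef_mean (m 1) l * coef_mean (m 2) l)"
    by (subst *) (use coef_cross[OF t(1)] in auto)
  have [measurable]: "G 1 t j \<in> measurable M (count_space UNIV)" "G 2 t j' \<in> measurable M (count_space UNIV)"
    using t by (auto intro: G_rv)
  show "integrable M (\<lambda>\<omega>. real (G 1 t j \<omega>) * real (G 2 t j' \<omega>))"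
    by (rule integrableI_nonneg) (auto simp: c simp del: One_nat_def)
  show "expectation (\<lambda>\<omega>. real (G 1 t j \<omega>) * real (G 2 t j' \<omega>)) = coef_mean (m 1) l * coef_mean (m 2) l"
    using coef_mean_bounds[of 1] coef_mean_bounds[of 2] by (simp add: integral_eq_nn_integral c del: One_nat_def)
  assume i: "i \<in> {1, 2}" and jj: "j \<noteq> j'"
  note [measurable] = G_rv[OF i t(1) t(2)] G_rv[OF i t(1) t(3)]
  have s: "(\<integral>\<^sup>+\<omega>. ennreal (real (G i t j \<omega>) * real (G i t j' \<omega>)) \<partial>M) = ennreal (coef_sq_mean i)"
    using coef_nn_moments(2)[OF i t(1)] jj by (subst *[OF i i]) (auto simp: power2_eq_square)
  show "integrable M (\<lambda>\<omega>. real (G i t j \<omega>) * real (G i t j' \<omega>))"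
    by (rule integrableI_nonneg) (auto simp: s)
  show "expectation (\<lambda>\<omega>. real (G i t j \<omega>) * real (G i t j' \<omega>)) = coef_sq_mean i"
    using coef_sq_mean_pos[OF i] by (simp add: integral_eq_nn_integral s)
qed

subsection \<open>One step of the process\<close>

text \<open>Thinning with a deterministic number of summands, which is what remains of the random
  sum once the past is frozen.\<close>

definition partial_count :: "nat \<Rightarrow> nat \<Rightarrow> nat \<Rightarrow> 'w \<Rightarrow> nat" where
  "partial_count i t n \<omega> = (\<Sum>j\<in>{1..n}. G i t j \<omega>)"

definition thinned :: "nat \<Rightarrow> nat \<Rightarrow> 'w \<Rightarrow> nat" where
  "thinned i t = nb_thinning (G i t) (X i (t - 1))"

definition state :: "nat \<Rightarrow> 'w \<Rightarrow> nat \<times> nat" where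
  "state t \<omega> = (X 1 t \<omega>, X 2 t \<omega>)"

lemma thinned_eq: "thinned i t \<omega> = partial_count i t (X i (t - 1) \<omega> + 1) \<omega>"
  by (simp add: thinned_def nb_thinning_def partial_count_def)

lemma state_rv [measurable]: "state t \<in> measurable M (count_space UNIV)"
proof -
  have "(\<lambda>\<omega>. (X 1 t \<omega>, X 2 t \<omega>)) \<in> measurable M (count_space UNIV \<Otimes>\<^sub>M count_space UNIV)"
    using X_rv[of 1 t] X_rv[of 2 t] by (intro measurable_Pair) auto
  thus ?thesis by (simp add: state_def[abs_def] pair_measure_countable)
qed

lemma partial_count_rv:
  assumes "i \<in> {1, 2}" "1 \<le> t"
  shows "partial_count i t n \<in> measurable M (count_space UNIV)"
  unfolding partial_count_def[abs_def] using assms by (intro measurable_sum_count_space G_rv) auto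

lemma thinned_rv:
  assumes "i \<in> {1, 2}" "1 \<le> t"
  shows "thinned i t \<in> measurable M (count_space UNIV)"
proof -
  have "(\<lambda>\<omega>. partial_count i t (X i (t - 1) \<omega> + 1) \<omega>) \<in> measurable M (count_space UNIV)"
    by (rule measurable_compose_countable[where f = "\<lambda>n. partial_count i t n"])
      (use assms X_rv[OF assms(1)] in \<open>auto intro!: partial_count_rv measurable_add_count_space\<close>)
  thus ?thesis by (simp add: thinned_eq[abs_def])
qed

lemma partial_count_moments:
  assumes it: "i \<in> {1, 2}" "1 \<le> t"
  shows "(\<integral>\<^sup>+\<omega>. ennreal (real (partial_count i t n \<omega>)) \<partial>M) = ennreal (real n * coef_mean (m i) l)"
    and "(\<integral>\<^sup>+\<omega>. ennreal ((real (partial_count i t n \<omega>))\<^sup>2) \<partial>M)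
       = ennreal (real n * coef_mean (m i) l + ((real n)\<^sup>2 + real n) * coef_sq_mean i)"
proof -
  let ?a = "coef_mean (m i) l"
  have eq1: "real (partial_count i t n \<omega>) = (\<Sum>j\<in>{1..n}. real (G i t j \<omega>))" for \<omega>
    by (simp add: partial_count_def)
  have int1: "integrable M (\<lambda>\<omega>. real (partial_count i t n \<omega>))"
    unfolding eq1 using it by (intro Bochner_Integration.integrable_sum counting_moments) auto
  have "expectation (\<lambda>\<omega>. real (partial_count i t n \<omega>)) = (\<Sum>j\<in>{1..n}. ?a)"
    unfolding eq1 using it
    by (subst Bochner_Integration.integral_sum) (auto intro!: counting_moments sum.cong simp del: One_nat_def sum_constant)
  thus "(\<integral>\<^sup>+\<omega>. ennreal (real (partial_count i t n \<omega>)) \<partial>M) = ennreal (real n * coef_mean (m i) l)"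
    by (subst nn_integral_eq_integral[OF int1]) auto
  \<comment> \<open>Off the diagonal the product moment is \<open>coef_sq_mean i\<close>; on the
    diagonal it is \<open>?a + 2 * coef_sq_mean i\<close>. Isolating the surplus on the diagonal
    turns the double sum into \<open>n^2\<close> equal terms plus \<open>n\<close>
    corrections.\<close>
  let ?e = "\<lambda>j j'. coef_sq_mean i + (if j = j' then ?a + coef_sq_mean i else 0)"
  have pair: "integrable M (\<lambda>\<omega>. real (G i t j \<omega>) * real (G i t j' \<omega>))"
    "expectation (\<lambda>\<omega>. real (G i t j \<omega>) * real (G i t j' \<omega>)) = ?e j j'" if "1 \<le> j" "1 \<le> j'" for j j'
    using counting_moments(3,4)[OF it that(1)] counting_product_moments(1,2)[OF it(2) that it(1)]
    by (cases "j = j'"; simp add: power2_eq_square)+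
  have eq2: "(real (partial_count i t n \<omega>))\<^sup>2 = (\<Sum>j\<in>{1..n}. \<Sum>j'\<in>{1..n}. real (G i t j \<omega>) * real (G i t j' \<omega>))" for \<omega>
    by (simp add: eq1 power2_eq_square sum_product)
  have int2: "integrable M (\<lambda>\<omega>. (real (partial_count i t n \<omega>))\<^sup>2)"
    unfolding eq2 by (intro Bochner_Integration.integrable_sum pair) auto
  have "expectation (\<lambda>\<omega>. (real (partial_count i t n \<omega>))\<^sup>2)
      = (\<Sum>j\<in>{1..n}. expectation (\<lambda>\<omega>. \<Sum>j'\<in>{1..n}. real (G i t j \<omega>) * real (G i t j' \<omega>)))"
    unfolding eq2 by (intro Bochner_Integration.integral_sum Bochner_Integration.integrable_sum pair) auto
  also have "\<dots> = (\<Sum>j\<in>{1..n}. \<Sum>j'\<in>{1..n}. expectation (\<lambda>\<omega>. real (G i t j \<omega>) * real (G i t j' \<omega>)))"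
    by (intro sum.cong refl Bochner_Integration.integral_sum pair) auto
  also have "\<dots> = (\<Sum>j\<in>{1..n}. \<Sum>j'\<in>{1..n}. ?e j j')"
    by (intro sum.cong refl pair) auto
  also have "\<dots> = real n * ?a + ((real n)\<^sup>2 + real n) * coef_sq_mean i"
    by (simp add: sum.distrib algebra_simps power2_eq_square)
  finally show "(\<integral>\<^sup>+\<omega>. ennreal ((real (partial_count i t n \<omega>))\<^sup>2) \<partial>M)
       = ennreal (real n * coef_mean (m i) l + ((real n)\<^sup>2 + real n) * coef_sq_mean i)"
    by (subst nn_integral_eq_integral[OF int2]) auto
qed

lemma partial_count_cross_moment:
  assumes t: "1 \<le> t"
  shows "(\<integral>\<^sup>+\<omega>. ennreal (real (partial_count 1 t n \<omega>) * real (partial_count 2 t n' \<omega>)) \<partial>M)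
       = ennreal ((real n * coef_mean (m 1) l) * (real n' * coef_mean (m 2) l))"
proof -
  note pair = counting_product_moments(3,4)[OF t]
  have eq: "real (partial_count 1 t n \<omega>) * real (partial_count 2 t n' \<omega>)
      = (\<Sum>j\<in>{1..n}. \<Sum>j'\<in>{1..n'}. real (G 1 t j \<omega>) * real (G 2 t j' \<omega>))" for \<omega>
    by (simp add: partial_count_def sum_product)
  have int: "integrable M (\<lambda>\<omega>. real (partial_count 1 t n \<omega>) * real (partial_count 2 t n' \<omega>))"
    unfolding eq by (intro Bochner_Integration.integrable_sum pair) auto
  have "expectation (\<lambda>\<omega>. real (partial_count 1 t n \<omega>) * real (partial_count 2 t n' \<omega>))
      = (\<Sum>j\<in>{1..n}. expectation (\<lambda>\<omega>. \<Sum>j'\<in>{1..n'}. real (G 1 t j \<omega>) * real (G 2 t j' \<omega>)))"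
    unfolding eq by (intro Bochner_Integration.integral_sum Bochner_Integration.integrable_sum pair) auto
  also have "\<dots> = (\<Sum>j\<in>{1..n}. \<Sum>j'\<in>{1..n'}. expectation (\<lambda>\<omega>. real (G 1 t j \<omega>) * real (G 2 t j' \<omega>)))"
    by (intro sum.cong refl Bochner_Integration.integral_sum pair) auto
  also have "\<dots> = (\<Sum>j\<in>{1..n}. \<Sum>j'\<in>{1..n'}. coef_mean (m 1) l * coef_mean (m 2) l)"
    by (intro sum.cong refl pair) auto
  finally show ?thesis
    by (subst nn_integral_eq_integral[OF int]) (auto simp: mult_ac)
qed

text \<open>The innovations at time \<open>t\<close> are independent of the whole past trajectory,
  so freezing it makes the number of summands deterministic. The weight may look at any earlier time
  \<open>s\<close>, which the lagged products exploit.\<close>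

lemma thinned_nn_integral:
  fixes \<psi> :: "nat \<times> nat \<Rightarrow> ennreal" and H :: "nat \<Rightarrow> nat \<Rightarrow> ennreal"
  assumes t: "1 \<le> t" and s: "s < t"
  shows "(\<integral>\<^sup>+\<omega>. \<psi> (state s \<omega>) * H (thinned 1 t \<omega>) (thinned 2 t \<omega>) \<partial>M)
       = (\<integral>\<^sup>+\<omega>. \<psi> (state s \<omega>) * (\<integral>\<^sup>+\<omega>'. H (partial_count 1 t (X 1 (t - 1) \<omega> + 1) \<omega>')
            (partial_count 2 t (X 2 (t - 1) \<omega> + 1) \<omega>') \<partial>M) \<partial>M)"
proof -
  let ?S = "((borel :: real measure) \<Otimes>\<^sub>M (borel :: real measure)) \<Otimes>\<^sub>M (\<Pi>\<^sub>M p\<in>{1, 2::nat} \<times> {1::nat..}. count_space (UNIV :: nat set)) \<Otimes>\<^sub>M count_space (UNIV :: (nat \<times> nat) set)"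
  let ?U = "\<lambda>\<omega>. ((\<alpha> 1 t \<omega>, \<alpha> 2 t \<omega>), (\<lambda>(i, j)\<in>{1, 2} \<times> {1..}. G i t j \<omega>), (Z 1 t \<omega>, Z 2 t \<omega>))"
  let ?T = "\<Pi>\<^sub>M s\<in>{..<t}. count_space (UNIV :: (nat \<times> nat) set)"
  let ?P = "\<lambda>\<omega>. \<lambda>s\<in>{..<t}. (X 1 s \<omega>, X 2 s \<omega>)"
  \<comment> \<open>\<open>partial_count\<close> as a function of the value of the innovation
    vector, as the freezing argument requires.\<close>
  define cnt where "cnt i n u = (\<Sum>j\<in>{1..n}. fst (snd u) (i, j))"
    for i n :: nat and u :: "(real \<times> real) \<times> (nat \<times> nat \<Rightarrow> nat) \<times> nat \<times> nat"
  define h where "h u p = \<psi> (p s) * H (cnt 1 (fst (p (t - 1)) + 1) u) (cnt 2 (snd (p (t - 1)) + 1) u)"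
    for u and p :: "nat \<Rightarrow> nat \<times> nat"
  have cnt_m: "cnt i n \<in> measurable ?S (count_space UNIV)" if "i \<in> {1, 2}" for i n
    unfolding cnt_def
  proof (rule measurable_sum_count_space)
    fix j assume "j \<in> {1..n}"
    thus "(\<lambda>u. fst (snd u) (i, j)) \<in> measurable ?S (count_space UNIV)"
      using that by (intro measurable_compose[OF measurable_compose[OF measurable_snd measurable_fst] measurable_component_singleton]) auto
  qed
  have Pm: "(\<lambda>x. snd x r) \<in> measurable (?S \<Otimes>\<^sub>M ?T) (count_space UNIV)" if "r < t" for r
    using that by (intro measurable_compose[OF measurable_snd measurable_component_singleton]) auto
  have cm: "(\<lambda>x. cnt i (c (snd x (t - 1)) + 1) (fst x)) \<in> measurable (?S \<Otimes>\<^sub>M ?T) (count_space UNIV)"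
    if "i \<in> {1, 2}" for i and c :: "nat \<times> nat \<Rightarrow> nat"
  proof (rule measurable_compose_countable[where f = "\<lambda>p x. cnt i (c p + 1) (fst x)" and g = "\<lambda>x. snd x (t - 1)"])
    show "(\<lambda>x. cnt i (c p + 1) (fst x)) \<in> measurable (?S \<Otimes>\<^sub>M ?T) (count_space UNIV)" for p
      by (rule measurable_compose[OF measurable_fst cnt_m[OF that]])
    show "(\<lambda>x. snd x (t - 1)) \<in> measurable (?S \<Otimes>\<^sub>M ?T) (count_space UNIV)"
      using t by (intro Pm) simp
  qed
  have cs: "count_space (UNIV :: (nat \<times> nat) set) \<Otimes>\<^sub>M (count_space (UNIV :: nat set) \<Otimes>\<^sub>M count_space (UNIV :: nat set)) = count_space UNIV"
    by (simp add: pair_measure_countable)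
  have "(\<lambda>x. (snd x s, cnt 1 (fst (snd x (t - 1)) + 1) (fst x), cnt 2 (snd (snd x (t - 1)) + 1) (fst x)))
      \<in> measurable (?S \<Otimes>\<^sub>M ?T) (count_space UNIV)"
    unfolding cs[symmetric] by (intro measurable_Pair Pm[OF s] cm) auto
  moreover have "(\<lambda>(p, a, b). \<psi> p * H a b) \<in> borel_measurable (count_space UNIV)" by simp
  ultimately have "(\<lambda>x. (\<lambda>(p, a, b). \<psi> p * H a b) (snd x s, cnt 1 (fst (snd x (t - 1)) + 1) (fst x), cnt 2 (snd (snd x (t - 1)) + 1) (fst x)))
      \<in> borel_measurable (?S \<Otimes>\<^sub>M ?T)"
    by (rule measurable_compose)
  moreover have "case_prod h = (\<lambda>x. (\<lambda>(p, a, b). \<psi> p * H a b)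
      (snd x s, cnt 1 (fst (snd x (t - 1)) + 1) (fst x), cnt 2 (snd (snd x (t - 1)) + 1) (fst x)))"
    by (simp add: h_def fun_eq_iff)
  ultimately have hm: "case_prod h \<in> borel_measurable (?S \<Otimes>\<^sub>M ?T)"
    by (simp only:)
  have c: "cnt i n (?U \<omega>) = partial_count i t n \<omega>" if "i \<in> {1, 2}" for i n \<omega>
    using that by (auto simp: cnt_def partial_count_def intro!: sum.cong)
  have hc: "h (?U \<omega>') (?P \<omega>) = \<psi> (state s \<omega>) * H (partial_count 1 t (X 1 (t - 1) \<omega> + 1) \<omega>') (partial_count 2 t (X 2 (t - 1) \<omega> + 1) \<omega>')" for \<omega> \<omega>'
    unfolding h_def using t s by (subst c, simp, subst c, simp) (simp add: state_def)
  have [measurable]: "(\<lambda>\<omega>'. H (partial_count 1 t n \<omega>') (partial_count 2 t n' \<omega>')) \<in> borel_measurable M" for n n'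
  proof -
    have "(\<lambda>\<omega>. (partial_count 1 t n \<omega>, partial_count 2 t n' \<omega>)) \<in> measurable M (count_space UNIV \<Otimes>\<^sub>M count_space UNIV)"
      using t by (intro measurable_Pair partial_count_rv) auto
    hence "(\<lambda>\<omega>. (partial_count 1 t n \<omega>, partial_count 2 t n' \<omega>)) \<in> measurable M (count_space UNIV)"
      by (simp add: pair_measure_countable)
    from measurable_compose[OF this, of "\<lambda>(a, b). H a b" borel] show ?thesis by simp
  qed
  have cmult: "(\<integral>\<^sup>+\<omega>'. c * H (partial_count 1 t n \<omega>') (partial_count 2 t n' \<omega>') \<partial>M)
      = c * (\<integral>\<^sup>+\<omega>'. H (partial_count 1 t n \<omega>') (partial_count 2 t n' \<omega>') \<partial>M)" for c n n'
    by (rule nn_integral_cmult) measurable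
  show ?thesis
    using indep_rv_nn_integral[OF indep_innov_past[OF t] hm] unfolding hc cmult thinned_eq .
qed

text \<open>
  \<open>Z\<close> must be split off together with the thinned variables at the random state: given a fixed
  number of counting variables, its independence of them is not assumed.
\<close>

lemma thinned_innovation_nn_integral:
  fixes \<psi> :: "nat \<times> nat \<Rightarrow> ennreal" and H :: "nat \<Rightarrow> nat \<Rightarrow> ennreal" and K :: "nat \<Rightarrow> nat \<Rightarrow> ennreal"
  assumes t: "1 \<le> t" and s: "s < t"
  shows "(\<integral>\<^sup>+\<omega>. \<psi> (state s \<omega>) * H (thinned 1 t \<omega>) (thinned 2 t \<omega>) * K (Z 1 t \<omega>) (Z 2 t \<omega>) \<partial>M)
       = (\<integral>\<^sup>+\<omega>. \<psi> (state s \<omega>) * H (thinned 1 t \<omega>) (thinned 2 t \<omega>) \<partial>M) * (\<integral>\<^sup>+\<omega>. K (Z 1 t \<omega>) (Z 2 t \<omega>) \<partial>M)"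
proof -
  let ?T = "count_space (UNIV :: (nat \<times> nat) set) \<Otimes>\<^sub>M (\<Pi>\<^sub>M s\<in>{..<t}. count_space (UNIV :: (nat \<times> nat) set))"
  have "(\<lambda>v. snd v s) \<in> measurable ?T (count_space UNIV)"
    using s by (intro measurable_compose[OF measurable_snd measurable_component_singleton]) auto
  hence "(\<lambda>v. (fst v, snd v s)) \<in> measurable ?T (count_space UNIV \<Otimes>\<^sub>M count_space UNIV)"
    by (intro measurable_Pair) auto
  hence "(\<lambda>v. (fst v, snd v s)) \<in> measurable ?T (count_space UNIV)"
    by (simp add: pair_measure_countable)
  from measurable_compose[OF this, of "\<lambda>((a, b), p). \<psi> p * H a b" borel]
  have fm: "(\<lambda>v. \<psi> (snd v s) * H (fst (fst v)) (snd (fst v))) \<in> borel_measurable ?T"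
    by (simp add: case_prod_beta')
  from indep_rv_nn_integral_mult[OF Z_indep_thinning_past[OF t], of "\<lambda>z. K (fst z) (snd z)", OF _ fm]
  show ?thesis using s by (simp add: state_def thinned_def mult_ac)
qed

text \<open>Makes a component a function of the state pair, so that facts about atoms and laws of
  the pair apply to each component.\<close>

definition coord :: "nat \<Rightarrow> nat \<times> nat \<Rightarrow> nat" where
  "coord i p = (if i = 1 then fst p else snd p)"

lemma coord_state: "i \<in> {1, 2} \<Longrightarrow> coord i (state t \<omega>) = X i t \<omega>"
  by (auto simp: coord_def state_def)

text \<open>Conditional mean of component \<open>i\<close> at the next time when its present value
  is \<open>x\<close>. Both \<open>cmean\<close> and \<open>cvar\<close> are plain functions on the
  naturals, so that they can be integrated before any conditional expectation is mentioned.\<close>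

definition cmean :: "nat \<Rightarrow> nat \<Rightarrow> real" where
  "cmean i x = coef_mean (m i) l * (real x + 1) + \<mu> i"

definition cvar :: "nat \<Rightarrow> nat \<Rightarrow> real" where
  "cvar i x = coef_var (m i) l * (real x + 1)\<^sup>2
     + (coef_var (m i) l + (coef_mean (m i) l)\<^sup>2 + coef_mean (m i) l) * (real x + 1) + (\<sigma>Z i)\<^sup>2"

lemma coef_var_pos: "i \<in> {1, 2} \<Longrightarrow> 0 < coef_var (m i) l"
  using m_bounds[of i] l_gt_1 by (simp add: coef_var_def)

lemma state_fun_rv [measurable]:
  fixes f :: "nat \<times> nat \<Rightarrow> 'b :: topological_space"
  shows "(\<lambda>\<omega>. f (state t \<omega>)) \<in> borel_measurable M"
  by (rule measurable_compose[OF state_rv]) simp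

lemma X_fun_rv [measurable]:
  assumes "i \<in> {1, 2}"
  shows "(\<lambda>\<omega>. real (X i t \<omega>)) \<in> borel_measurable M"
  by (rule measurable_compose[OF X_rv[OF assms]]) simp

lemma Z_fun_rv [measurable]:
  assumes "i \<in> {1, 2}" "1 \<le> t"
  shows "(\<lambda>\<omega>. real (Z i t \<omega>)) \<in> borel_measurable M"
  by (rule measurable_compose[OF Z_rv[OF assms]]) simp

lemma thinned_fun_rv [measurable]:
  assumes "i \<in> {1, 2}" "1 \<le> t"
  shows "(\<lambda>\<omega>. real (thinned i t \<omega>)) \<in> borel_measurable M"
  by (rule measurable_compose[OF thinned_rv[OF assms]]) simp

lemma X_eq:
  assumes "i \<in> {1, 2}" "1 \<le> t" "\<omega> \<in> space M"
  shows "X i t \<omega> = thinned i t \<omega> + Z i t \<omega>"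
  using recursion[OF assms] by (simp add: thinned_def)

lemma \<mu>_nonneg: assumes "i \<in> {1, 2}" shows "0 \<le> \<mu> i"
proof -
  have "0 \<le> expectation (\<lambda>\<omega>. real (Z i 1 \<omega>))" by (intro Bochner_Integration.integral_nonneg) simp
  thus ?thesis unfolding Z_mean[OF assms le_refl] .
qed

lemma Z_integrable:
  assumes "i \<in> {1, 2}" "1 \<le> t"
  shows "integrable M (\<lambda>\<omega>. real (Z i t \<omega>))"
  using square_integrable_imp_integrable[OF Z_fun_rv[OF assms] Z_square_integrable[OF assms]] .

lemma Z_nn_moments:
  assumes it: "i \<in> {1, 2}" "1 \<le> t"
  shows "(\<integral>\<^sup>+\<omega>. ennreal (real (Z i t \<omega>)) \<partial>M) = ennreal (\<mu> i)"
    and "(\<integral>\<^sup>+\<omega>. ennreal ((real (Z i t \<omega>))\<^sup>2) \<partial>M) = ennreal ((\<sigma>Z i)\<^sup>2 + (\<mu> i)\<^sup>2)"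
proof -
  show "(\<integral>\<^sup>+\<omega>. ennreal (real (Z i t \<omega>)) \<partial>M) = ennreal (\<mu> i)"
    using nn_integral_eq_integral[OF Z_integrable[OF it]] Z_mean[OF it] by simp
  have "expectation (\<lambda>\<omega>. (real (Z i t \<omega>))\<^sup>2) = (\<sigma>Z i)\<^sup>2 + (\<mu> i)\<^sup>2"
    using variance_eq[OF Z_integrable[OF it] Z_square_integrable[OF it]] Z_var[OF it] Z_mean[OF it] by simp
  thus "(\<integral>\<^sup>+\<omega>. ennreal ((real (Z i t \<omega>))\<^sup>2) \<partial>M) = ennreal ((\<sigma>Z i)\<^sup>2 + (\<mu> i)\<^sup>2)"
    using nn_integral_eq_integral[OF Z_square_integrable[OF it]] by simp
qed

text \<open>The covariance \<phi> may be negative, but this sum is the mean of a product of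
  nonnegative variables.\<close>

lemma Z_nn_cross:
  assumes t: "1 \<le> t"
  shows "(\<integral>\<^sup>+\<omega>. ennreal (real (Z 1 t \<omega>) * real (Z 2 t \<omega>)) \<partial>M) = ennreal (\<phi> + \<mu> 1 * \<mu> 2)"
    and "0 \<le> \<phi> + \<mu> 1 * \<mu> 2"
proof -
  have i: "integrable M (\<lambda>\<omega>. real (Z 1 t \<omega>))" "integrable M (\<lambda>\<omega>. real (Z 2 t \<omega>))"
    using t by (auto intro: Z_integrable)
  have [measurable]: "(\<lambda>\<omega>. real (Z 1 t \<omega>)) \<in> borel_measurable M" "(\<lambda>\<omega>. real (Z 2 t \<omega>)) \<in> borel_measurable M"
    using t by (auto intro: Z_fun_rv)
  have int: "integrable M (\<lambda>\<omega>. real (Z 1 t \<omega>) * real (Z 2 t \<omega>))"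
  proof (rule Bochner_Integration.integrable_bound)
    show "integrable M (\<lambda>\<omega>. (real (Z 1 t \<omega>))\<^sup>2 + (real (Z 2 t \<omega>))\<^sup>2)"
      using t by (intro Bochner_Integration.integrable_add Z_square_integrable) auto
    have "x * y \<le> x\<^sup>2 + y\<^sup>2" if "0 \<le> x" "0 \<le> y" for x y :: real
    proof -
      have "2 * (x * y) \<le> x\<^sup>2 + y\<^sup>2" using sum_squares_bound[of x y] by (simp add: mult.assoc)
      moreover have "0 \<le> x * y" using that by simp
      ultimately show ?thesis by linarith
    qed
    thus "AE \<omega> in M. norm (real (Z 1 t \<omega>) * real (Z 2 t \<omega>)) \<le> norm ((real (Z 1 t \<omega>))\<^sup>2 + (real (Z 2 t \<omega>))\<^sup>2)"
      by (intro always_eventually allI) simp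
  qed measurable
  have E: "expectation (\<lambda>\<omega>. real (Z 1 t \<omega>) * real (Z 2 t \<omega>)) = \<phi> + \<mu> 1 * \<mu> 2"
    using covariance_eq[OF i int] Z_cov[OF t] Z_mean[OF _ t, of 1] Z_mean[OF _ t, of 2] by simp
  have "0 \<le> expectation (\<lambda>\<omega>. real (Z 1 t \<omega>) * real (Z 2 t \<omega>))"
    by (intro Bochner_Integration.integral_nonneg) simp
  thus "0 \<le> \<phi> + \<mu> 1 * \<mu> 2" by (simp only: E)
  show "(\<integral>\<^sup>+\<omega>. ennreal (real (Z 1 t \<omega>) * real (Z 2 t \<omega>)) \<partial>M) = ennreal (\<phi> + \<mu> 1 * \<mu> 2)"
    using nn_integral_eq_integral[OF int] E by simp
qed

lemma cmean_nonneg: "i \<in> {1, 2} \<Longrightarrow> 0 \<le> cmean i x"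
  using coef_mean_bounds[of i] \<mu>_nonneg[of i] by (simp add: cmean_def)

lemma cvar_nonneg: "i \<in> {1, 2} \<Longrightarrow> 0 \<le> cvar i x"
  using coef_mean_bounds[of i] coef_var_pos[of i] by (simp add: cvar_def)

lemma cmean_cross_nonneg: "0 \<le> cmean 1 x * cmean 2 y + \<phi>"
proof -
  have "cmean 1 x * cmean 2 y + \<phi> = coef_mean (m 1) l * (real x + 1) * cmean 2 y
      + \<mu> 1 * (coef_mean (m 2) l * (real y + 1)) + (\<phi> + \<mu> 1 * \<mu> 2)"
    by (simp add: cmean_def algebra_simps)
  moreover have "0 \<le> coef_mean (m 1) l * (real x + 1) * cmean 2 y" "0 \<le> \<mu> 1 * (coef_mean (m 2) l * (real y + 1))"
    using coef_mean_bounds[of 1] coef_mean_bounds[of 2] \<mu>_nonneg[of 1] cmean_nonneg[of 2 y] by auto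
  ultimately show ?thesis using Z_nn_cross(2)[of 1] by linarith
qed

section \<open>One-step moments weighted by a function of an earlier state\<close>

context
  fixes \<psi> :: "nat \<times> nat \<Rightarrow> ennreal" and s t :: nat
  assumes t: "1 \<le> t" and s: "s < t"
begin

lemma thinned_nn_integral_single:
  assumes i: "i \<in> {1, 2}"
  shows "(\<integral>\<^sup>+\<omega>. \<psi> (state s \<omega>) * h (thinned i t \<omega>) \<partial>M)
       = (\<integral>\<^sup>+\<omega>. \<psi> (state s \<omega>) * (\<integral>\<^sup>+\<omega>'. h (partial_count i t (X i (t - 1) \<omega> + 1) \<omega>') \<partial>M) \<partial>M)"
  using thinned_nn_integral[OF t s, of \<psi> "\<lambda>a b. h (if i = 1 then a else b)"] i
  by (auto simp del: One_nat_def)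

lemma thinned_innovation_nn_integral_single:
  assumes i: "i \<in> {1, 2}" and j: "j \<in> {1, 2}"
  shows "(\<integral>\<^sup>+\<omega>. \<psi> (state s \<omega>) * h (thinned i t \<omega>) * k (Z j t \<omega>) \<partial>M)
       = (\<integral>\<^sup>+\<omega>. \<psi> (state s \<omega>) * h (thinned i t \<omega>) \<partial>M) * (\<integral>\<^sup>+\<omega>. k (Z j t \<omega>) \<partial>M)"
  using thinned_innovation_nn_integral[OF t s, of \<psi> "\<lambda>a b. h (if i = 1 then a else b)" "\<lambda>a b. k (if j = 1 then a else b)"] i j
  by (auto simp del: One_nat_def)

lemma thinned_mean:
  assumes i: "i \<in> {1, 2}"
  shows "(\<integral>\<^sup>+\<omega>. \<psi> (state s \<omega>) * ennreal (real (thinned i t \<omega>)) \<partial>M)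
       = (\<integral>\<^sup>+\<omega>. \<psi> (state s \<omega>) * ennreal (coef_mean (m i) l * (real (X i (t - 1) \<omega>) + 1)) \<partial>M)"
  by (subst thinned_nn_integral_single[OF i, of "\<lambda>a. ennreal (real a)"])
    (simp add: partial_count_moments[OF i t] mult.commute add.commute)

lemma thinned_second_moment:
  assumes i: "i \<in> {1, 2}"
  shows "(\<integral>\<^sup>+\<omega>. \<psi> (state s \<omega>) * ennreal ((real (thinned i t \<omega>))\<^sup>2) \<partial>M)
       = (\<integral>\<^sup>+\<omega>. \<psi> (state s \<omega>) * ennreal (coef_mean (m i) l * (real (X i (t - 1) \<omega>) + 1)
          + ((real (X i (t - 1) \<omega>) + 1)\<^sup>2 + (real (X i (t - 1) \<omega>) + 1)) * coef_sq_mean i) \<partial>M)"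
  by (subst thinned_nn_integral_single[OF i, of "\<lambda>a. ennreal ((real a)\<^sup>2)"])
    (simp add: partial_count_moments[OF i t] mult.commute add.commute)

lemma thinned_cross_moment:
  shows "(\<integral>\<^sup>+\<omega>. \<psi> (state s \<omega>) * ennreal (real (thinned 1 t \<omega>) * real (thinned 2 t \<omega>)) \<partial>M)
       = (\<integral>\<^sup>+\<omega>. \<psi> (state s \<omega>) * ennreal ((coef_mean (m 1) l * (real (X 1 (t - 1) \<omega>) + 1))
           * (coef_mean (m 2) l * (real (X 2 (t - 1) \<omega>) + 1))) \<partial>M)"
  by (subst thinned_nn_integral[OF t s, of _ "\<lambda>a b. ennreal (real a * real b)"], subst partial_count_cross_moment[OF t])
    (simp add: mult.commute add.commute)

lemma innovation_nn_integral:
  assumes j: "j \<in> {1, 2}"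
  shows "(\<integral>\<^sup>+\<omega>. \<psi> (state s \<omega>) * k (Z j t \<omega>) \<partial>M) = (\<integral>\<^sup>+\<omega>. \<psi> (state s \<omega>) \<partial>M) * (\<integral>\<^sup>+\<omega>. k (Z j t \<omega>) \<partial>M)"
  using thinned_innovation_nn_integral_single[of 1 j "\<lambda>_. 1" k] j by simp

text \<open>The thinned part contributes the coefficient mean times the number of counting
  variables, the innovation contributes its mean. The weight sits at time \<open>s\<close>, the
  right side at time \<open>t - 1\<close>; the two times coincide for conditional moments and differ
  for larger lags.\<close>

lemma step_mean:
  assumes i: "i \<in> {1, 2}"
  shows "(\<integral>\<^sup>+\<omega>. \<psi> (state s \<omega>) * ennreal (real (X i t \<omega>)) \<partial>M)
       = (\<integral>\<^sup>+\<omega>. \<psi> (state s \<omega>) * ennreal (cmean i (X i (t - 1) \<omega>)) \<partial>M)"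
proof -
  note [measurable] = X_fun_rv[OF i] Z_fun_rv[OF i t] thinned_fun_rv[OF i t]
  have "(\<integral>\<^sup>+\<omega>. \<psi> (state s \<omega>) * ennreal (real (X i t \<omega>)) \<partial>M)
      = (\<integral>\<^sup>+\<omega>. \<psi> (state s \<omega>) * ennreal (real (thinned i t \<omega>)) + \<psi> (state s \<omega>) * ennreal (real (Z i t \<omega>)) \<partial>M)"
    by (intro nn_integral_cong) (simp add: X_eq[OF i t] distrib_left)
  also have "\<dots> = (\<integral>\<^sup>+\<omega>. \<psi> (state s \<omega>) * ennreal (coef_mean (m i) l * (real (X i (t - 1) \<omega>) + 1)) + \<psi> (state s \<omega>) * ennreal (\<mu> i) \<partial>M)"
    by (subst (1 2) nn_integral_add)
       (simp_all add: thinned_mean[OF i] innovation_nn_integral[OF i, of "\<lambda>a. ennreal (real a)"] Z_nn_moments[OF i t] nn_integral_multc)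
  also have "\<dots> = (\<integral>\<^sup>+\<omega>. \<psi> (state s \<omega>) * ennreal (cmean i (X i (t - 1) \<omega>)) \<partial>M)"
    using coef_mean_bounds(1)[OF i] \<mu>_nonneg[OF i]
    by (intro nn_integral_cong) (simp add: cmean_def distrib_left)
  finally show ?thesis .
qed

text \<open>The square of thinned part plus innovation is expanded, and independence factorises the
  mixed term. The outcome is regrouped as variance plus squared mean, a sum of nonnegative
  terms.\<close>

lemma step_second_moment:
  assumes i: "i \<in> {1, 2}"
  shows "(\<integral>\<^sup>+\<omega>. \<psi> (state s \<omega>) * ennreal ((real (X i t \<omega>))\<^sup>2) \<partial>M)
       = (\<integral>\<^sup>+\<omega>. \<psi> (state s \<omega>) * ennreal (cvar i (X i (t - 1) \<omega>) + (cmean i (X i (t - 1) \<omega>))\<^sup>2) \<partial>M)"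
proof -
  note [measurable] = X_fun_rv[OF i] Z_fun_rv[OF i t] thinned_fun_rv[OF i t]
  let ?n = "\<lambda>\<omega>. real (X i (t - 1) \<omega>) + 1" and ?a = "coef_mean (m i) l"
  have "(\<integral>\<^sup>+\<omega>. \<psi> (state s \<omega>) * ennreal ((real (X i t \<omega>))\<^sup>2) \<partial>M)
      = (\<integral>\<^sup>+\<omega>. \<psi> (state s \<omega>) * ennreal ((real (thinned i t \<omega>))\<^sup>2)
          + (2 * (\<psi> (state s \<omega>) * ennreal (real (thinned i t \<omega>)) * ennreal (real (Z i t \<omega>)))
          + \<psi> (state s \<omega>) * ennreal ((real (Z i t \<omega>))\<^sup>2)) \<partial>M)"
  proof (rule nn_integral_cong)
    fix \<omega> assume "\<omega> \<in> space M"
    define x z where "x = real (thinned i t \<omega>)" and "z = real (Z i t \<omega>)"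
    have "(real (X i t \<omega>))\<^sup>2 = x\<^sup>2 + (2 * (x * z) + z\<^sup>2)"
      by (simp add: X_eq[OF i t \<open>\<omega> \<in> space M\<close>] x_def z_def power2_eq_square algebra_simps)
    moreover have "ennreal (x\<^sup>2 + (2 * (x * z) + z\<^sup>2)) = ennreal (x\<^sup>2) + (2 * (ennreal x * ennreal z) + ennreal (z\<^sup>2))"
      by (simp add: x_def z_def ennreal_mult)
    ultimately show "\<psi> (state s \<omega>) * ennreal ((real (X i t \<omega>))\<^sup>2) = \<psi> (state s \<omega>) * ennreal ((real (thinned i t \<omega>))\<^sup>2)
          + (2 * (\<psi> (state s \<omega>) * ennreal (real (thinned i t \<omega>)) * ennreal (real (Z i t \<omega>)))
          + \<psi> (state s \<omega>) * ennreal ((real (Z i t \<omega>))\<^sup>2))"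
      by (simp add: distrib_left mult_ac flip: x_def z_def)
  qed
  also have "\<dots> = (\<integral>\<^sup>+\<omega>. \<psi> (state s \<omega>) * ennreal (?a * ?n \<omega> + ((?n \<omega>)\<^sup>2 + ?n \<omega>) * coef_sq_mean i)
      + (2 * (\<psi> (state s \<omega>) * ennreal (?a * ?n \<omega>) * ennreal (\<mu> i))
      + \<psi> (state s \<omega>) * ennreal ((\<sigma>Z i)\<^sup>2 + (\<mu> i)\<^sup>2)) \<partial>M)"
    by (simp add: nn_integral_add nn_integral_cmult nn_integral_multc thinned_second_moment[OF i] thinned_mean[OF i]
      innovation_nn_integral[OF i, of "\<lambda>a. ennreal ((real a)\<^sup>2)"]
      thinned_innovation_nn_integral_single[OF i i, of "\<lambda>a. ennreal (real a)" "\<lambda>a. ennreal (real a)"] Z_nn_moments[OF i t])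
  also have "\<dots> = (\<integral>\<^sup>+\<omega>. \<psi> (state s \<omega>) * ennreal (cvar i (X i (t - 1) \<omega>) + (cmean i (X i (t - 1) \<omega>))\<^sup>2) \<partial>M)"
  proof (rule nn_integral_cong)
    fix \<omega>
    define n where "n = ?n \<omega>"
    have nn: "0 \<le> n" "0 \<le> ?a" "0 \<le> coef_sq_mean i" "0 \<le> \<mu> i"
      using coef_mean_bounds(1)[OF i] coef_sq_mean_pos[OF i] \<mu>_nonneg[OF i] by (auto simp: n_def)
    have gen: "ennreal (A + (2 * (B * C) + D)) = ennreal A + (2 * (ennreal B * ennreal C) + ennreal D)"
      if "0 \<le> A" "0 \<le> B" "0 \<le> C" "0 \<le> D" for A B C D
      using that by (simp add: ennreal_mult)
    have "cvar i (X i (t - 1) \<omega>) + (cmean i (X i (t - 1) \<omega>))\<^sup>2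
        = (?a * n + (n\<^sup>2 + n) * coef_sq_mean i) + (2 * ((?a * n) * \<mu> i) + ((\<sigma>Z i)\<^sup>2 + (\<mu> i)\<^sup>2))"
      by (simp add: cvar_def cmean_def coef_sq_mean_def n_def power2_eq_square algebra_simps)
    also have "ennreal \<dots> = ennreal (?a * n + (n\<^sup>2 + n) * coef_sq_mean i) + (2 * (ennreal (?a * n) * ennreal (\<mu> i)) + ennreal ((\<sigma>Z i)\<^sup>2 + (\<mu> i)\<^sup>2))"
      using nn by (intro gen) auto
    finally show "\<psi> (state s \<omega>) * ennreal (?a * ?n \<omega> + ((?n \<omega>)\<^sup>2 + ?n \<omega>) * coef_sq_mean i)
      + (2 * (\<psi> (state s \<omega>) * ennreal (?a * ?n \<omega>) * ennreal (\<mu> i))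
      + \<psi> (state s \<omega>) * ennreal ((\<sigma>Z i)\<^sup>2 + (\<mu> i)\<^sup>2)) = \<psi> (state s \<omega>) * ennreal (cvar i (X i (t - 1) \<omega>) + (cmean i (X i (t - 1) \<omega>))\<^sup>2)"
      by (simp only: n_def[symmetric]) (simp only: distrib_left mult_ac)
  qed
  finally show ?thesis .
qed

text \<open>Given the state, the thinned parts of the two components are uncorrelated and each is
  uncorrelated with the innovations, so only the product of the innovations contributes
  \<phi>.\<close>

lemma step_cross_moment:
  shows "(\<integral>\<^sup>+\<omega>. \<psi> (state s \<omega>) * ennreal (real (X 1 t \<omega>) * real (X 2 t \<omega>)) \<partial>M)
       = (\<integral>\<^sup>+\<omega>. \<psi> (state s \<omega>) * ennreal (cmean 1 (X 1 (t - 1) \<omega>) * cmean 2 (X 2 (t - 1) \<omega>) + \<phi>) \<partial>M)"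
proof -
  have i: "1 \<in> {1, 2 :: nat}" "2 \<in> {1, 2 :: nat}" by auto
  note [measurable] = X_fun_rv[OF i(1)] X_fun_rv[OF i(2)] Z_fun_rv[OF i(1) t] Z_fun_rv[OF i(2) t]
    thinned_fun_rv[OF i(1) t] thinned_fun_rv[OF i(2) t]
  let ?n = "\<lambda>i \<omega>. coef_mean (m i) l * (real (X i (t - 1) \<omega>) + 1)"
  have ZZ: "(\<integral>\<^sup>+\<omega>. \<psi> (state s \<omega>) * ennreal (real (Z 1 t \<omega>) * real (Z 2 t \<omega>)) \<partial>M) = (\<integral>\<^sup>+\<omega>. \<psi> (state s \<omega>) \<partial>M) * ennreal (\<phi> + \<mu> 1 * \<mu> 2)"
    using thinned_innovation_nn_integral[OF t s, of \<psi> "\<lambda>_ _. 1" "\<lambda>a b. ennreal (real a * real b)"] Z_nn_cross(1)[OF t] by simp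
  have "(\<integral>\<^sup>+\<omega>. \<psi> (state s \<omega>) * ennreal (real (X 1 t \<omega>) * real (X 2 t \<omega>)) \<partial>M)
      = (\<integral>\<^sup>+\<omega>. \<psi> (state s \<omega>) * ennreal (real (thinned 1 t \<omega>) * real (thinned 2 t \<omega>))
          + (\<psi> (state s \<omega>) * ennreal (real (thinned 1 t \<omega>)) * ennreal (real (Z 2 t \<omega>))
          + (\<psi> (state s \<omega>) * ennreal (real (thinned 2 t \<omega>)) * ennreal (real (Z 1 t \<omega>))
          + \<psi> (state s \<omega>) * ennreal (real (Z 1 t \<omega>) * real (Z 2 t \<omega>)))) \<partial>M)"
  proof (rule nn_integral_cong)
    fix \<omega> assume w: "\<omega> \<in> space M"
    define x1 z1 x2 z2 where "x1 = real (thinned 1 t \<omega>)" and "z1 = real (Z 1 t \<omega>)"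
      and "x2 = real (thinned 2 t \<omega>)" and "z2 = real (Z 2 t \<omega>)"
    have "real (X 1 t \<omega>) * real (X 2 t \<omega>) = x1 * x2 + (x1 * z2 + (x2 * z1 + z1 * z2))"
      unfolding X_eq[OF i(1) t w] X_eq[OF i(2) t w] x1_def z1_def x2_def z2_def by (simp add: algebra_simps)
    moreover have "ennreal (x1 * x2 + (x1 * z2 + (x2 * z1 + z1 * z2))) = ennreal (x1 * x2) + (ennreal x1 * ennreal z2 + (ennreal x2 * ennreal z1 + ennreal (z1 * z2)))"
      by (simp add: x1_def z1_def x2_def z2_def ennreal_mult)
    ultimately show "\<psi> (state s \<omega>) * ennreal (real (X 1 t \<omega>) * real (X 2 t \<omega>)) =
          \<psi> (state s \<omega>) * ennreal (real (thinned 1 t \<omega>) * real (thinned 2 t \<omega>))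
          + (\<psi> (state s \<omega>) * ennreal (real (thinned 1 t \<omega>)) * ennreal (real (Z 2 t \<omega>))
          + (\<psi> (state s \<omega>) * ennreal (real (thinned 2 t \<omega>)) * ennreal (real (Z 1 t \<omega>))
          + \<psi> (state s \<omega>) * ennreal (real (Z 1 t \<omega>) * real (Z 2 t \<omega>))))"
      unfolding x1_def[symmetric] z1_def[symmetric] x2_def[symmetric] z2_def[symmetric]
      by (simp only: distrib_left mult_ac)
  qed
  also have "\<dots> = (\<integral>\<^sup>+\<omega>. \<psi> (state s \<omega>) * ennreal (?n 1 \<omega> * ?n 2 \<omega>)
          + (\<psi> (state s \<omega>) * ennreal (?n 1 \<omega>) * ennreal (\<mu> 2)
          + (\<psi> (state s \<omega>) * ennreal (?n 2 \<omega>) * ennreal (\<mu> 1)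
          + \<psi> (state s \<omega>) * ennreal (\<phi> + \<mu> 1 * \<mu> 2))) \<partial>M)"
    using ZZ thinned_cross_moment
    by (simp add: nn_integral_add nn_integral_multc thinned_mean[OF i(1)] thinned_mean[OF i(2)]
      thinned_innovation_nn_integral_single[OF i(1) i(2), of "\<lambda>a. ennreal (real a)" "\<lambda>a. ennreal (real a)"]
      thinned_innovation_nn_integral_single[OF i(2) i(1), of "\<lambda>a. ennreal (real a)" "\<lambda>a. ennreal (real a)"]
      Z_nn_moments[OF i(1) t] Z_nn_moments[OF i(2) t] del: One_nat_def ennreal_plus)
  also have "\<dots> = (\<integral>\<^sup>+\<omega>. \<psi> (state s \<omega>) * ennreal (cmean 1 (X 1 (t - 1) \<omega>) * cmean 2 (X 2 (t - 1) \<omega>) + \<phi>) \<partial>M)"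
  proof (rule nn_integral_cong)
    fix \<omega>
    define x y where "x = ?n 1 \<omega>" and "y = ?n 2 \<omega>"
    have nn: "0 \<le> x" "0 \<le> y" "0 \<le> \<mu> 1" "0 \<le> \<mu> 2" "0 \<le> \<phi> + \<mu> 1 * \<mu> 2"
      using coef_mean_bounds(1)[OF i(1)] coef_mean_bounds(1)[OF i(2)] \<mu>_nonneg[OF i(1)] \<mu>_nonneg[OF i(2)] Z_nn_cross(2)[OF t]
      by (auto simp: x_def y_def)
    have gen: "ennreal (A * B + (A * C + (B * D + E))) = ennreal (A * B) + (ennreal A * ennreal C + (ennreal B * ennreal D + ennreal E))"
      if "0 \<le> A" "0 \<le> B" "0 \<le> C" "0 \<le> D" "0 \<le> E" for A B C D E
      using that by (simp add: ennreal_mult)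
    \<comment> \<open>\<phi> stays grouped with \<open>\<mu> 1 * \<mu> 2\<close>: this sum is
      nonnegative, so the image under \<open>ennreal\<close> may be split term by term.\<close>
    have "cmean 1 (X 1 (t - 1) \<omega>) * cmean 2 (X 2 (t - 1) \<omega>) + \<phi> = x * y + (x * \<mu> 2 + (y * \<mu> 1 + (\<phi> + \<mu> 1 * \<mu> 2)))"
      unfolding cmean_def x_def y_def by algebra
    also have "ennreal \<dots> = ennreal (x * y) + (ennreal x * ennreal (\<mu> 2) + (ennreal y * ennreal (\<mu> 1) + ennreal (\<phi> + \<mu> 1 * \<mu> 2)))"
      using nn by (intro gen) auto
    finally show "\<psi> (state s \<omega>) * ennreal (?n 1 \<omega> * ?n 2 \<omega>)
          + (\<psi> (state s \<omega>) * ennreal (?n 1 \<omega>) * ennreal (\<mu> 2)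
          + (\<psi> (state s \<omega>) * ennreal (?n 2 \<omega>) * ennreal (\<mu> 1)
          + \<psi> (state s \<omega>) * ennreal (\<phi> + \<mu> 1 * \<mu> 2))) = \<psi> (state s \<omega>) * ennreal (cmean 1 (X 1 (t - 1) \<omega>) * cmean 2 (X 2 (t - 1) \<omega>) + \<phi>)"
      unfolding x_def[symmetric] y_def[symmetric] by (simp only: distrib_left mult_ac)
  qed
  finally show ?thesis .
qed

end

subsection \<open>Conditional moments\<close>

text \<open>On an atom of the state the comparison function is the constant \<open>g y\<close>, so
  the integral over the atom is finite even when \<open>f\<close> has infinite mean.\<close>

lemma has_atom_integral:
  fixes f :: "'w \<Rightarrow> real" and g :: "nat \<times> nat \<Rightarrow> real"
  assumes [measurable]: "f \<in> borel_measurable M" and f: "\<And>\<omega>. 0 \<le> f \<omega>" and g: "0 \<le> g y"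
    and eq: "(\<integral>\<^sup>+\<omega>. indicator {y} (state t \<omega>) * ennreal (f \<omega>) \<partial>M) = (\<integral>\<^sup>+\<omega>. indicator {y} (state t \<omega>) * ennreal (g (state t \<omega>)) \<partial>M)"
  shows "has_bochner_integral M (\<lambda>\<omega>. indicator {y} (state t \<omega>) * f \<omega>) (g y * prob {\<omega> \<in> space M. state t \<omega> = y})"
proof (rule has_bochner_integral_nn_integral)
  show "(\<lambda>\<omega>. indicator {y} (state t \<omega>) * f \<omega>) \<in> borel_measurable M"
    by (intro borel_measurable_times state_fun_rv) simp
  have "(\<integral>\<^sup>+\<omega>. ennreal (indicator {y} (state t \<omega>) * f \<omega>) \<partial>M) = (\<integral>\<^sup>+\<omega>. indicator {y} (state t \<omega>) * ennreal (f \<omega>) \<partial>M)"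
    by (intro nn_integral_cong) (simp split: split_indicator)
  also have "\<dots> = (\<integral>\<^sup>+\<omega>. ennreal (g y) * indicator {\<omega> \<in> space M. state t \<omega> = y} \<omega> \<partial>M)"
    unfolding eq by (intro nn_integral_cong) (auto split: split_indicator)
  also have "\<dots> = ennreal (g y * prob {\<omega> \<in> space M. state t \<omega> = y})"
    using g by (simp add: nn_integral_cmult emeasure_eq_measure ennreal_mult)
  finally show "(\<integral>\<^sup>+\<omega>. ennreal (indicator {y} (state t \<omega>) * f \<omega>) \<partial>M) = ennreal (g y * prob {\<omega> \<in> space M. state t \<omega> = y})" .
qed (use f g in auto)

lemma atom_indicator_integral:
  "has_bochner_integral M (\<lambda>\<omega>. indicator {y} (state t \<omega>)) (prob {\<omega> \<in> space M. state t \<omega> = y})"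
  using has_atom_integral[of "\<lambda>_. 1" "\<lambda>_. 1" y t] by simp

lemma state_algebra_eq: "state_algebra M X t = vimage_algebra (space M) (state t) (count_space UNIV)"
  by (simp add: state_algebra_def state_def[abs_def])

lemma real_cond_exp_state:
  assumes f: "f \<in> borel_measurable M"
    and int: "\<And>y. has_bochner_integral M (\<lambda>\<omega>. indicator {y} (state t \<omega>) * f \<omega>) (g y * prob {\<omega> \<in> space M. state t \<omega> = y})"
  shows "AE \<omega> in M. real_cond_exp M (state_algebra M X t) f \<omega> = g (state t \<omega>)"
  unfolding state_algebra_eq using int
  by (intro real_cond_exp_discrete state_rv f) (auto simp: has_bochner_integral_iff)

lemma state_subalgebra: "sigma_finite_subalgebra M (state_algebra M X t)"
proof -
  have "subalgebra M (state_algebra M X t)"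
    using state_rv[of t] unfolding measurable_iff_sets subalgebra_def state_algebra_eq by simp
  then interpret F: finite_measure_subalgebra M "state_algebra M X t"
    by unfold_locales
  show ?thesis by unfold_locales
qed

section \<open>Moments on single atoms, and the conditional moments they determine\<close>

context
  fixes t :: nat
begin

lemma atom_mean:
  assumes i: "i \<in> {1, 2}"
  shows "has_bochner_integral M (\<lambda>\<omega>. indicator {y} (state t \<omega>) * real (X i (t + 1) \<omega>))
    (cmean i (coord i y) * prob {\<omega> \<in> space M. state t \<omega> = y})"
  using step_mean[of "t + 1" t i "indicator {y}"] i
  by (intro has_atom_integral[where g = "\<lambda>y. cmean i (coord i y)"] X_fun_rv cmean_nonneg)
     (auto simp: coord_state simp del: One_nat_def)

lemma atom_second_moment:
  assumes i: "i \<in> {1, 2}"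
  shows "has_bochner_integral M (\<lambda>\<omega>. indicator {y} (state t \<omega>) * (real (X i (t + 1) \<omega>))\<^sup>2)
    ((cvar i (coord i y) + (cmean i (coord i y))\<^sup>2) * prob {\<omega> \<in> space M. state t \<omega> = y})"
  using step_second_moment[of "t + 1" t i "indicator {y}"] i
  by (intro has_atom_integral[where g = "\<lambda>y. cvar i (coord i y) + (cmean i (coord i y))\<^sup>2"] borel_measurable_power X_fun_rv add_nonneg_nonneg cvar_nonneg)
     (auto simp: coord_state simp del: One_nat_def)

lemma atom_cross_moment:
  shows "has_bochner_integral M (\<lambda>\<omega>. indicator {y} (state t \<omega>) * (real (X 1 (t + 1) \<omega>) * real (X 2 (t + 1) \<omega>)))
    ((cmean 1 (coord 1 y) * cmean 2 (coord 2 y) + \<phi>) * prob {\<omega> \<in> space M. state t \<omega> = y})"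
  using step_cross_moment[of "t + 1" t "indicator {y}"] cmean_cross_nonneg
  by (intro has_atom_integral[where g = "\<lambda>y. cmean 1 (coord 1 y) * cmean 2 (coord 2 y) + \<phi>"] borel_measurable_times X_fun_rv)
     (auto simp: coord_state simp del: One_nat_def)

lemma cond_mean:
  assumes i: "i \<in> {1, 2}"
  shows "AE \<omega> in M. real_cond_exp M (state_algebra M X t) (\<lambda>\<omega>. real (X i (t + 1) \<omega>)) \<omega> = cmean i (X i t \<omega>)"
  using real_cond_exp_state[OF X_fun_rv[OF i] atom_mean[OF i]] i by (simp add: coord_state)

text \<open>The conditional mean is first replaced by its explicit version. On an atom that version
  is a constant \<open>c\<close>, and expanding the square leaves
  \<open>cvar + c^2 - 2 * c^2 + c^2\<close>. All integrals are over single atoms, so an infinite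
  second moment does no harm.\<close>

lemma cond_variance:
  assumes i: "i \<in> {1, 2}"
  shows "AE \<omega> in M. cond_variance M (state_algebra M X t) (\<lambda>\<omega>. real (X i (t + 1) \<omega>)) \<omega> = cvar i (X i t \<omega>)"
proof -
  interpret F: sigma_finite_subalgebra M "state_algebra M X t" by (rule state_subalgebra)
  let ?c = "\<lambda>\<omega>. cmean i (coord i (state t \<omega>))"
  let ?R = "real_cond_exp M (state_algebra M X t) (\<lambda>\<omega>. real (X i (t + 1) \<omega>))"
  note [measurable] = X_fun_rv[OF i] state_fun_rv[where f = "\<lambda>y. cmean i (coord i y)"]
  have "AE \<omega> in M. cond_variance M (state_algebra M X t) (\<lambda>\<omega>. real (X i (t + 1) \<omega>)) \<omega>
      = real_cond_exp M (state_algebra M X t) (\<lambda>\<omega>. (real (X i (t + 1) \<omega>) - ?c \<omega>)\<^sup>2) \<omega>"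
    unfolding cond_variance_def
  proof (rule F.real_cond_exp_cong)
    show "AE \<omega> in M. (real (X i (t + 1) \<omega>) - ?R \<omega>)\<^sup>2 = (real (X i (t + 1) \<omega>) - ?c \<omega>)\<^sup>2"
      using cond_mean[OF i] by eventually_elim (simp add: coord_state[OF i])
  qed measurable
  moreover have "AE \<omega> in M. real_cond_exp M (state_algebra M X t) (\<lambda>\<omega>. (real (X i (t + 1) \<omega>) - ?c \<omega>)\<^sup>2) \<omega> = cvar i (coord i (state t \<omega>))"
  proof (rule real_cond_exp_state)
    fix y
    let ?P = "prob {\<omega> \<in> space M. state t \<omega> = y}" and ?cy = "cmean i (coord i y)"
    have "has_bochner_integral M (\<lambda>\<omega>. indicator {y} (state t \<omega>) * (real (X i (t + 1) \<omega>))\<^sup>2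
        - 2 * ?cy * (indicator {y} (state t \<omega>) * real (X i (t + 1) \<omega>)) + ?cy\<^sup>2 * indicator {y} (state t \<omega>))
        ((cvar i (coord i y) + ?cy\<^sup>2) * ?P - 2 * ?cy * (?cy * ?P) + ?cy\<^sup>2 * ?P)"
      by (intro has_bochner_integral_add has_bochner_integral_diff has_bochner_integral_mult_right
          atom_mean[OF i] atom_second_moment[OF i] atom_indicator_integral)
    moreover have "indicator {y} (state t \<omega>) * (real (X i (t + 1) \<omega>))\<^sup>2
        - 2 * ?cy * (indicator {y} (state t \<omega>) * real (X i (t + 1) \<omega>)) + ?cy\<^sup>2 * indicator {y} (state t \<omega>)
        = indicator {y} (state t \<omega>) * (real (X i (t + 1) \<omega>) - ?c \<omega>)\<^sup>2" for \<omega>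
      by (simp add: power2_diff split: split_indicator)
    moreover have "(cvar i (coord i y) + ?cy\<^sup>2) * ?P - 2 * ?cy * (?cy * ?P) + ?cy\<^sup>2 * ?P = cvar i (coord i y) * ?P"
      by (simp add: algebra_simps power2_eq_square)
    ultimately show "has_bochner_integral M (\<lambda>\<omega>. indicator {y} (state t \<omega>) * (real (X i (t + 1) \<omega>) - ?c \<omega>)\<^sup>2)
        (cvar i (coord i y) * ?P)" by (simp only:)
  qed measurable
  ultimately show ?thesis by eventually_elim (simp add: coord_state[OF i])
qed

lemma cond_covariance:
  shows "AE \<omega> in M. cond_covariance M (state_algebra M X t)
    (\<lambda>\<omega>. real (X 1 (t + 1) \<omega>)) (\<lambda>\<omega>. real (X 2 (t + 1) \<omega>)) \<omega> = \<phi>"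
proof -
  interpret F: sigma_finite_subalgebra M "state_algebra M X t" by (rule state_subalgebra)
  have i: "1 \<in> {1, 2 :: nat}" "2 \<in> {1, 2 :: nat}" by auto
  let ?x = "\<lambda>i \<omega>. real (X i (t + 1) \<omega>)" and ?c = "\<lambda>i \<omega>. cmean i (coord i (state t \<omega>))"
  let ?R = "\<lambda>i. real_cond_exp M (state_algebra M X t) (?x i)"
  note [measurable] = X_fun_rv[OF i(1)] X_fun_rv[OF i(2)]
    state_fun_rv[where f = "\<lambda>y. cmean 1 (coord 1 y)"] state_fun_rv[where f = "\<lambda>y. cmean 2 (coord 2 y)"]
  have "AE \<omega> in M. cond_covariance M (state_algebra M X t) (?x 1) (?x 2) \<omega>
      = real_cond_exp M (state_algebra M X t) (\<lambda>\<omega>. (?x 1 \<omega> - ?c 1 \<omega>) * (?x 2 \<omega> - ?c 2 \<omega>)) \<omega>"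
    unfolding cond_covariance_def
  proof (rule F.real_cond_exp_cong)
    show "AE \<omega> in M. (?x 1 \<omega> - ?R 1 \<omega>) * (?x 2 \<omega> - ?R 2 \<omega>) = (?x 1 \<omega> - ?c 1 \<omega>) * (?x 2 \<omega> - ?c 2 \<omega>)"
      using cond_mean[OF i(1)] cond_mean[OF i(2)]
      by eventually_elim (simp add: coord_state[OF i(1)] coord_state[OF i(2)] del: One_nat_def)
  qed measurable
  moreover have "AE \<omega> in M. real_cond_exp M (state_algebra M X t) (\<lambda>\<omega>. (?x 1 \<omega> - ?c 1 \<omega>) * (?x 2 \<omega> - ?c 2 \<omega>)) \<omega> = \<phi>"
  proof (rule real_cond_exp_state[where g = "\<lambda>_. \<phi>"])
    fix y
    let ?P = "prob {\<omega> \<in> space M. state t \<omega> = y}" and ?cy = "\<lambda>i. cmean i (coord i y)"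
    let ?I = "\<lambda>\<omega>. indicator {y} (state t \<omega>) :: real"
    have "has_bochner_integral M (\<lambda>\<omega>. ?I \<omega> * (?x 1 \<omega> * ?x 2 \<omega>)
        - ?cy 2 * (?I \<omega> * ?x 1 \<omega>) - ?cy 1 * (?I \<omega> * ?x 2 \<omega>) + ?cy 1 * ?cy 2 * ?I \<omega>)
        ((?cy 1 * ?cy 2 + \<phi>) * ?P - ?cy 2 * (?cy 1 * ?P) - ?cy 1 * (?cy 2 * ?P) + ?cy 1 * ?cy 2 * ?P)"
      by (intro has_bochner_integral_add has_bochner_integral_diff has_bochner_integral_mult_right
          atom_mean[OF i(1)] atom_mean[OF i(2)] atom_cross_moment atom_indicator_integral)
    moreover have "?I \<omega> * (?x 1 \<omega> * ?x 2 \<omega>)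
        - ?cy 2 * (?I \<omega> * ?x 1 \<omega>) - ?cy 1 * (?I \<omega> * ?x 2 \<omega>) + ?cy 1 * ?cy 2 * ?I \<omega>
        = ?I \<omega> * ((?x 1 \<omega> - ?c 1 \<omega>) * (?x 2 \<omega> - ?c 2 \<omega>))" for \<omega>
      by (simp add: algebra_simps del: One_nat_def split: split_indicator)
    moreover have "(?cy 1 * ?cy 2 + \<phi>) * ?P - ?cy 2 * (?cy 1 * ?P) - ?cy 1 * (?cy 2 * ?P) + ?cy 1 * ?cy 2 * ?P = \<phi> * ?P"
      by (simp add: algebra_simps del: One_nat_def)
    ultimately show "has_bochner_integral M (\<lambda>\<omega>. ?I \<omega> * ((?x 1 \<omega> - ?c 1 \<omega>) * (?x 2 \<omega> - ?c 2 \<omega>))) (\<phi> * ?P)"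
      by (simp only:)
  qed measurable
  ultimately show ?thesis by eventually_elim (simp del: One_nat_def)
qed

end

end

subsection \<open>Stationary moments\<close>

locale stationary_brcmnbinar = brcmnbinar +
  assumes stationary: "strictly_stationary M (count_space UNIV) (\<lambda>t \<omega>. (X 1 t \<omega>, X 2 t \<omega>))"
begin

text \<open>The finite-dimensional identity is taken for the index set \<open>{t}\<close> and
  projected to its only coordinate.\<close>

lemma state_distr_shift:
  assumes t: "1 \<le> t"
  shows "distr M (count_space UNIV) (state (t + h)) = distr M (count_space UNIV) (state t)"
proof -
  let ?P = "\<Pi>\<^sub>M s\<in>{t}. count_space (UNIV :: (nat \<times> nat) set)"
  have proj: "(\<lambda>f. f t) \<in> measurable ?P (count_space UNIV)"
    by (rule measurable_component_singleton) simp
  have traj: "(\<lambda>\<omega>. \<lambda>s\<in>{t}. state (s + h) \<omega>) \<in> measurable M ?P" for h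
    by (intro measurable_restrict state_rv)
  have "distr M ?P (\<lambda>\<omega>. \<lambda>s\<in>{t}. state (s + h) \<omega>) = distr M ?P (\<lambda>\<omega>. \<lambda>s\<in>{t}. state (s + 0) \<omega>)"
    using stationary[unfolded strictly_stationary_def, rule_format, of "{t}" h] t
    by (simp add: state_def[abs_def])
  hence "distr (distr M ?P (\<lambda>\<omega>. \<lambda>s\<in>{t}. state (s + h) \<omega>)) (count_space UNIV) (\<lambda>f. f t)
      = distr (distr M ?P (\<lambda>\<omega>. \<lambda>s\<in>{t}. state (s + 0) \<omega>)) (count_space UNIV) (\<lambda>f. f t)" by simp
  thus ?thesis unfolding distr_distr[OF proj traj] by (simp add: comp_def)
qed

lemma state_fun_distr:
  fixes f :: "nat \<times> nat \<Rightarrow> real"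
  assumes "1 \<le> t"
  shows "distr M borel (\<lambda>\<omega>. f (state (t + h) \<omega>)) = distr M borel (\<lambda>\<omega>. f (state t \<omega>))"
proof -
  have "distr (distr M (count_space UNIV) (state t')) borel f = distr M borel (\<lambda>\<omega>. f (state t' \<omega>))" for t'
    by (subst distr_distr) (auto simp: comp_def)
  thus ?thesis using state_distr_shift[OF assms, of h] by metis
qed

lemma state_fun_stationary:
  fixes f :: "nat \<times> nat \<Rightarrow> real"
  assumes "1 \<le> t"
  shows "integrable M (\<lambda>\<omega>. f (state (t + h) \<omega>)) \<longleftrightarrow> integrable M (\<lambda>\<omega>. f (state t \<omega>))"
    and "expectation (\<lambda>\<omega>. f (state (t + h) \<omega>)) = expectation (\<lambda>\<omega>. f (state t \<omega>))"
proof -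
  have "integrable (distr M borel (\<lambda>\<omega>. f (state t' \<omega>))) (\<lambda>x. x) \<longleftrightarrow> integrable M (\<lambda>\<omega>. f (state t' \<omega>))"
    "integral\<^sup>L (distr M borel (\<lambda>\<omega>. f (state t' \<omega>))) (\<lambda>x. x) = expectation (\<lambda>\<omega>. f (state t' \<omega>))" for t'
    by (subst integrable_distr_eq integral_distr; simp)+
  thus "integrable M (\<lambda>\<omega>. f (state (t + h) \<omega>)) \<longleftrightarrow> integrable M (\<lambda>\<omega>. f (state t \<omega>))"
    "expectation (\<lambda>\<omega>. f (state (t + h) \<omega>)) = expectation (\<lambda>\<omega>. f (state t \<omega>))"
    using state_fun_distr[OF assms, of f h] by metis+
qed

text \<open>\<open>foster_lyapunov\<close> makes only the difference \<open>V - Q\<close>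
  integrable. The bound \<open>lower\<close> recovers \<open>V\<close> itself: in the applications
  \<open>Q\<close> is \<open>(1 - c) * V + W\<close>, with a contraction factor \<open>1 - c\<close>
  below 1 and a remainder \<open>W\<close> known to be integrable.\<close>

lemma drift_integrable:
  fixes V Q W :: "nat \<times> nat \<Rightarrow> real"
  assumes t: "1 \<le> t"
    and nonneg: "\<And>p. 0 \<le> V p" "\<And>p. 0 \<le> Q p" "\<And>p. 0 \<le> W p"
    and step: "\<And>\<psi> :: nat \<times> nat \<Rightarrow> ennreal. (\<integral>\<^sup>+\<omega>. \<psi> (state t \<omega>) * ennreal (V (state (t + 1) \<omega>)) \<partial>M)
        = (\<integral>\<^sup>+\<omega>. \<psi> (state t \<omega>) * ennreal (Q (state t \<omega>)) \<partial>M)"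
    and W: "integrable M (\<lambda>\<omega>. W (state t \<omega>))"
    and c: "0 < c" and lower: "\<And>p. c * V p \<le> V p - Q p + W p"
  shows "integrable M (\<lambda>\<omega>. V (state t \<omega>))"
proof -
  have "integrable M (\<lambda>\<omega>. V (state t \<omega>) - Q (state t \<omega>))"
  proof (rule foster_lyapunov[OF _ _ _ W])
    \<comment> \<open>The arbitrary weight is specialised to the indicator of a sublevel set of
      \<open>Q\<close>, which keeps the right side finite.\<close>
    show "(\<integral>\<^sup>+\<omega>. indicator {..b} (Q (state t \<omega>)) * ennreal (V (state (t + 1) \<omega>)) \<partial>M)
        = (\<integral>\<^sup>+\<omega>. indicator {..b} (Q (state t \<omega>)) * ennreal (Q (state t \<omega>)) \<partial>M)" for b
      by (rule step[of "\<lambda>p. indicator {..b} (Q p)"])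
    show "- W (state t \<omega>) \<le> V (state t \<omega>) - Q (state t \<omega>)" for \<omega>
      using lower[of "state t \<omega>"] nonneg(1)[of "state t \<omega>"] c
      by (smt (verit) mult_nonneg_nonneg)
    show "distr M borel (\<lambda>\<omega>. V (state (t + 1) \<omega>)) = distr M borel (\<lambda>\<omega>. V (state t \<omega>))"
      by (rule state_fun_distr[OF t])
  qed (use nonneg in auto)
  from Bochner_Integration.integrable_add[OF this W]
  have "integrable M (\<lambda>\<omega>. V (state t \<omega>) - Q (state t \<omega>) + W (state t \<omega>))" .
  hence "integrable M (\<lambda>\<omega>. c * V (state t \<omega>))"
  proof (rule Bochner_Integration.integrable_bound)
    show "AE \<omega> in M. norm (c * V (state t \<omega>)) \<le> norm (V (state t \<omega>) - Q (state t \<omega>) + W (state t \<omega>))"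
    proof (intro always_eventually allI)
      fix \<omega>
      have "0 \<le> c * V (state t \<omega>)" using nonneg c by simp
      thus "norm (c * V (state t \<omega>)) \<le> norm (V (state t \<omega>) - Q (state t \<omega>) + W (state t \<omega>))"
        using lower[of "state t \<omega>"] by simp
    qed
  qed simp
  thus ?thesis using c by simp
qed

text \<open>Affine recursion in the later time with the weight held at \<open>s\<close>. The weight
  1 yields the stationary mean, and a component of the state at \<open>s\<close> yields the lagged
  products. Integrability is carried along for the induction on the lag.\<close>

lemma step_expectation:
  assumes i: "i \<in> {1, 2}" and s: "s < t" and Y: "\<And>p. 0 \<le> Y p"
    and int: "integrable M (\<lambda>\<omega>. Y (state s \<omega>) * real (X i (t - 1) \<omega>))" "integrable M (\<lambda>\<omega>. Y (state s \<omega>))"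
  shows "integrable M (\<lambda>\<omega>. Y (state s \<omega>) * real (X i t \<omega>))"
    and "expectation (\<lambda>\<omega>. Y (state s \<omega>) * real (X i t \<omega>))
       = coef_mean (m i) l * expectation (\<lambda>\<omega>. Y (state s \<omega>) * real (X i (t - 1) \<omega>))
         + (coef_mean (m i) l + \<mu> i) * expectation (\<lambda>\<omega>. Y (state s \<omega>))"
proof -
  note [measurable] = X_fun_rv[OF i]
  have eq: "Y p * cmean i x = coef_mean (m i) l * (Y p * real x) + (coef_mean (m i) l + \<mu> i) * Y p" for p x
    by (simp add: cmean_def algebra_simps)
  have intc: "integrable M (\<lambda>\<omega>. Y (state s \<omega>) * cmean i (X i (t - 1) \<omega>))"
    unfolding eq using int by (intro Bochner_Integration.integrable_add integrable_mult_right)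
  have "(\<integral>\<^sup>+\<omega>. ennreal (Y (state s \<omega>) * real (X i t \<omega>)) \<partial>M) = (\<integral>\<^sup>+\<omega>. ennreal (Y (state s \<omega>) * cmean i (X i (t - 1) \<omega>)) \<partial>M)"
    using step_mean[of t s i "\<lambda>p. ennreal (Y p)"] i s Y cmean_nonneg[OF i] by (simp add: ennreal_mult)
  also have "\<dots> = ennreal (expectation (\<lambda>\<omega>. Y (state s \<omega>) * cmean i (X i (t - 1) \<omega>)))"
    using Y cmean_nonneg[OF i] by (intro nn_integral_eq_integral intc) auto
  finally have "has_bochner_integral M (\<lambda>\<omega>. Y (state s \<omega>) * real (X i t \<omega>)) (expectation (\<lambda>\<omega>. Y (state s \<omega>) * cmean i (X i (t - 1) \<omega>)))"
    using Y cmean_nonneg[OF i] by (intro has_bochner_integral_nn_integral) auto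
  moreover have "expectation (\<lambda>\<omega>. Y (state s \<omega>) * cmean i (X i (t - 1) \<omega>))
      = coef_mean (m i) l * expectation (\<lambda>\<omega>. Y (state s \<omega>) * real (X i (t - 1) \<omega>))
         + (coef_mean (m i) l + \<mu> i) * expectation (\<lambda>\<omega>. Y (state s \<omega>))"
    unfolding eq using int by simp
  ultimately show "integrable M (\<lambda>\<omega>. Y (state s \<omega>) * real (X i t \<omega>))"
    "expectation (\<lambda>\<omega>. Y (state s \<omega>) * real (X i t \<omega>))
       = coef_mean (m i) l * expectation (\<lambda>\<omega>. Y (state s \<omega>) * real (X i (t - 1) \<omega>))
         + (coef_mean (m i) l + \<mu> i) * expectation (\<lambda>\<omega>. Y (state s \<omega>))"
    by (auto simp: has_bochner_integral_iff)
qed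

text \<open>The drift is affine with slope \<open>coef_mean (m i) l < 1\<close>, and its remainder
  is constant.\<close>

lemma X_integrable:
  assumes i: "i \<in> {1, 2}" and t: "1 \<le> t"
  shows "integrable M (\<lambda>\<omega>. real (X i t \<omega>))"
proof -
  let ?a = "coef_mean (m i) l"
  have "integrable M (\<lambda>\<omega>. real (coord i (state t \<omega>)))"
  proof (rule drift_integrable[OF t, where Q = "\<lambda>p. cmean i (coord i p)" and W = "\<lambda>_. ?a + \<mu> i" and c = "1 - ?a"])
    show "(\<integral>\<^sup>+\<omega>. \<psi> (state t \<omega>) * ennreal (real (coord i (state (t + 1) \<omega>))) \<partial>M)
        = (\<integral>\<^sup>+\<omega>. \<psi> (state t \<omega>) * ennreal (cmean i (coord i (state t \<omega>))) \<partial>M)" for \<psi> :: "nat \<times> nat \<Rightarrow> ennreal"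
      using step_mean[of "t + 1" t i \<psi>] i by (simp add: coord_state)
    show "(1 - ?a) * real (coord i p) \<le> real (coord i p) - cmean i (coord i p) + (?a + \<mu> i)" for p
      by (simp add: cmean_def algebra_simps)
  qed (use coef_mean_bounds[OF i] \<mu>_nonneg[OF i] cmean_nonneg[OF i] in auto)
  thus ?thesis by (simp add: coord_state[OF i])
qed

text \<open>Equal means at two consecutive times give the fixed-point equation. It is kept beside
  the closed form because the later eliminations use it.\<close>

lemma X_mean:
  assumes i: "i \<in> {1, 2}" and t: "1 \<le> t"
  shows "expectation (\<lambda>\<omega>. real (X i t \<omega>)) = coef_mean (m i) l * (expectation (\<lambda>\<omega>. real (X i t \<omega>)) + 1) + \<mu> i"
    and "expectation (\<lambda>\<omega>. real (X i t \<omega>)) = (m i + l * \<mu> i) / (l - m i)"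
proof -
  let ?E = "expectation (\<lambda>\<omega>. real (X i t \<omega>))"
  have "expectation (\<lambda>\<omega>. real (X i (t + 1) \<omega>)) = coef_mean (m i) l * ?E + (coef_mean (m i) l + \<mu> i)"
    using step_expectation(2)[OF i, of t "t + 1" "\<lambda>_. 1"] X_integrable[OF i t] by (simp add: prob_space)
  moreover have "expectation (\<lambda>\<omega>. real (X i (t + 1) \<omega>)) = ?E"
    using state_fun_stationary(2)[OF t, of "\<lambda>p. real (coord i p)" 1] by (simp only: coord_state[OF i])
  ultimately show *: "?E = coef_mean (m i) l * (?E + 1) + \<mu> i" by (simp add: algebra_simps)
  have "?E * (l - m i) = m i + l * \<mu> i"
    using * l_gt_1 unfolding coef_mean_def by (simp add: field_simps)
  thus "?E = (m i + l * \<mu> i) / (l - m i)" using m_bounds[OF i] by (simp add: field_simps)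
qed

lemma X_mean_stationary:
  assumes i: "i \<in> {1, 2}" and t: "1 \<le> t"
  shows "expectation (\<lambda>\<omega>. real (X i (t + k) \<omega>)) = expectation (\<lambda>\<omega>. real (X i t \<omega>))"
  using X_mean(2)[OF i] t by simp

text \<open>Together with \<open>coef_sq_mean i\<close> and \<open>sq_drift_const i\<close>, the
  coefficients of the conditional second moment \<open>cvar i x + (cmean i x)^2\<close> as a
  quadratic polynomial in \<open>x\<close>.\<close>

definition sq_drift_slope :: "nat \<Rightarrow> real" where
  "sq_drift_slope i = 2 * coef_sq_mean i + coef_sq_mean i + coef_mean (m i) l + 2 * coef_mean (m i) l * \<mu> i"

definition sq_drift_const :: "nat \<Rightarrow> real" where
  "sq_drift_const i = 2 * coef_sq_mean i + coef_mean (m i) l + 2 * coef_mean (m i) l * \<mu> i + (\<mu> i)\<^sup>2 + (\<sigma>Z i)\<^sup>2"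

lemma second_moment_drift:
  "cvar i x + (cmean i x)\<^sup>2 = coef_sq_mean i * (real x)\<^sup>2 + sq_drift_slope i * real x + sq_drift_const i"
  by (simp add: sq_drift_slope_def sq_drift_const_def cvar_def cmean_def coef_sq_mean_def power2_eq_square algebra_simps)

lemma sq_drift_pos:
  assumes i: "i \<in> {1, 2}"
  shows "0 < sq_drift_slope i" "0 < sq_drift_const i"
  using coef_sq_mean_pos[OF i] coef_mean_bounds[OF i] \<mu>_nonneg[OF i]
  by (auto simp: sq_drift_slope_def sq_drift_const_def intro!: add_pos_nonneg)

text \<open>Here the contraction factor is the leading coefficient \<open>coef_sq_mean i\<close>,
  and the remainder is affine in the state, hence integrable by the first-moment result.\<close>

lemma X_square_integrable:
  assumes i: "i \<in> {1, 2}" and t: "1 \<le> t" and m2: "coef_sq_mean i < 1"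
  shows "integrable M (\<lambda>\<omega>. (real (X i t \<omega>))\<^sup>2)"
proof -
  have "integrable M (\<lambda>\<omega>. (real (coord i (state t \<omega>)))\<^sup>2)"
  proof (rule drift_integrable[OF t, where Q = "\<lambda>p. cvar i (coord i p) + (cmean i (coord i p))\<^sup>2"
        and W = "\<lambda>p. sq_drift_slope i * real (coord i p) + sq_drift_const i" and c = "1 - coef_sq_mean i"])
    show "(\<integral>\<^sup>+\<omega>. \<psi> (state t \<omega>) * ennreal ((real (coord i (state (t + 1) \<omega>)))\<^sup>2) \<partial>M)
        = (\<integral>\<^sup>+\<omega>. \<psi> (state t \<omega>) * ennreal (cvar i (coord i (state t \<omega>)) + (cmean i (coord i (state t \<omega>)))\<^sup>2) \<partial>M)"
      for \<psi> :: "nat \<times> nat \<Rightarrow> ennreal"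
      using step_second_moment[of "t + 1" t i \<psi>] i by (simp add: coord_state)
    show "(1 - coef_sq_mean i) * (real (coord i p))\<^sup>2 \<le> (real (coord i p))\<^sup>2 - (cvar i (coord i p) + (cmean i (coord i p))\<^sup>2)
        + (sq_drift_slope i * real (coord i p) + sq_drift_const i)" for p
      by (simp add: second_moment_drift algebra_simps)
    show "integrable M (\<lambda>\<omega>. sq_drift_slope i * real (coord i (state t \<omega>)) + sq_drift_const i)"
      using X_integrable[OF i t] by (simp add: coord_state[OF i])
  qed (use m2 sq_drift_pos[OF i] cvar_nonneg[OF i] in auto)
  thus ?thesis by (simp add: coord_state[OF i])
qed

lemma X_second_moment:
  assumes i: "i \<in> {1, 2}" and t: "1 \<le> t" and int: "integrable M (\<lambda>\<omega>. (real (X i t \<omega>))\<^sup>2)"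
  shows "expectation (\<lambda>\<omega>. (real (X i t \<omega>))\<^sup>2) = coef_sq_mean i * expectation (\<lambda>\<omega>. (real (X i t \<omega>))\<^sup>2)
      + sq_drift_slope i * expectation (\<lambda>\<omega>. real (X i t \<omega>)) + sq_drift_const i"
    and "coef_sq_mean i < 1"
proof -
  let ?S = "expectation (\<lambda>\<omega>. (real (X i t \<omega>))\<^sup>2)" and ?E = "expectation (\<lambda>\<omega>. real (X i t \<omega>))"
  note intX = X_integrable[OF i t]
  note [measurable] = X_fun_rv[OF i]
  have intq: "integrable M (\<lambda>\<omega>. cvar i (X i t \<omega>) + (cmean i (X i t \<omega>))\<^sup>2)"
    unfolding second_moment_drift using int intX by simp
  have nn: "0 \<le> cvar i x + (cmean i x)\<^sup>2" for x using cvar_nonneg[OF i] by simp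
  have "(\<integral>\<^sup>+\<omega>. ennreal ((real (X i (t + 1) \<omega>))\<^sup>2) \<partial>M) = (\<integral>\<^sup>+\<omega>. ennreal (cvar i (X i t \<omega>) + (cmean i (X i t \<omega>))\<^sup>2) \<partial>M)"
    using step_second_moment[of "t + 1" t i "\<lambda>_. 1"] i by simp
  also have "\<dots> = ennreal (expectation (\<lambda>\<omega>. cvar i (X i t \<omega>) + (cmean i (X i t \<omega>))\<^sup>2))"
    using nn by (intro nn_integral_eq_integral intq) auto
  finally have "expectation (\<lambda>\<omega>. (real (X i (t + 1) \<omega>))\<^sup>2) = expectation (\<lambda>\<omega>. cvar i (X i t \<omega>) + (cmean i (X i t \<omega>))\<^sup>2)"
    using nn by (intro expectation_eqI Bochner_Integration.integral_nonneg borel_measurable_power X_fun_rv[OF i]) auto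
  moreover have "expectation (\<lambda>\<omega>. (real (X i (t + 1) \<omega>))\<^sup>2) = ?S"
    using state_fun_stationary(2)[OF t, of "\<lambda>p. (real (coord i p))\<^sup>2" 1] by (simp only: coord_state[OF i])
  moreover have "expectation (\<lambda>\<omega>. cvar i (X i t \<omega>) + (cmean i (X i t \<omega>))\<^sup>2) = coef_sq_mean i * ?S + sq_drift_slope i * ?E + sq_drift_const i"
    unfolding second_moment_drift using int intX by (simp add: prob_space)
  ultimately show eq: "?S = coef_sq_mean i * ?S + sq_drift_slope i * ?E + sq_drift_const i" by simp
  \<comment> \<open>The equation says that \<open>(1 - coef_sq_mean i) * ?S\<close> equals a
    positive number, so a finite nonnegative second moment forces \<open>coef_sq_mean i < 1\<close>.
    The denominator of the variance is thereby positive.\<close>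
  have "0 \<le> ?S" "0 \<le> ?E" by (auto intro!: Bochner_Integration.integral_nonneg)
  hence "0 < (1 - coef_sq_mean i) * ?S"
    using eq sq_drift_pos[OF i] mult_nonneg_nonneg[of "sq_drift_slope i" ?E] unfolding left_diff_distrib by linarith
  thus "coef_sq_mean i < 1" using \<open>0 \<le> ?S\<close> by (simp add: zero_less_mult_iff)
qed

text \<open>Elimination from the linear equations for the first and second moments. The factor
  \<open>l * (\<mu> i + 1) / (l - m i)\<close> is the stationary mean of \<open>X i t + 1\<close>,
  the expected number of counting variables. Strict positivity is needed for dividing in the
  correlation.\<close>

lemma X_variance:
  assumes i: "i \<in> {1, 2}" and t: "1 \<le> t" and int: "integrable M (\<lambda>\<omega>. (real (X i t \<omega>))\<^sup>2)"
  shows "variance (\<lambda>\<omega>. real (X i t \<omega>))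
          = ((coef_var (m i) l + (coef_mean (m i) l)\<^sup>2 + coef_mean (m i) l)
                * (l * (\<mu> i + 1) / (l - m i))
              + m i * (m i + l) * (\<mu> i + 1)\<^sup>2 / ((l - 1) * (l - m i)\<^sup>2)
              + (\<sigma>Z i)\<^sup>2)
            / (1 - (coef_mean (m i) l)\<^sup>2 - coef_var (m i) l)" (is "?V = ?N / ?D")
    and "0 < variance (\<lambda>\<omega>. real (X i t \<omega>))"
proof -
  let ?S = "expectation (\<lambda>\<omega>. (real (X i t \<omega>))\<^sup>2)" and ?E = "expectation (\<lambda>\<omega>. real (X i t \<omega>))"
  let ?a = "coef_mean (m i) l" and ?v = "coef_var (m i) l"
  have ml: "0 < m i" "m i < l" "1 < l" using m_bounds[OF i] l_gt_1 by auto
  have V: "?V = ?S - ?E\<^sup>2" by (rule variance_eq[OF X_integrable[OF i t] int])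
  have n: "?E + 1 = l * (\<mu> i + 1) / (l - m i)"
    using X_mean(2)[OF i t] ml by (simp add: field_simps)
  have vn: "?v * (?E + 1)\<^sup>2 = m i * (m i + l) * (\<mu> i + 1)\<^sup>2 / ((l - 1) * (l - m i)\<^sup>2)"
    unfolding n coef_var_def using ml by (simp add: power_divide power_mult_distrib)
  have S: "?S = coef_sq_mean i * ?S + sq_drift_slope i * ?E + sq_drift_const i" by (rule X_second_moment(1)[OF i t int])
  have E: "?E = ?a * (?E + 1) + \<mu> i" by (rule X_mean(1)[OF i t])
  have "?E\<^sup>2 = (?a * (?E + 1) + \<mu> i)\<^sup>2" using E by simp
  hence "(?S - ?E\<^sup>2) * ?D = (?v + ?a\<^sup>2 + ?a) * (?E + 1) + ?v * (?E + 1)\<^sup>2 + (\<sigma>Z i)\<^sup>2"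
    using S unfolding sq_drift_slope_def sq_drift_const_def coef_sq_mean_def by algebra
  hence VD: "?V * ?D = ?N" unfolding V vn unfolding n .
  have D: "0 < ?D" using X_second_moment(2)[OF i t int] by (simp add: coef_sq_mean_def)
  thus eq: "?V = ?N / ?D" using VD by (simp add: field_simps)
  have "0 < (?v + ?a\<^sup>2 + ?a) * (l * (\<mu> i + 1) / (l - m i))"
    using ml \<mu>_nonneg[OF i] coef_mean_bounds[OF i] coef_var_pos[OF i]
    by (intro mult_pos_pos divide_pos_pos add_pos_pos[of _ ?a] add_pos_nonneg[of ?v] add_nonneg_pos[of "\<mu> i"]) auto
  moreover have "0 \<le> m i * (m i + l) * (\<mu> i + 1)\<^sup>2 / ((l - 1) * (l - m i)\<^sup>2)" using ml by simp
  ultimately have "0 < ?N" by (intro add_pos_nonneg) auto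
  thus "0 < ?V" unfolding eq using D by (rule divide_pos_pos)
qed

text \<open>One more step multiplies the covariance by the coefficient mean. The case
  \<open>i = j\<close> gives autocovariances, the case of different indices gives cross-covariances.
  Integrability belongs to the induction claim because each step presupposes it.\<close>

lemma lagged_product:
  assumes i: "i \<in> {1, 2}" and j: "j \<in> {1, 2}" and t: "1 \<le> t"
    and int: "integrable M (\<lambda>\<omega>. real (X i t \<omega>) * real (X j t \<omega>))"
  shows "integrable M (\<lambda>\<omega>. real (X i (t + k) \<omega>) * real (X j t \<omega>)) \<and>
    covariance M (\<lambda>\<omega>. real (X i (t + k) \<omega>)) (\<lambda>\<omega>. real (X j t \<omega>))
      = coef_mean (m i) l ^ k * covariance M (\<lambda>\<omega>. real (X i t \<omega>)) (\<lambda>\<omega>. real (X j t \<omega>))"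
proof (induction k)
  case 0
  thus ?case using int by simp
next
  case (Suc k)
  let ?a = "coef_mean (m i) l"
  let ?Y = "\<lambda>p. real (coord j p)"
  let ?E = "\<lambda>i. expectation (\<lambda>\<omega>. real (X i t \<omega>))"
  have ints: "integrable M (\<lambda>\<omega>. real (X i (t + k) \<omega>))" "integrable M (\<lambda>\<omega>. real (X i (t + Suc k) \<omega>))" "integrable M (\<lambda>\<omega>. real (X j t \<omega>))"
    using i j t by (auto intro: X_integrable)
  have means: "expectation (\<lambda>\<omega>. real (X i (t + k) \<omega>)) = ?E i" "expectation (\<lambda>\<omega>. real (X i (t + Suc k) \<omega>)) = ?E i"
    by (rule X_mean_stationary[OF i t])+
  have pre: "integrable M (\<lambda>\<omega>. ?Y (state t \<omega>) * real (X i (t + Suc k - 1) \<omega>))" "integrable M (\<lambda>\<omega>. ?Y (state t \<omega>))"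
    using Suc.IH ints(3) by (simp_all add: coord_state[OF j] mult.commute[of "real (X j _ _)"])
  have "integrable M (\<lambda>\<omega>. ?Y (state t \<omega>) * real (X i (t + Suc k) \<omega>))"
    "expectation (\<lambda>\<omega>. ?Y (state t \<omega>) * real (X i (t + Suc k) \<omega>))
      = ?a * expectation (\<lambda>\<omega>. ?Y (state t \<omega>) * real (X i (t + Suc k - 1) \<omega>)) + (?a + \<mu> i) * expectation (\<lambda>\<omega>. ?Y (state t \<omega>))"
    by (rule step_expectation[OF i _ _ pre]; simp)+
  hence st: "integrable M (\<lambda>\<omega>. real (X i (t + Suc k) \<omega>) * real (X j t \<omega>))"
    "expectation (\<lambda>\<omega>. real (X i (t + Suc k) \<omega>) * real (X j t \<omega>))
      = ?a * expectation (\<lambda>\<omega>. real (X i (t + k) \<omega>) * real (X j t \<omega>)) + (?a + \<mu> i) * ?E j"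
    by (simp_all add: coord_state[OF j] mult.commute[of "real (X j _ _)"])
  have "covariance M (\<lambda>\<omega>. real (X i (t + Suc k) \<omega>)) (\<lambda>\<omega>. real (X j t \<omega>))
      = ?a * expectation (\<lambda>\<omega>. real (X i (t + k) \<omega>) * real (X j t \<omega>)) + (?a + \<mu> i) * ?E j - ?E i * ?E j"
    unfolding covariance_eq[OF ints(2,3) st(1)] st(2) means ..
  \<comment> \<open>Substituting the fixed-point equation for the mean of component \<open>i\<close>
    cancels the affine term.\<close>
  also have "\<dots> = ?a * (expectation (\<lambda>\<omega>. real (X i (t + k) \<omega>) * real (X j t \<omega>)) - ?E i * ?E j)"
    using X_mean(1)[OF i t] by algebra
  also have "\<dots> = ?a * covariance M (\<lambda>\<omega>. real (X i (t + k) \<omega>)) (\<lambda>\<omega>. real (X j t \<omega>))"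
    unfolding covariance_eq[OF ints(1,3) conjunct1[OF Suc.IH]] means ..
  finally show ?case using Suc.IH st(1) by simp
qed

text \<open>The contraction factor is the product of the two coefficient means and is always below
  1, so integrability holds even when the individual second moments are infinite.\<close>

lemma cross_product_integrable:
  assumes t: "1 \<le> t"
  shows "integrable M (\<lambda>\<omega>. real (X 1 t \<omega>) * real (X 2 t \<omega>))"
proof -
  have i: "1 \<in> {1, 2 :: nat}" "2 \<in> {1, 2 :: nat}" by auto
  let ?a = "\<lambda>i. coef_mean (m i) l"
  have a: "0 < ?a 1" "?a 1 < 1" "0 < ?a 2" "?a 2 < 1" "0 \<le> \<mu> 1" "0 \<le> \<mu> 2"
    using coef_mean_bounds[OF i(1)] coef_mean_bounds[OF i(2)] \<mu>_nonneg[OF i(1)] \<mu>_nonneg[OF i(2)] by auto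
  have a12: "?a 1 * ?a 2 < 1" using mult_strict_mono[OF a(2) a(4)] a by simp
  have q: "cmean 1 x * cmean 2 y + \<phi> = ?a 1 * ?a 2 * (real x * real y) + (?a 1 * (?a 2 + \<mu> 2) * real x + ?a 2 * (?a 1 + \<mu> 1) * real y
      + ((?a 1 + \<mu> 1) * (?a 2 + \<mu> 2) + \<phi>))" for x y
    unfolding cmean_def by algebra
  \<comment> \<open>The constant of the drift is its value at the state (0, 0), hence nonnegative
    although \<phi> need not be.\<close>
  have k: "0 \<le> (?a 1 + \<mu> 1) * (?a 2 + \<mu> 2) + \<phi>"
    using cmean_cross_nonneg[of 0 0] by (simp add: cmean_def del: One_nat_def)
  have "integrable M (\<lambda>\<omega>. real (coord 1 (state t \<omega>)) * real (coord 2 (state t \<omega>)))"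
  proof (rule drift_integrable[OF t, where V = "\<lambda>p. real (coord 1 p) * real (coord 2 p)"
        and Q = "\<lambda>p. cmean 1 (coord 1 p) * cmean 2 (coord 2 p) + \<phi>"
        and W = "\<lambda>p. ?a 1 * (?a 2 + \<mu> 2) * real (coord 1 p) + ?a 2 * (?a 1 + \<mu> 1) * real (coord 2 p) + ((?a 1 + \<mu> 1) * (?a 2 + \<mu> 2) + \<phi>)"
        and c = "1 - ?a 1 * ?a 2"])
    show "(\<integral>\<^sup>+\<omega>. \<psi> (state t \<omega>) * ennreal (real (coord 1 (state (t + 1) \<omega>)) * real (coord 2 (state (t + 1) \<omega>))) \<partial>M)
        = (\<integral>\<^sup>+\<omega>. \<psi> (state t \<omega>) * ennreal (cmean 1 (coord 1 (state t \<omega>)) * cmean 2 (coord 2 (state t \<omega>)) + \<phi>) \<partial>M)"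
      for \<psi> :: "nat \<times> nat \<Rightarrow> ennreal"
      unfolding coord_state[OF i(1)] coord_state[OF i(2)] using step_cross_moment[of "t + 1" t \<psi>] by simp
    show "(1 - ?a 1 * ?a 2) * (real (coord 1 p) * real (coord 2 p)) \<le> real (coord 1 p) * real (coord 2 p)
        - (cmean 1 (coord 1 p) * cmean 2 (coord 2 p) + \<phi>)
        + (?a 1 * (?a 2 + \<mu> 2) * real (coord 1 p) + ?a 2 * (?a 1 + \<mu> 1) * real (coord 2 p) + ((?a 1 + \<mu> 1) * (?a 2 + \<mu> 2) + \<phi>))" for p
      unfolding q left_diff_distrib by simp
    show "integrable M (\<lambda>\<omega>. ?a 1 * (?a 2 + \<mu> 2) * real (coord 1 (state t \<omega>)) + ?a 2 * (?a 1 + \<mu> 1) * real (coord 2 (state t \<omega>))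
        + ((?a 1 + \<mu> 1) * (?a 2 + \<mu> 2) + \<phi>))"
      unfolding coord_state[OF i(1)] coord_state[OF i(2)] using X_integrable[OF i(1) t] X_integrable[OF i(2) t] by simp
    show "0 \<le> ?a 1 * (?a 2 + \<mu> 2) * real (coord 1 p) + ?a 2 * (?a 1 + \<mu> 1) * real (coord 2 p)
        + ((?a 1 + \<mu> 1) * (?a 2 + \<mu> 2) + \<phi>)" for p
      using a by (intro add_nonneg_nonneg[OF _ k] add_nonneg_nonneg mult_nonneg_nonneg) auto
    show "0 < 1 - ?a 1 * ?a 2" using a12 by simp
  qed (use cmean_cross_nonneg in auto)
  thus ?thesis unfolding coord_state[OF i(1)] coord_state[OF i(2)] .
qed

text \<open>Stationarity of the product moment together with the two mean equations reduces to
  \<open>C = ?a 1 * ?a 2 * C + \<phi>\<close> for the covariance \<open>C\<close>.\<close>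

lemma cross_covariance:
  assumes t: "1 \<le> t"
  shows "covariance M (\<lambda>\<omega>. real (X 1 t \<omega>)) (\<lambda>\<omega>. real (X 2 t \<omega>)) = l\<^sup>2 * \<phi> / (l\<^sup>2 - m 1 * m 2)"
proof -
  have i: "1 \<in> {1, 2 :: nat}" "2 \<in> {1, 2 :: nat}" by auto
  note int = X_integrable[OF i(1) t] X_integrable[OF i(2) t] cross_product_integrable[OF t]
  note [measurable] = X_fun_rv[OF i(1)] X_fun_rv[OF i(2)]
  let ?a = "\<lambda>i. coef_mean (m i) l" and ?E = "\<lambda>i. expectation (\<lambda>\<omega>. real (X i t \<omega>))"
  let ?P = "expectation (\<lambda>\<omega>. real (X 1 t \<omega>) * real (X 2 t \<omega>))"
  have q: "cmean 1 x * cmean 2 y + \<phi> = ?a 1 * ?a 2 * (real x * real y) + (?a 1 * (?a 2 + \<mu> 2) * real x + ?a 2 * (?a 1 + \<mu> 1) * real y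
      + ((?a 1 + \<mu> 1) * (?a 2 + \<mu> 2) + \<phi>))" for x y
    unfolding cmean_def by algebra
  have intq: "integrable M (\<lambda>\<omega>. cmean 1 (X 1 t \<omega>) * cmean 2 (X 2 t \<omega>) + \<phi>)"
    unfolding q using int by simp
  have "(\<integral>\<^sup>+\<omega>. ennreal (real (X 1 (t + 1) \<omega>) * real (X 2 (t + 1) \<omega>)) \<partial>M) = (\<integral>\<^sup>+\<omega>. ennreal (cmean 1 (X 1 t \<omega>) * cmean 2 (X 2 t \<omega>) + \<phi>) \<partial>M)"
    using step_cross_moment[of "t + 1" t "\<lambda>_. 1"] by simp
  also have "\<dots> = ennreal (expectation (\<lambda>\<omega>. cmean 1 (X 1 t \<omega>) * cmean 2 (X 2 t \<omega>) + \<phi>))"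
    using cmean_cross_nonneg by (intro nn_integral_eq_integral intq) auto
  finally have "expectation (\<lambda>\<omega>. real (X 1 (t + 1) \<omega>) * real (X 2 (t + 1) \<omega>)) = expectation (\<lambda>\<omega>. cmean 1 (X 1 t \<omega>) * cmean 2 (X 2 t \<omega>) + \<phi>)"
    by (intro expectation_eqI Bochner_Integration.integral_nonneg borel_measurable_times X_fun_rv i cmean_cross_nonneg) auto
  moreover have "expectation (\<lambda>\<omega>. real (X 1 (t + 1) \<omega>) * real (X 2 (t + 1) \<omega>)) = ?P"
    using state_fun_stationary(2)[OF t, of "\<lambda>p. real (coord 1 p) * real (coord 2 p)" 1]
    by (simp only: coord_state[OF i(1)] coord_state[OF i(2)])
  moreover have "expectation (\<lambda>\<omega>. cmean 1 (X 1 t \<omega>) * cmean 2 (X 2 t \<omega>) + \<phi>)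
      = ?a 1 * ?a 2 * ?P + (?a 1 * (?a 2 + \<mu> 2) * ?E 1 + ?a 2 * (?a 1 + \<mu> 1) * ?E 2 + ((?a 1 + \<mu> 1) * (?a 2 + \<mu> 2) + \<phi>))"
    unfolding q using int by (simp add: prob_space del: One_nat_def)
  ultimately have P: "?P = ?a 1 * ?a 2 * ?P + (?a 1 * (?a 2 + \<mu> 2) * ?E 1 + ?a 2 * (?a 1 + \<mu> 1) * ?E 2 + ((?a 1 + \<mu> 1) * (?a 2 + \<mu> 2) + \<phi>))"
    by simp
  have C: "covariance M (\<lambda>\<omega>. real (X 1 t \<omega>)) (\<lambda>\<omega>. real (X 2 t \<omega>)) = ?P - ?E 1 * ?E 2" (is "?C = _")
    by (rule covariance_eq[OF int])
  have "?C * (1 - ?a 1 * ?a 2) = \<phi>"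
    using P X_mean(1)[OF i(1) t] X_mean(1)[OF i(2) t] unfolding C by algebra
  hence "?C * (l\<^sup>2 - m 1 * m 2) = l\<^sup>2 * \<phi>"
    using l_gt_1 unfolding coef_mean_def by (simp add: field_simps power2_eq_square del: One_nat_def)
  moreover have "m 1 * m 2 < l * l"
    using m_bounds[OF i(1)] m_bounds[OF i(2)] by (intro mult_strict_mono) auto
  ultimately show ?thesis by (simp add: field_simps power2_eq_square del: One_nat_def)
qed

end

text \<open>The denominator \<open>1 - (coef_mean (m i) l)^2 - coef_var (m i) l\<close> can be
  nonpositive for admissible parameters. The second moment is then infinite and the Bochner integral
  would return a default value, so variance, autocovariance and autocorrelation are stated under
  square integrability, with positivity of the denominator as a sufficient criterion. The integer
  power gives \<open>l^(k-2)\<close> its meaning for lags 0 and 1.\<close>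

theorem proposition2p4:
  fixes M :: "'w measure"
    and m \<mu> \<sigma>Z :: "nat \<Rightarrow> real" and l \<phi> :: real and fZ :: "(nat \<times> nat) pmf"
    and \<alpha> :: "nat \<Rightarrow> nat \<Rightarrow> 'w \<Rightarrow> real"
    and G :: "nat \<Rightarrow> nat \<Rightarrow> nat \<Rightarrow> 'w \<Rightarrow> nat"
    and Z X :: "nat \<Rightarrow> nat \<Rightarrow> 'w \<Rightarrow> nat"
    and t k i j :: nat
  assumes process: "brcmnbinar M m \<mu> \<sigma>Z l \<phi> fZ \<alpha> G Z X"
    and stationary:
      "strictly_stationary M (count_space UNIV) (\<lambda>t \<omega>. (X 1 t \<omega>, X 2 t \<omega>))"
    and t: "1 \<le> t"
    and ij: "i \<in> {1, 2}" "j \<in> {1, 2}" "i \<noteq> j"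
  shows
    "\<comment> \<open>(i)\<close>
     (AE \<omega> in M. real_cond_exp M (state_algebra M X t) (\<lambda>\<omega>. real (X i (t + 1) \<omega>)) \<omega>
        = coef_mean (m i) l * (real (X i t \<omega>) + 1) + \<mu> i) \<and>
     (AE \<omega> in M. cond_variance M (state_algebra M X t) (\<lambda>\<omega>. real (X i (t + 1) \<omega>)) \<omega>
        = coef_var (m i) l * (real (X i t \<omega>) + 1)\<^sup>2
          + (coef_var (m i) l + (coef_mean (m i) l)\<^sup>2 + coef_mean (m i) l) * (real (X i t \<omega>) + 1)
          + (\<sigma>Z i)\<^sup>2) \<and>
     (AE \<omega> in M. cond_covariance M (state_algebra M X t)
        (\<lambda>\<omega>. real (X 1 (t + 1) \<omega>)) (\<lambda>\<omega>. real (X 2 (t + 1) \<omega>)) \<omega> = \<phi>) \<and>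
     \<comment> \<open>(ii)\<close>
     prob_space.expectation M (\<lambda>\<omega>. real (X i t \<omega>)) = (m i + l * \<mu> i) / (l - m i) \<and>
     (0 < 1 - (coef_mean (m i) l)\<^sup>2 - coef_var (m i) l \<longrightarrow>
        integrable M (\<lambda>\<omega>. (real (X i t \<omega>))\<^sup>2)) \<and>
     (integrable M (\<lambda>\<omega>. (real (X i t \<omega>))\<^sup>2) \<longrightarrow>
        prob_space.variance M (\<lambda>\<omega>. real (X i t \<omega>))
          = ((coef_var (m i) l + (coef_mean (m i) l)\<^sup>2 + coef_mean (m i) l)
                * (l * (\<mu> i + 1) / (l - m i))
              + m i * (m i + l) * (\<mu> i + 1)\<^sup>2 / ((l - 1) * (l - m i)\<^sup>2)
              + (\<sigma>Z i)\<^sup>2)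
            / (1 - (coef_mean (m i) l)\<^sup>2 - coef_var (m i) l) \<and>
        covariance M (\<lambda>\<omega>. real (X i (t + k) \<omega>)) (\<lambda>\<omega>. real (X i t \<omega>))
          = coef_mean (m i) l ^ k * prob_space.variance M (\<lambda>\<omega>. real (X i t \<omega>)) \<and>
        correlation M (\<lambda>\<omega>. real (X i (t + k) \<omega>)) (\<lambda>\<omega>. real (X i t \<omega>))
          = coef_mean (m i) l ^ k) \<and>
     \<comment> \<open>(iii)\<close>
     integrable M (\<lambda>\<omega>. real (X i (t + k) \<omega>) * real (X j t \<omega>)) \<and>
     covariance M (\<lambda>\<omega>. real (X 1 t \<omega>)) (\<lambda>\<omega>. real (X 2 t \<omega>))
        = l\<^sup>2 * \<phi> / (l\<^sup>2 - m 1 * m 2) \<and>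
     covariance M (\<lambda>\<omega>. real (X i (t + k) \<omega>)) (\<lambda>\<omega>. real (X j t \<omega>))
        = m i ^ k * \<phi> / (l ^ k - l powi (int k - 2) * m 1 * m 2)"
proof -
  interpret stationary_brcmnbinar M m \<mu> \<sigma>Z l \<phi> fZ \<alpha> G Z X
    using process stationary by (simp add: stationary_brcmnbinar_def stationary_brcmnbinar_axioms_def)
  have ml: "0 < m i" "m i < l" "0 < l" using m_bounds[OF ij(1)] by auto
  have pair: "(i = 1 \<and> j = 2) \<or> (i = 2 \<and> j = 1)" using ij by auto
  have int: "integrable M (\<lambda>\<omega>. real (X i t \<omega>) * real (X j t \<omega>))"
    using pair cross_product_integrable[OF t] by (elim disjE conjE) (simp_all only: mult.commute)
  have C: "covariance M (\<lambda>\<omega>. real (X i t \<omega>)) (\<lambda>\<omega>. real (X j t \<omega>)) = l\<^sup>2 * \<phi> / (l\<^sup>2 - m 1 * m 2)"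
    using pair cross_covariance[OF t] by (elim disjE conjE) (simp_all only: covariance_commute)
  note lag = lagged_product[OF ij(1,2) t int, of k]
  have "covariance M (\<lambda>\<omega>. real (X i (t + k) \<omega>)) (\<lambda>\<omega>. real (X j t \<omega>))
      = coef_mean (m i) l ^ k * (l\<^sup>2 * \<phi> / (l\<^sup>2 - m 1 * m 2))"
    using lag unfolding C by blast
  also have "\<dots> = m i ^ k * \<phi> / (l ^ k - l powi (int k - 2) * m 1 * m 2)"
  proof -
    \<comment> \<open>Valid for every lag because \<open>l\<close> is nonzero; it pulls
      \<open>l ^ k\<close> out of the denominator.\<close>
    have "l powi (int k - 2) = l ^ k / l\<^sup>2"
      using ml by (simp add: power_int_diff)
    hence "l ^ k - l powi (int k - 2) * m 1 * m 2 = l ^ k * (l\<^sup>2 - m 1 * m 2) / l\<^sup>2"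
      using ml by (simp add: field_simps)
    thus ?thesis using ml by (simp add: coef_mean_def power_divide)
  qed
  finally have lagC: "covariance M (\<lambda>\<omega>. real (X i (t + k) \<omega>)) (\<lambda>\<omega>. real (X j t \<omega>))
      = m i ^ k * \<phi> / (l ^ k - l powi (int k - 2) * m 1 * m 2)" .
  have second: "integrable M (\<lambda>\<omega>. (real (X i t \<omega>))\<^sup>2)" if "0 < 1 - (coef_mean (m i) l)\<^sup>2 - coef_var (m i) l"
    using that by (intro X_square_integrable ij t) (simp add: coef_sq_mean_def)
  have auto_cov: "covariance M (\<lambda>\<omega>. real (X i (t + k) \<omega>)) (\<lambda>\<omega>. real (X i t \<omega>))
      = coef_mean (m i) l ^ k * variance (\<lambda>\<omega>. real (X i t \<omega>))"
    if "integrable M (\<lambda>\<omega>. (real (X i t \<omega>))\<^sup>2)" for k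
    using lagged_product[OF ij(1) ij(1) t, of k] that
    by (simp add: power2_eq_square covariance_def)
  have auto_corr: "correlation M (\<lambda>\<omega>. real (X i (t + k) \<omega>)) (\<lambda>\<omega>. real (X i t \<omega>)) = coef_mean (m i) l ^ k"
    if int2: "integrable M (\<lambda>\<omega>. (real (X i t \<omega>))\<^sup>2)"
  proof -
    \<comment> \<open>Both standard deviations agree, so their product is the variance that appears
      in the autocovariance and cancels.\<close>
    have "variance (\<lambda>\<omega>. real (X i (t + k) \<omega>)) = variance (\<lambda>\<omega>. real (X i t \<omega>))"
      using state_fun_stationary(2)[OF t, of "\<lambda>p. (real (coord i p) - expectation (\<lambda>\<omega>. real (X i t \<omega>)))\<^sup>2" k]
      by (simp only: coord_state[OF ij(1)] X_mean_stationary[OF ij(1) t])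
    thus ?thesis
      using X_variance(2)[OF ij(1) t int2] by (simp add: correlation_def auto_cov[OF int2])
  qed
  show ?thesis
    using cond_mean[OF ij(1), of t] cond_variance[OF ij(1), of t] cond_covariance[of t]
      X_mean(2)[OF ij(1) t] second X_variance(1)[OF ij(1) t] auto_cov[of k] auto_corr
      conjunct1[OF lag] cross_covariance[OF t] lagC
    unfolding cmean_def cvar_def by blast
qed

end
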